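(* Consider the game, the function $F$ and the zero-order procedure described in the context, and assume the game possesses a generalized Nash equilibrium. Let $\mu_F=2(\sigma^+_{\min}(G))^2$. Choose $\gamma_t=g/t$ with $g>1/\mu_F$, and any fixed $\sigma>0$, $\delta>0$. Then the iterates $\boldsymbol{x}(t)=[\boldsymbol{x}^1(t),\dots,\boldsymbol{x}^n(t)]$ converge almost surely to some (random) generalized Nash equilibrium of the game, and $\mathbb{E}F(\boldsymbol{x}(t),\boldsymbol{\lambda}(t))=O(1/t)$ as $t\to\infty$.
   Context: Game: $n$ players; player $i$ chooses $\boldsymbol{x}^i\in\mathbb{R}^d$; joint action $\boldsymbol{x}=[\boldsymbol{x}^1,\dots,\boldsymbol{x}^n]\in\mathbb{R}^{nd}$. Costs $J_i(\boldsymbol{x})=\tfrac12\boldsymbol{x}^\top Q_i\boldsymbol{x}+\boldsymbol{r}_i^\top\boldsymbol{x}+k_i$ with $Q_i\in\mathbb{R}^{nd\times nd}$ symmetric, $\boldsymbol{r}_i=[\boldsymbol{r}_i^1,\dots,\boldsymbol{r}_i^n]$, $\boldsymbol{r}_i^j\in\mathbb{R}^d$, $k_i\in\mathbb{R}$, $J_i$ convex in $\boldsymbol{x}^i$ for fixed $\boldsymbol{x}^{-i}$. Player $i$'s feasible set is $C_i(\boldsymbol{x}^{-i})=\{\boldsymbol{x}^i:\ A_i\boldsymbol{x}-\boldsymbol{b}_i=\boldsymbol{0}\}$, $A_i\in\mathbb{R}^{m_i\times nd}$, $\boldsymbol{b}_i\in\mathbb{R}^{m_i}$; $m=\sum_im_i$.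 A generalized Nash equilibrium (GNE) is $\boldsymbol{x}^*$ with $\boldsymbol{x}^{*,i}\in C_i(\boldsymbol{x}^{*,-i})$ for all $i$ and $J_i(\boldsymbol{x}^{*,i},\boldsymbol{x}^{*,-i})\le J_i(\boldsymbol{x}^i,\boldsymbol{x}^{*,-i})$ for all $i$ and $\boldsymbol{x}^i\in C_i(\boldsymbol{x}^{*,-i})$. Let $H_i\in\mathbb{R}^{d\times nd}$ be the $i$-th block of $d$ rows of $Q_i$ and $A_i^{[i]}\in\mathbb{R}^{m_i\times d}$ the block of $d$ columns of $A_i$ multiplying $\boldsymbol{x}^i$. For $\boldsymbol{\lambda}=[\boldsymbol{\lambda}^1,\dots,\boldsymbol{\lambda}^n]$, $\boldsymbol{\lambda}^i\in\mathbb{R}^{m_i}$, $F(\boldsymbol{x},\boldsymbol{\lambda})=\sum_{i=1}^n\big(\|H_i\boldsymbol{x}+\boldsymbol{r}_i^i+(A_i^{[i]})^\top\boldsymbol{\lambda}^i\|^2+\|A_i\boldsymbol{x}-\boldsymbol{b}_i\|^2\big)=\|G[\boldsymbol{x},\boldsymbol{\lambda}]+\mathbf{e}\|^2$, where $G=\begin{bmatrix}H_{\mathrm{stk}} & A^\top_{\mathrm{blk}}\\ A_{\mathrm{stk}} & 0\end{bmatrix}$, $\mathbf{e}=[\boldsymbol{r}_1^1,\dots,\boldsymbol{r}_n^n,-\boldsymbol{b}_1,\dots,-\boldsymbol{b}_n]$, with $H_{\mathrm{stk}}$ (resp. $A_{\mathrm{stk}}$) the vertical concatenation of $H_1,\dots,H_n$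 (resp. $A_1,\dots,A_n$) and $A^\top_{\mathrm{blk}}=\operatorname{blkdiag}((A_1^{[1]})^\top,\dots,(A_n^{[n]})^\top)$; $\sigma^+_{\min}(G)$ is the smallest positive singular value of $G$. Local Lagrangian $L_i(\boldsymbol{x},\boldsymbol{\lambda}^i)=J_i(\boldsymbol{x})+\langle\boldsymbol{\lambda}^i,A_i\boldsymbol{x}-\boldsymbol{b}_i\rangle$; $c_i(\boldsymbol{x})=\|A_i\boldsymbol{x}-\boldsymbol{b}_i\|^2$. Procedure (from an arbitrary initial $(\boldsymbol{x}(1),\boldsymbol{\lambda}(1))$): at each $t=1,2,\dots$ draw independent (of each other and the past) $\xi_x^i\sim\mathcal N(0,I_d)$, $\xi_\lambda^i\sim\mathcal N(0,I_{m_i})$, $\eta^i\sim\mathcal N(0,I_d)$, $i\in[n]$; $\xi_x=[\xi_x^1,\dots,\xi_x^n]$, $\eta=[\eta^1,\dots,\eta^n]$. Let $\tilde{\boldsymbol{x}}_{1,2}=\boldsymbol{x}(t)\mp\sigma\eta$, $\tilde{\boldsymbol{x}}_{3,4}=\boldsymbol{x}(t)+\delta\xi_x\mp\sigma\eta$, $\mathbf{y}_k^i=(\tilde{\boldsymbol{x}}_k,\boldsymbol{\lambda}^i(t))$ for $k=1,2$ and $\mathbf{y}_k^i=(\tilde{\boldsymbol{x}}_k,\boldsymbol{\lambda}^i(t)+\delta\xi_\lambda^i)$ for $k=3,4$. Set $\Delta_1^{(i)}=\frac{L_i(\mathbf{y}_2^i)-L_i(\mathbf{y}_1^i)}{2\sigma}$,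 $\Delta_2^{(i)}=\frac{L_i(\mathbf{y}_4^i)-L_i(\mathbf{y}_3^i)}{2\sigma}$, $\Delta_3^{(i)}=\frac{c_i(\tilde{\boldsymbol{x}}_2)-c_i(\tilde{\boldsymbol{x}}_1)}{2\sigma}$, $S_1^{(i)}=\frac{(\Delta_2^{(i)})^2-(\Delta_1^{(i)})^2}{\delta}$, $S_2^{(i)}=S_1^{(i)}\|\eta^i\|^2$, $S(t)=\tfrac12\sum_j(S_2^{(j)}-dS_1^{(j)})$, $D(t)=\sum_j\Delta_3^{(j)}$, $\zeta_{\boldsymbol{x}^i}(t)=S(t)\xi_x^i+D(t)\eta^i$, $\zeta_{\boldsymbol{\lambda}^i}(t)=\tfrac12(S_2^{(i)}-dS_1^{(i)})\xi_\lambda^i$, and update $\boldsymbol{x}^i(t+1)=\boldsymbol{x}^i(t)-\gamma_t\zeta_{\boldsymbol{x}^i}(t)$, $\boldsymbol{\lambda}^i(t+1)=\boldsymbol{\lambda}^i(t)-\gamma_t\zeta_{\boldsymbol{\lambda}^i}(t)$. *)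

theory Defs
  imports "HOL-Probability.Probability" "HOL-Library.Landau_Symbols"
begin

text \<open>Coordinates of the joint action x are indexed by pairs (i,k), i < n (player), k < d.
  Coordinates of the multiplier lambda are indexed by pairs (i,l), i < n, l < m_i.
  Q i p q is the entry (p,q) of Q_i; r i p is entry p of r_i; A i l p is entry (l,p) of A_i;
  b i l is entry l of b_i.\<close>

record game =
  np  :: nat
  dim :: nat
  mc  :: "nat \<Rightarrow> nat"
  Qm  :: "nat \<Rightarrow> nat \<times> nat \<Rightarrow> nat \<times> nat \<Rightarrow> real"
  rv  :: "nat \<Rightarrow> nat \<times> nat \<Rightarrow> real"
  kc  :: "nat \<Rightarrow> real"
  Am  :: "nat \<Rightarrow> nat \<Rightarrow> nat \<times> nat \<Rightarrow> real"
  bv  :: "nat \<Rightarrow> nat \<Rightarrow> real"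

definition xidx :: "game \<Rightarrow> (nat \<times> nat) set" where
  "xidx \<Gamma> = {0..<np \<Gamma>} \<times> {0..<dim \<Gamma>}"

definition lidx :: "game \<Rightarrow> (nat \<times> nat) set" where
  "lidx \<Gamma> = Sigma {0..<np \<Gamma>} (\<lambda>i. {0..<mc \<Gamma> i})"

definition resid :: "game \<Rightarrow> nat \<Rightarrow> nat \<Rightarrow> (nat \<times> nat \<Rightarrow> real) \<Rightarrow> real" where
  "resid \<Gamma> i l x = (\<Sum>p\<in>xidx \<Gamma>. Am \<Gamma> i l p * x p) - bv \<Gamma> i l"

definition Jc :: "game \<Rightarrow> nat \<Rightarrow> (nat \<times> nat \<Rightarrow> real) \<Rightarrow> real" where
  "Jc \<Gamma> i x = 1/2 * (\<Sum>p\<in>xidx \<Gamma>. \<Sum>q\<in>xidx \<Gamma>. x p * Qm \<Gamma> i p q * x q)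
      + (\<Sum>p\<in>xidx \<Gamma>. rv \<Gamma> i p * x p) + kc \<Gamma> i"

definition Lag :: "game \<Rightarrow> nat \<Rightarrow> (nat \<times> nat \<Rightarrow> real) \<Rightarrow> (nat \<times> nat \<Rightarrow> real) \<Rightarrow> real" where
  "Lag \<Gamma> i x lam = Jc \<Gamma> i x + (\<Sum>l<mc \<Gamma> i. lam (i, l) * resid \<Gamma> i l x)"

definition cfun :: "game \<Rightarrow> nat \<Rightarrow> (nat \<times> nat \<Rightarrow> real) \<Rightarrow> real" where
  "cfun \<Gamma> i x = (\<Sum>l<mc \<Gamma> i. (resid \<Gamma> i l x)\<^sup>2)"

definition repl :: "(nat \<times> nat \<Rightarrow> real) \<Rightarrow> nat \<Rightarrow> (nat \<Rightarrow> real) \<Rightarrow> (nat \<times> nat \<Rightarrow> real)" where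
  "repl x i y = (\<lambda>(j, k). if j = i then y k else x (j, k))"

definition feasible :: "game \<Rightarrow> nat \<Rightarrow> (nat \<times> nat \<Rightarrow> real) \<Rightarrow> bool" where
  "feasible \<Gamma> i x \<longleftrightarrow> (\<forall>l<mc \<Gamma> i. resid \<Gamma> i l x = 0)"

definition is_GNE :: "game \<Rightarrow> (nat \<times> nat \<Rightarrow> real) \<Rightarrow> bool" where
  "is_GNE \<Gamma> x \<longleftrightarrow> (\<forall>i<np \<Gamma>. feasible \<Gamma> i x \<and>
      (\<forall>y. feasible \<Gamma> i (repl x i y) \<longrightarrow> Jc \<Gamma> i x \<le> Jc \<Gamma> i (repl x i y)))"

definition standing_game :: "game \<Rightarrow> bool" where
  "standing_game \<Gamma> \<longleftrightarrow>
     (\<forall>i<np \<Gamma>. \<forall>p\<in>xidx \<Gamma>. \<forall>q\<in>xidx \<Gamma>. Qm \<Gamma> i p q = Qm \<Gamma> i q p) \<and>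
     (\<forall>i<np \<Gamma>. \<forall>x y z u. 0 \<le> u \<and> u \<le> 1 \<longrightarrow>
        Jc \<Gamma> i (repl x i (\<lambda>k. u * y k + (1 - u) * z k))
          \<le> u * Jc \<Gamma> i (repl x i y) + (1 - u) * Jc \<Gamma> i (repl x i z))"

definition Ffun :: "game \<Rightarrow> (nat \<times> nat \<Rightarrow> real) \<Rightarrow> (nat \<times> nat \<Rightarrow> real) \<Rightarrow> real" where
  "Ffun \<Gamma> x lam = (\<Sum>i<np \<Gamma>.
      (\<Sum>k<dim \<Gamma>. ((\<Sum>p\<in>xidx \<Gamma>. Qm \<Gamma> i (i, k) p * x p) + rv \<Gamma> i (i, k)
                    + (\<Sum>l<mc \<Gamma> i. Am \<Gamma> i l (i, k) * lam (i, l)))\<^sup>2)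
      + (\<Sum>l<mc \<Gamma> i. (resid \<Gamma> i l x)\<^sup>2))"

definition gidx :: "game \<Rightarrow> ((nat \<times> nat) + (nat \<times> nat)) set" where
  "gidx \<Gamma> = Inl ` xidx \<Gamma> \<union> Inr ` lidx \<Gamma>"

fun Gmat :: "game \<Rightarrow> (nat \<times> nat) + (nat \<times> nat) \<Rightarrow> (nat \<times> nat) + (nat \<times> nat) \<Rightarrow> real" where
  "Gmat \<Gamma> (Inl (i, k)) (Inl p) = Qm \<Gamma> i (i, k) p"
| "Gmat \<Gamma> (Inl (i, k)) (Inr (j, l)) = (if j = i then Am \<Gamma> i l (i, k) else 0)"
| "Gmat \<Gamma> (Inr (i, l)) (Inl p) = Am \<Gamma> i l p"
| "Gmat \<Gamma> (Inr _) (Inr _) = 0"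

definition sing_val :: "game \<Rightarrow> real \<Rightarrow> bool" where
  "sing_val \<Gamma> s \<longleftrightarrow> 0 \<le> s \<and> (\<exists>v. (\<exists>j\<in>gidx \<Gamma>. v j \<noteq> 0) \<and>
      (\<forall>j\<in>gidx \<Gamma>. (\<Sum>k\<in>gidx \<Gamma>. (\<Sum>rr\<in>gidx \<Gamma>. Gmat \<Gamma> rr j * Gmat \<Gamma> rr k) * v k) = s\<^sup>2 * v j))"

definition sigma_min_pos :: "game \<Rightarrow> real" where
  "sigma_min_pos \<Gamma> = Inf {s. 0 < s \<and> sing_val \<Gamma> s}"

definition zo_step :: "game \<Rightarrow> real \<Rightarrow> real \<Rightarrow> real \<Rightarrow> (nat \<times> nat \<Rightarrow> real) \<Rightarrow> (nat \<times> nat \<Rightarrow> real)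
    \<Rightarrow> (nat \<times> nat \<Rightarrow> real) \<Rightarrow> (nat \<times> nat \<Rightarrow> real) \<times> (nat \<times> nat \<Rightarrow> real)
    \<Rightarrow> (nat \<times> nat \<Rightarrow> real) \<times> (nat \<times> nat \<Rightarrow> real)" where
  "zo_step \<Gamma> \<sigma> \<delta> gam \<xi>x \<xi>l \<eta> st =
    (let x = fst st; lam = snd st;
         x1 = (\<lambda>p. x p - \<sigma> * \<eta> p);
         x2 = (\<lambda>p. x p + \<sigma> * \<eta> p);
         x3 = (\<lambda>p. x p + \<delta> * \<xi>x p - \<sigma> * \<eta> p);
         x4 = (\<lambda>p. x p + \<delta> * \<xi>x p + \<sigma> * \<eta> p);
         lamt = (\<lambda>q. lam q + \<delta> * \<xi>l q);
         D1 = (\<lambda>i. (Lag \<Gamma> i x2 lam - Lag \<Gamma> i x1 lam) / (2 * \<sigma>));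
         D2 = (\<lambda>i. (Lag \<Gamma> i x4 lamt - Lag \<Gamma> i x3 lamt) / (2 * \<sigma>));
         D3 = (\<lambda>i. (cfun \<Gamma> i x2 - cfun \<Gamma> i x1) / (2 * \<sigma>));
         S1 = (\<lambda>i. ((D2 i)\<^sup>2 - (D1 i)\<^sup>2) / \<delta>);
         S2 = (\<lambda>i. S1 i * (\<Sum>k<dim \<Gamma>. (\<eta> (i, k))\<^sup>2));
         S = 1/2 * (\<Sum>j<np \<Gamma>. S2 j - real (dim \<Gamma>) * S1 j);
         D = (\<Sum>j<np \<Gamma>. D3 j)
     in (\<lambda>p. x p - gam * (S * \<xi>x p + D * \<eta> p),
         \<lambda>(i, l). lam (i, l) - gam * (1/2 * (S2 i - real (dim \<Gamma>) * S1 i) * \<xi>l (i, l))))"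

text \<open>Iterates: zo_iter ... k \<omega> is (x(k+1), lambda(k+1)). The noise drawn at time t is
  xi_x(t) p = Z (t,0,p), xi_lambda(t) q = Z (t,1,q), eta(t) p = Z (t,2,p); gamma_t = g/t.\<close>
fun zo_iter :: "game \<Rightarrow> real \<Rightarrow> real \<Rightarrow> real \<Rightarrow> (nat \<times> nat \<Rightarrow> real) \<Rightarrow> (nat \<times> nat \<Rightarrow> real)
    \<Rightarrow> (nat \<times> nat \<times> (nat \<times> nat) \<Rightarrow> 'w \<Rightarrow> real) \<Rightarrow> nat \<Rightarrow> 'w
    \<Rightarrow> (nat \<times> nat \<Rightarrow> real) \<times> (nat \<times> nat \<Rightarrow> real)" where
  "zo_iter \<Gamma> \<sigma> \<delta> g x0 l0 Z 0 \<omega> = (x0, l0)"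
| "zo_iter \<Gamma> \<sigma> \<delta> g x0 l0 Z (Suc k) \<omega> =
     zo_step \<Gamma> \<sigma> \<delta> (g / real (Suc k))
       (\<lambda>p. Z (Suc k, 0, p) \<omega>) (\<lambda>q. Z (Suc k, 1, q) \<omega>) (\<lambda>p. Z (Suc k, 2, p) \<omega>)
       (zo_iter \<Gamma> \<sigma> \<delta> g x0 l0 Z k \<omega>)"

end

theory Submission
  imports Defs
begin

text \<open>
  Write z = (x, lambda), F(z) = |Gz + e|^2. A KKT argument identifies the generalized Nash
  equilibria with the x-components of zeros of F. All costs being quadratic, the finite
  differences are exact, so the search direction Y(t) is affine in z with coefficients polynomial
  in the Gaussian noise; Wick-type moment identities give E[Y(t) | past] = grad F(z), and
  E|Y(t)|^2 \<le> K (1 + |z - z*|^2) for a zero z* of F.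

  Since F(z*) = 0, the inner product of grad F(z) and z - z* is 2 F(z) \<ge> 0, so E|z - z*|^2 stays
  bounded because the squared step sizes are summable. With |grad F|^2 \<ge> 4 sigma^2 F (spectral gap of G
  on its range) this gives E F(t+1) \<le> (1 - 4 sigma^2 g/t) E F(t) + C/t^2, hence the rate O(1/t).
  For almost sure convergence, the accumulated noise is an L2-bounded martingale and converges;
  subtracting it leaves, path by path, gradient descent with a vanishing perturbation. Its residual
  tends to 0 by the spectral gap of G, and as its increments lie in the range of G^T, the gap of
  G^T turns convergence of the residuals into convergence of the iterates.
\<close>

section \<open>Linear algebra over finite index sets\<close>

text \<open>The obstacle is that G may be singular. The zeros of F then form an affine set along
  which the drift contracts nothing, and the second moment of the search direction is controlled by
  the distance to a fixed zero, not by F. Boundedness of that distance in mean square must therefore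
  come first; only then is the noise in the recursion for F of size C/t^2. The limit depends on the
  accumulated noise, so it has to be found path by path. The step condition says 4 sigma^2 g > 2,
  since mu_F = 2 sigma^2; this lets an induction with hypothesis D/t close directly. Unbiasedness
  rests on the factor |eta^i|^2 - d, a sum of second Hermite polynomials: it reduces the products
  eta_p eta_q to p = q in the block of player i. The term of order delta is odd in the xi and has
  mean zero for every delta. Conditional means are used in weak form, tested against
  square-integrable functions of the past. Dimensions vary with the game, so vectors and matrices
  are functions read on finite index sets.\<close>

definition matvec :: "('r \<Rightarrow> 'c \<Rightarrow> real) \<Rightarrow> 'c set \<Rightarrow> ('c \<Rightarrow> real) \<Rightarrow> 'r \<Rightarrow> real" where
  "matvec G C x r = (\<Sum>c\<in>C. G r c * x c)"

definition ip :: "'i set \<Rightarrow> ('i \<Rightarrow> real) \<Rightarrow> ('i \<Rightarrow> real) \<Rightarrow> real" where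
  "ip I x y = (\<Sum>i\<in>I. x i * y i)"

abbreviation (input) tr :: "('r \<Rightarrow> 'c \<Rightarrow> real) \<Rightarrow> 'c \<Rightarrow> 'r \<Rightarrow> real" where
  "tr G \<equiv> (\<lambda>c r. G r c)"

lemma ip_adjoint: "ip R (matvec G C x) u = ip C x (matvec (tr G) R u)"
  unfolding ip_def matvec_def sum_distrib_left sum_distrib_right
  by (subst sum.swap) (simp add: mult_ac)

lemma ip_commute: "ip I x y = ip I y x"
  by (simp add: ip_def mult.commute)

lemma ip_nonneg: "0 \<le> ip I x x"
  by (simp add: ip_def sum_nonneg)

lemma ip_cong: "(\<And>i. i \<in> I \<Longrightarrow> x i = x' i) \<Longrightarrow> (\<And>i. i \<in> I \<Longrightarrow> y i = y' i) \<Longrightarrow> ip I x y = ip I x' y'"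
  by (simp add: ip_def)

lemma matvec_cong: "(\<And>c. c \<in> C \<Longrightarrow> x c = x' c) \<Longrightarrow> matvec G C x = matvec G C x'"
  by (simp add: matvec_def fun_eq_iff)

lemma ip_self_eq_0_iff: "finite I \<Longrightarrow> ip I x x = 0 \<longleftrightarrow> (\<forall>i\<in>I. x i = 0)"
  by (simp add: ip_def sum_nonneg_eq_0_iff)

lemma ip_add_scaled: "ip I (\<lambda>i. x i + e * y i) (\<lambda>i. x i + e * y i) = ip I x x + 2 * e * ip I x y + e\<^sup>2 * ip I y y"
  unfolding ip_def sum_distrib_left sum.distrib[symmetric]
  by (intro sum.cong refl) (simp add: power2_eq_square algebra_simps)

lemma ip_diff_left: "ip I (\<lambda>i. x i - e * y i) z = ip I x z - e * ip I y z"
  unfolding ip_def sum_distrib_left sum_subtractf[symmetric]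
  by (intro sum.cong refl) (simp add: algebra_simps)

lemma ip_scale: "ip I (\<lambda>i. a * x i) (\<lambda>i. b * y i) = a * b * ip I x y"
  unfolding ip_def sum_distrib_left by (simp add: mult_ac)

lemma matvec_add_scaled: "matvec G C (\<lambda>c. x c + e * y c) r = matvec G C x r + e * matvec G C y r"
  unfolding matvec_def sum_distrib_left sum.distrib[symmetric]
  by (intro sum.cong refl) (simp add: algebra_simps)

lemma matvec_diff_scaled: "matvec G C (\<lambda>c. x c - e * y c) r = matvec G C x r - e * matvec G C y r"
  using matvec_add_scaled[of G C x "-e" y r] by simp

lemma matvec_diff: "matvec G C (\<lambda>c. x c - y c) r = matvec G C x r - matvec G C y r"
  using matvec_diff_scaled[of G C x 1 y r] by simp

lemma matvec_scale: "matvec G C (\<lambda>c. e * y c) r = e * matvec G C y r"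
  unfolding matvec_def sum_distrib_left by (simp add: mult_ac)

lemma ip_le_matvec_sqr:
  "ip R (matvec G C x) (matvec G C x) \<le> (\<Sum>r\<in>R. \<Sum>c\<in>C. (G r c)\<^sup>2) * ip C x x"
proof -
  have "matvec G C x r * matvec G C x r \<le> (\<Sum>c\<in>C. (G r c)\<^sup>2) * ip C x x" for r
    using Cauchy_Schwarz_ineq_sum[of "G r" x C] by (simp add: matvec_def ip_def power2_eq_square)
  then show ?thesis
    unfolding ip_def[of R] sum_distrib_right by (intro sum_mono)
qed

text \<open>This supplies both the Lagrange multipliers of an equilibrium and the description of a
  range as the complement of a kernel. Rows are added one at a time. If some \<open>w0\<close> is
  killed by the old rows but not by the new row \<open>l\<close>, the multiple \<open>k\<close> of
  row \<open>l\<close> is subtracted from \<open>g\<close> so that the rest annihilates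
  \<open>w0\<close>. A vector killed by the old rows is a multiple of \<open>w0\<close> plus a
  vector killed by all rows, so the induction hypothesis applies to the rest.\<close>

lemma kernel_annihilator_in_row_span:
  fixes A :: "'l \<Rightarrow> 'c \<Rightarrow> real"
  assumes "finite L" "finite C"
    and "\<And>w. (\<And>l. l \<in> L \<Longrightarrow> matvec A C w l = 0) \<Longrightarrow> ip C g w = 0"
  shows "\<exists>lam. \<forall>c\<in>C. g c = matvec (tr A) L lam c"
  using assms(1,3)
proof (induction L arbitrary: g rule: finite_induct)
  case empty
  have "g c = 0" if "c \<in> C" for c
  proof -
    have "ip C g (\<lambda>c'. if c' = c then 1 else 0) = 0" by (rule empty) simp
    then show ?thesis using \<open>finite C\<close> that by (simp add: ip_def if_distrib cong: if_cong)
  qed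
  then show ?case by (auto simp: matvec_def)
next
  case (insert l L)
  show ?case
  proof (cases "\<exists>w0. (\<forall>l'\<in>L. matvec A C w0 l' = 0) \<and> matvec A C w0 l \<noteq> 0")
    case False
    then have "\<exists>lam. \<forall>c\<in>C. g c = matvec (tr A) L lam c"
      by (intro insert.IH insert.prems) auto
    then obtain lam where lam: "\<forall>c\<in>C. g c = matvec (tr A) L lam c" by blast
    have "matvec (tr A) (insert l L) (lam(l := 0)) c = matvec (tr A) L lam c" for c
      using insert.hyps by (auto simp: matvec_def intro!: sum.cong)
    then show ?thesis using lam by (metis (no_types))
  next
    case True
    then obtain w0 where w0: "\<And>l'. l' \<in> L \<Longrightarrow> matvec A C w0 l' = 0" and nz: "matvec A C w0 l \<noteq> 0" by blast
    define k where "k = ip C g w0 / matvec A C w0 l"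
    have "\<exists>lam. \<forall>c\<in>C. g c - k * A l c = matvec (tr A) L lam c"
    proof (rule insert.IH)
      fix w assume w: "\<And>l'. l' \<in> L \<Longrightarrow> matvec A C w l' = 0"
      define s where "s = matvec A C w l / matvec A C w0 l"
      have "ip C g (\<lambda>c. w c - s * w0 c) = 0"
      proof (rule insert.prems)
        show "matvec A C (\<lambda>c. w c - s * w0 c) l' = 0" if "l' \<in> insert l L" for l'
          unfolding matvec_diff_scaled using that w w0 nz by (auto simp: s_def)
      qed
      then have "ip C g w = s * ip C g w0"
        using ip_diff_left[of C w s w0 g] by (simp add: ip_commute)
      moreover have "ip C (\<lambda>c. g c - k * A l c) w = ip C g w - k * matvec A C w l"
        unfolding ip_diff_left by (simp add: ip_def matvec_def)
      ultimately show "ip C (\<lambda>c. g c - k * A l c) w = 0"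
        using nz by (simp add: s_def k_def field_simps)
    qed
    then obtain lam where lam: "\<And>c. c \<in> C \<Longrightarrow> g c - k * A l c = matvec (tr A) L lam c" by blast
    have "matvec (tr A) (insert l L) (lam(l := k)) c = k * A l c + matvec (tr A) L lam c" for c
    proof -
      have "(\<Sum>x\<in>L. A x c * (lam(l := k)) x) = (\<Sum>x\<in>L. A x c * lam x)"
        using insert.hyps by (intro sum.cong) auto
      then show ?thesis using insert.hyps by (simp add: matvec_def)
    qed
    then have "\<forall>c\<in>C. g c = matvec (tr A) (insert l L) (lam(l := k)) c"
      using lam by (metis add.commute diff_add_cancel)
    then show ?thesis by blast
  qed
qed

text \<open>For a small negative \<open>e\<close> the linear term wins; dividing by
  \<open>\<bar>k\<bar> + 1\<close> keeps the quadratic contribution \<open>e * k\<close> below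
  \<open>a\<close> in absolute value.\<close>

lemma quadratic_nonneg_imp_linear_zero:
  fixes a k :: real
  assumes "\<And>e. 0 \<le> 2 * e * a + e\<^sup>2 * k" and "0 \<le> a"
  shows "a = 0"
proof (rule ccontr)
  assume "a \<noteq> 0"
  then have a: "a > 0" using assms(2) by simp
  define e where "e = - a / (\<bar>k\<bar> + 1)"
  have e: "e < 0" using a by (simp add: e_def divide_neg_pos)
  have "\<bar>e * k\<bar> = a * (\<bar>k\<bar> / (\<bar>k\<bar> + 1))"
    using a by (simp add: e_def abs_mult)
  also have "\<dots> \<le> a * 1"
    using a by (intro mult_left_mono) (auto simp: divide_le_eq)
  finally have "2 * a + e * k > 0" using a by linarith
  then have "e * (2 * a + e * k) < 0" using e by (simp add: mult_neg_pos)
  then show False using assms(1)[of e] by (simp add: power2_eq_square algebra_simps)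
qed

text \<open>Variational proof: minimise |G^T u|^2 over unit vectors of the range of G. The first
  variation makes the minimiser \<open>us\<close> an eigenvector of G G^T with eigenvalue
  \<open>m\<close>, hence G^T \<open>us\<close> one of G^T G, and homogeneity turns minimality into
  the gap inequality. Giving an eigenvector along with the gap is what later identifies
  \<open>m\<close> as the square of the least positive singular value.\<close>

lemma spectral_gap:
  fixes G :: "'r \<Rightarrow> 'c \<Rightarrow> real"
  assumes finR: "finite R" and fC: "finite C" and nz: "\<exists>r\<in>R. \<exists>c\<in>C. G r c \<noteq> 0"
  obtains m v where "m > 0" "\<exists>c\<in>C. v c \<noteq> 0"
    "\<And>c. c \<in> C \<Longrightarrow> matvec (tr G) R (matvec G C v) c = m * v c"
    "\<And>v. m * ip R (matvec G C v) (matvec G C v)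
        \<le> ip C (matvec (tr G) R (matvec G C v)) (matvec (tr G) R (matvec G C v))"
proof -
  let ?g = "matvec G C" and ?t = "matvec (tr G) R"
  define f where "f u = ip C (?t u) (?t u)" for u
  \<comment> \<open>The row type may be infinite. Pinning the coordinates outside \<open>R\<close>
    to 0 and the others to [-1, 1] gives a set that is compact by Tychonoff.\<close>
  define P where "P = PiE UNIV (\<lambda>r. if r \<in> R then {-1..1::real} else {0})"
  \<comment> \<open>The range of G is expressed as the orthogonal complement of the kernel of G^T,
    which is visibly closed.\<close>
  define U where "U = P \<inter> {u. ip R u u = 1 \<and> (\<forall>w. (\<forall>c\<in>C. ?t w c = 0) \<longrightarrow> ip R u w = 0)}"
  have cont_ip: "continuous_on UNIV (\<lambda>u::'r \<Rightarrow> real. ip R u w)" for w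
    unfolding ip_def by (intro continuous_intros continuous_on_product_coordinates)
  have cont_ip2: "continuous_on UNIV (\<lambda>u::'r \<Rightarrow> real. ip R u u)"
    unfolding ip_def by (intro continuous_intros continuous_on_product_coordinates)
  have cont_f: "continuous_on UNIV f"
    unfolding f_def ip_def matvec_def by (intro continuous_intros continuous_on_product_coordinates)
  have "compact P"
    unfolding P_def compactin_euclidean_iff[symmetric] euclidean_product_topology[symmetric] compactin_PiE
    by auto
  moreover have "closed {u. ip R u u = 1 \<and> (\<forall>w. (\<forall>c\<in>C. ?t w c = 0) \<longrightarrow> ip R u w = 0)}"
    by (intro closed_Collect_conj closed_Collect_all closed_Collect_imp closed_Collect_eq cont_ip cont_ip2
        continuous_on_const open_Collect_const)
  ultimately have compU: "compact U" unfolding U_def by (rule compact_Int_closed)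
  have normalized: "(\<lambda>r. if r \<in> R then ?g v r / sqrt (ip R (?g v) (?g v)) else 0) \<in> U" (is "?u \<in> U")
    if pos: "ip R (?g v) (?g v) > 0" for v
  proof -
    let ?n = "ip R (?g v) (?g v)"
    have u: "ip R ?u w = ip R (?g v) w / sqrt ?n" for w
      unfolding ip_def sum_divide_distrib by (intro sum.cong) auto
    have "ip R ?u ?u = ip R ?u (?g v) / sqrt ?n"
      unfolding u[of ?u] by (simp only: ip_commute)
    also have "ip R ?u (?g v) = ?n / sqrt ?n" by (rule u)
    also have "?n / sqrt ?n / sqrt ?n = 1"
      using pos real_sqrt_mult_self[of ?n] by (simp only: divide_divide_eq_left) simp
    finally have uu: "ip R ?u ?u = 1" .
    have "?u r \<in> {-1..1}" if "r \<in> R" for r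
    proof -
      have "(?u r)\<^sup>2 \<le> (\<Sum>r\<in>R. (?u r)\<^sup>2)" using that finR by (intro member_le_sum) auto
      also have "\<dots> = 1" using uu by (simp add: ip_def power2_eq_square)
      finally show ?thesis by (simp add: abs_square_le_1 abs_le_iff)
    qed
    then have "?u \<in> P" by (auto simp: P_def)
    moreover have "ip R ?u w = 0" if "\<forall>c\<in>C. ?t w c = 0" for w
      using that unfolding u[of w] ip_adjoint[of R G C v w] by (simp add: ip_def)
    ultimately show ?thesis using uu by (simp add: U_def)
  qed
  obtain r0 c0 where rc: "r0 \<in> R" "c0 \<in> C" "G r0 c0 \<noteq> 0" using nz by blast
  have "?g (\<lambda>c. if c = c0 then 1 else 0) r0 \<noteq> 0"
    using rc fC by (simp add: matvec_def mult_delta_right)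
  then have "ip R (?g (\<lambda>c. if c = c0 then 1 else 0)) (?g (\<lambda>c. if c = c0 then 1 else 0)) > 0"
    using rc(1) ip_self_eq_0_iff[OF finR, of "?g (\<lambda>c. if c = c0 then 1 else 0)"]
      ip_nonneg[of R "?g (\<lambda>c. if c = c0 then 1 else 0)"] by force
  then have "U \<noteq> {}" using normalized by blast
  then obtain us where us: "us \<in> U" and min: "\<And>u. u \<in> U \<Longrightarrow> f us \<le> f u"
    using continuous_attains_inf[OF compU _ continuous_on_subset[OF cont_f subset_UNIV]] by blast
  define m where "m = f us"
  have us1: "ip R us us = 1" and us0: "\<And>w. (\<forall>c\<in>C. ?t w c = 0) \<Longrightarrow> ip R us w = 0"
    using us by (auto simp: U_def)
  have lower: "m * ip R (?g v) (?g v) \<le> f (?g v)" for v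
  proof (cases "ip R (?g v) (?g v) = 0")
    case True
    then show ?thesis by (simp add: f_def ip_nonneg)
  next
    case False
    let ?n = "ip R (?g v) (?g v)"
    have n: "?n > 0" using False ip_nonneg[of R "?g v"] by simp
    let ?u = "\<lambda>r. if r \<in> R then ?g v r / sqrt ?n else 0"
    have t: "?t ?u = (\<lambda>c. (1 / sqrt ?n) * ?t (?g v) c)"
      unfolding matvec_def[of "tr G"] sum_distrib_left by (intro ext sum.cong) auto
    have "m \<le> f ?u" using min normalized[OF n] by (simp add: m_def)
    also have "f ?u = f (?g v) / ?n"
      unfolding f_def t ip_scale using n by (simp flip: real_sqrt_mult)
    finally show ?thesis using n by (simp add: field_simps)
  qed
  have "\<exists>a. \<forall>r\<in>R. us r = matvec (tr (tr G)) C a r"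
    by (rule kernel_annihilator_in_row_span[OF fC finR]) (use us0 in blast)
  then obtain a where a: "\<And>r. r \<in> R \<Longrightarrow> us r = ?g a r" by auto
  \<comment> \<open>On \<open>R\<close>, G \<open>b\<close> is the defect G G^T \<open>us\<close> -
    m \<open>us\<close> of the eigenvalue equation. Perturbing \<open>a\<close> by \<open>b\<close>
    stays in the range, and the first variation in that direction is the squared norm of the
    defect.\<close>
  define b where "b c = ?t us c - m * a c" for c
  have ta: "?t (?g a) = ?t us" by (rule matvec_cong) (simp add: a)
  have gb: "?g b r = ?g (?t us) r - m * us r" if "r \<in> R" for r
    unfolding b_def matvec_diff_scaled using a that by simp
  have ipgb: "ip R (?g b) (?g b) = ip C (?t us) (?t (?g b)) - m * ip R us (?g b)"
  proof -
    have "ip R (?g b) (?g b) = ip R (\<lambda>r. ?g (?t us) r - m * us r) (?g b)"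
      by (intro ip_cong) (simp_all add: gb)
    then show ?thesis unfolding ip_diff_left by (simp only: ip_adjoint)
  qed
  have "ip R (?g b) (?g b) = 0"
  proof (rule quadratic_nonneg_imp_linear_zero[OF _ ip_nonneg])
    fix e :: real
    let ?v = "\<lambda>c. a c + e * b c"
    have g: "?g ?v = (\<lambda>r. ?g a r + e * ?g b r)" by (simp add: matvec_add_scaled fun_eq_iff)
    have "?t (?g ?v) = (\<lambda>c. ?t us c + e * ?t (?g b) c)"
      unfolding g by (simp add: matvec_add_scaled fun_eq_iff ta)
    then have "f (?g ?v) = m + 2 * e * ip C (?t us) (?t (?g b)) + e\<^sup>2 * f (?g b)"
      unfolding f_def m_def by (simp only: ip_add_scaled)
    moreover have "ip R (?g ?v) (?g ?v) = 1 + 2 * e * ip R us (?g b) + e\<^sup>2 * ip R (?g b) (?g b)"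
    proof -
      have "ip R (?g a) (?g a) = 1" "ip R (?g a) (?g b) = ip R us (?g b)"
        using us1 a by (simp_all add: ip_def)
      then show ?thesis unfolding g by (simp only: ip_add_scaled)
    qed
    ultimately have "0 \<le> 2 * e * (ip C (?t us) (?t (?g b)) - m * ip R us (?g b))
        + e\<^sup>2 * (f (?g b) - m * ip R (?g b) (?g b))"
      using lower[of ?v] by (simp only: distrib_left right_diff_distrib mult.assoc mult.left_commute[of m])
    then show "0 \<le> 2 * e * ip R (?g b) (?g b) + e\<^sup>2 * (f (?g b) - m * ip R (?g b) (?g b))"
      unfolding ipgb[symmetric] .
  qed
  then have eig: "?g (?t us) r = m * us r" if "r \<in> R" for r
    using gb that ip_self_eq_0_iff[OF finR, of "?g b"] by simp
  \<comment> \<open>A unit vector orthogonal to the kernel of G^T is not in that kernel; this gives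
    both the positivity of \<open>m\<close> and a nonzero eigenvector.\<close>
  have nz': "\<exists>c\<in>C. ?t us c \<noteq> 0"
    using us0[of us] us1 by auto
  show thesis
  proof
    show "m > 0"
      using nz' ip_self_eq_0_iff[OF fC, of "?t us"] ip_nonneg[of C "?t us"] by (auto simp: m_def f_def less_le)
    show "\<exists>c\<in>C. ?t us c \<noteq> 0" by (rule nz')
    show "?t (?g (?t us)) c = m * ?t us c" for c
    proof -
      have "?t (?g (?t us)) c = ?t (\<lambda>r. m * us r) c"
        by (rule fun_cong[OF matvec_cong]) (simp add: eig)
      then show ?thesis by (simp add: matvec_scale)
    qed
    show "m * ip R (?g v) (?g v) \<le> ip C (?t (?g v)) (?t (?g v))" for v
      using lower[of v] by (simp add: f_def)
  qed
qed

section \<open>Recursive inequalities with harmonic step sizes\<close>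

text \<open>With s = k + 1 and f k \<le> K/s, the factor is at most 1 - 2/s. Since (s - 2)(s + 1) =
  s^2 - s - 2, there remains a slack K (s + 2), which absorbs C (s + 1).\<close>

lemma chung_sequence_bound:
  fixes f :: "nat \<Rightarrow> real"
  assumes nonneg: "\<And>k. 0 \<le> f k" and C: "0 \<le> C" and \<alpha>: "2 \<le> \<alpha>"
    and step: "\<And>k. f (Suc k) \<le> (1 - \<alpha> / real (Suc k)) * f k + C / (real (Suc k))\<^sup>2"
  shows "f k \<le> (f 0 + 2 * C) / real (Suc k)"
proof (induction k)
  case 0
  then show ?case using C by simp
next
  case (Suc k)
  define s where "s = real (Suc k)"
  define K where "K = f 0 + 2 * C"
  have s: "s \<ge> 1" and K: "K \<ge> 2 * C" using nonneg[of 0] by (simp_all add: s_def K_def)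
  have fs: "f (Suc k) \<le> (1 - \<alpha> / s) * f k + C / s\<^sup>2" using step[of k] by (simp add: s_def)
  have "f (Suc k) \<le> K / (s + 1)"
  \<comment> \<open>In the early steps the factor is not positive and the induction hypothesis
    cannot be multiplied by it. Its term is dropped instead, and the part 2 C of \<open>K\<close>
    covers C/s^2, as s + 1 \<le> 2 s^2.\<close>
  proof (cases "s \<le> \<alpha>")
    case True
    then have "(1 - \<alpha> / s) * f k \<le> 0" using s nonneg by (intro mult_nonpos_nonneg) (auto simp: field_simps)
    then have "f (Suc k) \<le> C / s\<^sup>2" using fs by linarith
    also have "\<dots> \<le> K / (s + 1)"
    proof -
      have "C * (s + 1) \<le> (2 * C) * (s * s)"
      proof -
        have "s + 1 \<le> 2 * (s * s)" using s mult_mono[of 1 s 1 s] mult_left_mono[of 1 s s] by linarith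
        then have "C * (s + 1) \<le> C * (2 * (s * s))" using C by (rule mult_left_mono)
        then show ?thesis by (simp add: algebra_simps)
      qed
      also have "\<dots> \<le> K * (s * s)" using K s by (intro mult_right_mono) auto
      finally show ?thesis using s by (simp add: divide_simps power2_eq_square)
    qed
    finally show ?thesis .
  next
    case False
    then have "(1 - \<alpha> / s) * f k \<le> (1 - \<alpha> / s) * (K / s)"
      using s Suc by (intro mult_left_mono) (auto simp: K_def s_def field_simps)
    also have "\<dots> \<le> (1 - 2 / s) * (K / s)"
      using s \<alpha> K C by (intro mult_right_mono) (auto simp: field_simps)
    finally have "f (Suc k) \<le> (1 - 2 / s) * (K / s) + C / s\<^sup>2" using fs by linarith
    also have "\<dots> = ((s - 2) * K + C) / s\<^sup>2"
      using s by (simp add: field_simps power2_eq_square)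
    also have "\<dots> \<le> K / (s + 1)"
    proof -
      have "C * (s + 1) \<le> K * (s + 1)" using C K s by (intro mult_right_mono) auto
      then have "C * (s + 1) \<le> K * (s + 2)" using C K by (simp add: algebra_simps)
      then have "((s - 2) * K + C) * (s + 1) \<le> K * s\<^sup>2"
        by (simp add: algebra_simps power2_eq_square)
      then show ?thesis using s by (simp add: divide_simps)
    qed
    finally show ?thesis .
  qed
  then show ?case by (simp add: s_def K_def add.commute)
qed

text \<open>Discrete Gronwall argument: 1 + a is multiplied by at most exp(C/s^2) in each step, and
  the exponents are summable.\<close>

lemma bounded_if_summable_growth:
  fixes a :: "nat \<Rightarrow> real"
  assumes nonneg: "\<And>k. 0 \<le> a k" and C: "0 \<le> C"
    and step: "\<And>k. a (Suc k) \<le> a k + C / (real (Suc k))\<^sup>2 * (1 + a k)"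
  shows "\<exists>B. \<forall>k. a k \<le> B"
proof -
  define S where "S k = (\<Sum>i<k. C / (real (Suc i))\<^sup>2)" for k
  have "1 + a k \<le> exp (S k) * (1 + a 0)" for k
  proof (induction k)
    case (Suc k)
    have "1 + a (Suc k) \<le> (1 + C / (real (Suc k))\<^sup>2) * (1 + a k)"
      using step[of k] by (simp add: algebra_simps)
    also have "\<dots> \<le> exp (C / (real (Suc k))\<^sup>2) * (exp (S k) * (1 + a 0))"
      using nonneg[of k] C Suc by (intro mult_mono exp_ge_add_one_self) auto
    finally show ?case by (simp add: S_def exp_add mult_ac)
  qed (simp add: S_def)
  moreover have "S k \<le> C * (\<Sum>i. 1 / (real (Suc i))\<^sup>2)" for k
  proof -
    have "summable (\<lambda>i. 1 / (real (Suc i))\<^sup>2)"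
      using inverse_power_summable[of 2, where 'a=real] by (subst summable_Suc_iff) (simp add: inverse_eq_divide)
    then have "(\<Sum>i<k. 1 / (real (Suc i))\<^sup>2) \<le> (\<Sum>i. 1 / (real (Suc i))\<^sup>2)"
      by (intro sum_le_suminf) auto
    then have "C * (\<Sum>i<k. 1 / (real (Suc i))\<^sup>2) \<le> C * (\<Sum>i. 1 / (real (Suc i))\<^sup>2)"
      using C by (rule mult_left_mono)
    then show ?thesis by (simp add: S_def sum_distrib_left)
  qed
  ultimately have "1 + a k \<le> exp (C * (\<Sum>i. 1 / (real (Suc i))\<^sup>2)) * (1 + a 0)" for k
    using nonneg[of 0] by (meson order_trans mult_right_mono exp_le_cancel_iff add_nonneg_nonneg zero_le_one)
  then show ?thesis by (intro exI[of _ "exp (C * (\<Sum>i. 1 / (real (Suc i))\<^sup>2)) * (1 + a 0) - 1"]) (smt (verit))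
qed

text \<open>The perturbation only tends to 0, without a rate, so it is absorbed at an arbitrary
  positive level \<open>d\<close>. The excess over \<open>d\<close> is then contracted by factors 1
  - c/k, whose product is at most exp of -c times a harmonic sum and tends to 0.\<close>

lemma tendsto_zero_if_harmonic_contraction:
  fixes a e :: "nat \<Rightarrow> real"
  assumes nonneg: "\<And>k. 0 \<le> a k" and c: "0 < c" and e: "e \<longlonglongrightarrow> 0"
    and step: "\<And>k. k \<ge> N \<Longrightarrow> a (Suc k) \<le> (1 - c / real (Suc k)) * a k + e k / real (Suc k)"
  shows "a \<longlonglongrightarrow> 0"
proof (rule tendstoI)
  fix \<epsilon> :: real assume "\<epsilon> > 0"
  define d where "d = \<epsilon> / 2"
  have d: "d > 0" using \<open>\<epsilon> > 0\<close> by (simp add: d_def)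
  have "\<forall>\<^sub>F k in sequentially. e k < c * d"
    using e d c by (intro order_tendstoD(2)[OF e]) auto
  moreover have "\<forall>\<^sub>F k in sequentially. c \<le> real (Suc k)"
    using filterlim_compose[OF filterlim_real_sequentially filterlim_Suc] by (simp add: filterlim_at_top)
  ultimately have "\<forall>\<^sub>F k in sequentially. k \<ge> N \<and> e k < c * d \<and> c \<le> real (Suc k)"
    using eventually_ge_at_top[of N] by eventually_elim auto
  then obtain k1 where k1: "\<And>k. k \<ge> k1 \<Longrightarrow> k \<ge> N \<and> e k < c * d \<and> c \<le> real (Suc k)"
    unfolding eventually_sequentially by blast
  \<comment> \<open>Once e k < c d, the level \<open>d\<close> is preserved by the recursion, so the
    excess obeys the homogeneous one. Truncation at 0 keeps it nonnegative, as needed for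
    multiplying the bounds.\<close>
  define b where "b k = max 0 (a k - d)" for k
  have b_step: "b (Suc k) \<le> (1 - c / real (Suc k)) * b k" if "k \<ge> k1" for k
  proof -
    define s where "s = real (Suc k)"
    have s: "s > 0" "c \<le> s" "e k \<le> c * d" using k1[OF that] by (auto simp: s_def)
    have "a (Suc k) \<le> (1 - c / s) * a k + e k / s" using step k1[OF that] by (simp add: s_def)
    also have "\<dots> \<le> (1 - c / s) * a k + c * d / s" using s by (intro add_left_mono divide_right_mono) auto
    finally have "a (Suc k) - d \<le> (1 - c / s) * (a k - d)" using s by (simp add: field_simps)
    also have "\<dots> \<le> (1 - c / s) * b k" using s by (intro mult_left_mono) (auto simp: b_def field_simps)
    finally have "a (Suc k) - d \<le> (1 - c / s) * b k" .
    moreover have "0 \<le> (1 - c / s) * b k" using s by (intro mult_nonneg_nonneg) (auto simp: b_def field_simps)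
    ultimately show ?thesis by (simp add: b_def s_def)
  qed
  have bound: "b (k1 + n) \<le> exp (- c * (harm (k1 + n) - harm k1)) * b k1" for n
  proof (induction n)
    case (Suc n)
    have "b (k1 + Suc n) \<le> (1 - c / real (Suc (k1 + n))) * b (k1 + n)" using b_step[of "k1 + n"] by simp
    also have "\<dots> \<le> exp (- c / real (Suc (k1 + n))) * (exp (- c * (harm (k1 + n) - harm k1)) * b k1)"
      using Suc exp_ge_add_one_self[of "- c / real (Suc (k1 + n))"]
      by (intro mult_mono) (auto simp: b_def)
    also have "\<dots> = exp (- c * (harm (k1 + Suc n) - harm k1)) * b k1"
      by (simp add: harm_Suc exp_add[symmetric] algebra_simps inverse_eq_divide flip: mult.assoc)
    finally show ?case .
  qed simp
  have "filterlim (\<lambda>n. harm (k1 + n) :: real) at_top sequentially"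
    using filterlim_compose[OF harm_at_top, of "\<lambda>n. k1 + n" sequentially]
    by (simp add: filterlim_add_const_nat_at_top add.commute)
  then have "filterlim (\<lambda>n. - harm k1 + harm (k1 + n) :: real) at_top sequentially"
    by (rule filterlim_tendsto_add_at_top[OF tendsto_const])
  then have "filterlim (\<lambda>n. (harm (k1 + n) - harm k1) * c) at_top sequentially"
    using filterlim_at_top_mult_tendsto_pos[OF tendsto_const c] by (simp add: add.commute)
  then have "(\<lambda>n. exp (- ((harm (k1 + n) - harm k1) * c))) \<longlonglongrightarrow> 0"
    by (intro filterlim_compose[OF exp_at_bot]) (simp add: filterlim_uminus_at_bot)
  then have "(\<lambda>n. exp (- c * (harm (k1 + n) - harm k1)) * b k1) \<longlonglongrightarrow> 0 * b k1"
    by (intro tendsto_mult tendsto_const) (simp add: mult.commute)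
  then have "\<forall>\<^sub>F n in sequentially. exp (- c * (harm (k1 + n) - harm k1)) * b k1 < d"
    using d by (intro order_tendstoD(2)) auto
  then have "\<forall>\<^sub>F n in sequentially. b (n + k1) < d"
  proof eventually_elim
    case (elim n)
    then show ?case using bound[of n] by (simp add: add.commute)
  qed
  then have "\<forall>\<^sub>F n in sequentially. b n < d" using eventually_sequentially_seg by blast
  then show "\<forall>\<^sub>F n in sequentially. dist (a n) 0 < \<epsilon>"
  proof eventually_elim
    case (elim n)
    then show ?case using nonneg[of n] by (auto simp: b_def d_def max_def split: if_splits)
  qed
qed

section \<open>Gradient descent with a vanishing perturbation\<close>

lemma ip_le_half_squares: "ip I x y \<le> (ip I x x + ip I y y) / 2"
proof -
  have "ip I (\<lambda>i. x i + (-1) * y i) (\<lambda>i. x i + (-1) * y i) \<ge> 0" by (rule ip_nonneg)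
  then show ?thesis unfolding ip_add_scaled by simp
qed

lemma ip_diff_self_le: "ip I (\<lambda>i. x i - y i) (\<lambda>i. x i - y i) \<le> 2 * (ip I x x + ip I y y)"
proof -
  have "ip I (\<lambda>i. x i + 1 * y i) (\<lambda>i. x i + 1 * y i) \<ge> 0" by (rule ip_nonneg)
  moreover have "ip I (\<lambda>i. x i - y i) (\<lambda>i. x i - y i) = ip I x x - 2 * ip I x y + ip I y y"
    using ip_add_scaled[of I x "-1" y] by simp
  ultimately show ?thesis unfolding ip_add_scaled by simp
qed

lemma square_le_ip: "finite I \<Longrightarrow> i \<in> I \<Longrightarrow> (x i)\<^sup>2 \<le> ip I x x"
  unfolding ip_def power2_eq_square by (rule member_le_sum) auto

text \<open>The gradient is taken at \<open>y n - e n\<close>, which will be the actual iterate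
  relative to a zero of F, while \<open>y\<close> is its noise-free shift. The perturbation of the
  residual recursion is the fixed linear image \<open>s\<close> of \<open>e\<close>, so convergence
  of \<open>e\<close> to 0 suffices, without a rate. The increments of \<open>y\<close> have no
  component in the kernel of G, which is why \<open>y\<close> cannot drift along the set of
  zeros.\<close>

lemma perturbed_gradient_descent_converges:
  fixes G :: "'r \<Rightarrow> 'c \<Rightarrow> real" and y e :: "nat \<Rightarrow> 'c \<Rightarrow> real"
  assumes finR: "finite R" and fC: "finite C" and g: "g > 0"
    and step: "\<And>n c. c \<in> C \<Longrightarrow> y (Suc n) c = y n c
        - 2 * (g / real (Suc n)) * matvec (tr G) R (matvec G C (\<lambda>c. y n c - e n c)) c"
    and e0: "\<And>c. c \<in> C \<Longrightarrow> (\<lambda>n. e n c) \<longlonglongrightarrow> 0"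
    and m: "m > 0" and gap: "\<And>v. m * ip R (matvec G C v) (matvec G C v)
        \<le> ip C (matvec (tr G) R (matvec G C v)) (matvec (tr G) R (matvec G C v))"
    and m': "m' > 0" and gap': "\<And>v. m' * ip C (matvec (tr G) R v) (matvec (tr G) R v)
        \<le> ip R (matvec G C (matvec (tr G) R v)) (matvec G C (matvec (tr G) R v))"
  shows "\<exists>w. (\<forall>c\<in>C. (\<lambda>n. y n c) \<longlonglongrightarrow> w c) \<and> (\<forall>r\<in>R. matvec G C w r = 0)"
proof -
  define U where "U n = matvec G C (y n)" for n
  define q where "q n = matvec (tr G) R (U n)" for n
  define s where "s n = matvec (tr G) R (matvec G C (e n))" for n
  define L where "L = (\<Sum>r\<in>R. \<Sum>c\<in>C. (G r c)\<^sup>2)"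
  define a where "a n = ip R (U n) (U n)" for n
  have y_step: "y (Suc n) c = y n c + (- (2 * (g / real (Suc n)))) * (q n c - s n c)" if "c \<in> C" for n c
  proof -
    have "matvec G C (\<lambda>c. y n c - e n c) = (\<lambda>r. U n r - matvec G C (e n) r)"
      by (simp add: matvec_diff fun_eq_iff U_def)
    then show ?thesis using step[OF that, of n] by (simp add: matvec_diff q_def s_def)
  qed
  have U_step: "U (Suc n) = (\<lambda>r. U n r + (- (2 * (g / real (Suc n)))) * matvec G C (\<lambda>c. q n c - s n c) r)" for n
  proof -
    have "U (Suc n) = matvec G C (\<lambda>c. y n c + (- (2 * (g / real (Suc n)))) * (q n c - s n c))"
      unfolding U_def by (rule matvec_cong) (rule y_step)
    then show ?thesis by (simp only: matvec_add_scaled fun_eq_iff U_def) simp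
  qed
  \<comment> \<open>Here \<open>L\<close> is the squared Frobenius norm of G. Once the step h is at
    most 1/(8 L), the quadratic term costs at most h |q|^2, half of the decrease 2 h |q|^2 left by
    the linear term; the remaining h |q|^2 is at least h m a by \<open>gap\<close>.\<close>
  have a_step: "a (Suc n) \<le> (1 - (g * m) / real (Suc n)) * a n + (3 * g * ip C (s n) (s n)) / real (Suc n)"
    if n: "8 * g * L \<le> real (Suc n)" for n
  proof -
    define h where "h = g / real (Suc n)"
    have h: "h > 0" using g by (simp add: h_def)
    have hL: "8 * h * L \<le> 1" using n by (simp add: h_def field_simps)
    let ?d = "\<lambda>c. q n c - s n c"
    have "ip R (U n) (matvec G C ?d) = ip C ?d (q n)"
      using ip_adjoint[of R G C ?d "U n"] by (simp add: ip_commute q_def)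
    also have "\<dots> = ip C (q n) (q n) - ip C (s n) (q n)"
      using ip_diff_left[of C "q n" 1 "s n" "q n"] by simp
    finally have lin: "ip R (U n) (matvec G C ?d) \<ge> ip C (q n) (q n) / 2 - ip C (s n) (s n) / 2"
      using ip_le_half_squares[of C "s n" "q n"] by (simp add: field_simps)
    have "ip R (matvec G C ?d) (matvec G C ?d) \<le> L * ip C ?d ?d"
      unfolding L_def by (rule ip_le_matvec_sqr)
    also have "\<dots> \<le> L * (2 * (ip C (q n) (q n) + ip C (s n) (s n)))"
      by (intro mult_left_mono ip_diff_self_le) (simp add: L_def sum_nonneg)
    finally have "h * (4 * h * ip R (matvec G C ?d) (matvec G C ?d))
        \<le> h * (4 * h * (L * (2 * (ip C (q n) (q n) + ip C (s n) (s n)))))"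
      using h by (intro mult_left_mono) auto
    also have "\<dots> = h * ((8 * h * L) * (ip C (q n) (q n) + ip C (s n) (s n)))" by simp
    also have "\<dots> \<le> h * (1 * (ip C (q n) (q n) + ip C (s n) (s n)))"
      using h hL by (intro mult_left_mono mult_right_mono add_nonneg_nonneg ip_nonneg) auto
    finally have quad: "4 * h * h * ip R (matvec G C ?d) (matvec G C ?d) \<le> h * (ip C (q n) (q n) + ip C (s n) (s n))"
      by simp
    have "a (Suc n) = a n - 4 * h * ip R (U n) (matvec G C ?d) + 4 * h * h * ip R (matvec G C ?d) (matvec G C ?d)"
      unfolding a_def U_step ip_add_scaled h_def by (simp add: power2_eq_square)
    also have "\<dots> \<le> a n - 4 * h * (ip C (q n) (q n) / 2 - ip C (s n) (s n) / 2)
        + h * (ip C (q n) (q n) + ip C (s n) (s n))"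
      using lin quad h by (intro add_mono diff_left_mono mult_left_mono) auto
    also have "\<dots> = a n - h * ip C (q n) (q n) + 3 * h * ip C (s n) (s n)"
      by (simp add: algebra_simps)
    also have "\<dots> \<le> a n - h * (m * a n) + 3 * h * ip C (s n) (s n)"
      using gap[of "y n"] h by (intro add_right_mono diff_left_mono mult_left_mono) (auto simp: a_def q_def U_def)
    finally show ?thesis by (simp add: h_def algebra_simps)
  qed
  have s0: "(\<lambda>n. s n c) \<longlonglongrightarrow> 0" for c
    unfolding s_def matvec_def by (intro tendsto_null_sum tendsto_mult_right_zero e0)
  have e3: "(\<lambda>n. 3 * g * ip C (s n) (s n)) \<longlonglongrightarrow> 0"
    unfolding ip_def by (intro tendsto_mult_right_zero tendsto_null_sum tendsto_mult_zero s0)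
  have large: "8 * g * L \<le> real (Suc n)" if "n \<ge> nat \<lceil>8 * g * L\<rceil>" for n
    using that by linarith
  have gm: "0 < g * m" using g m by simp
  have a_nonneg: "0 \<le> a n" for n by (simp add: a_def ip_nonneg)
  have a0: "a \<longlonglongrightarrow> 0"
    by (rule tendsto_zero_if_harmonic_contraction[OF a_nonneg gm e3 a_step[OF large]])
  have "\<exists>b. \<forall>c\<in>C. y n c - y 0 c = matvec (tr G) R b c" for n
  proof (induction n)
    case 0
    show ?case by (rule exI[of _ "\<lambda>r. 0"]) (simp add: matvec_def)
  next
    case (Suc n)
    then obtain b where b: "\<And>c. c \<in> C \<Longrightarrow> y n c - y 0 c = matvec (tr G) R b c" by blast
    have "q n c - s n c = matvec (tr G) R (\<lambda>r. U n r - matvec G C (e n) r) c" for c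
      by (simp add: matvec_diff q_def s_def)
    then have "y (Suc n) c - y 0 c = matvec (tr G) R (\<lambda>r. b r + (- (2 * (g / real (Suc n)))) * (U n r - matvec G C (e n) r)) c"
      if "c \<in> C" for c
      using y_step[OF that, of n] b[OF that] by (simp only: matvec_add_scaled)
    then show ?case by blast
  qed
  then obtain b where b: "\<And>n c. c \<in> C \<Longrightarrow> y n c - y 0 c = matvec (tr G) R (b n) c" by metis
  have dist: "(y n c - y k c)\<^sup>2 \<le> 2 * (a n + a k) / m'" if c: "c \<in> C" for n k c
  proof -
    let ?b = "\<lambda>r. b n r - b k r"
    have eq: "y n c - y k c = matvec (tr G) R ?b c" if "c \<in> C" for c
      using b[OF that, of n] b[OF that, of k] by (simp add: matvec_diff)
    have "matvec G C (matvec (tr G) R ?b) = matvec G C (\<lambda>c. y n c - y k c)"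
      by (rule matvec_cong) (simp add: eq)
    also have "\<dots> = (\<lambda>r. U n r - U k r)" by (simp add: matvec_diff U_def fun_eq_iff)
    finally have eqU: "matvec G C (matvec (tr G) R ?b) = (\<lambda>r. U n r - U k r)" .
    have "m' * (y n c - y k c)\<^sup>2 \<le> m' * ip C (matvec (tr G) R ?b) (matvec (tr G) R ?b)"
      using m' square_le_ip[OF fC c, of "matvec (tr G) R ?b"] eq[OF c] by (intro mult_left_mono) auto
    also have "\<dots> \<le> ip R (\<lambda>r. U n r - U k r) (\<lambda>r. U n r - U k r)"
      using gap'[of ?b] unfolding eqU .
    also have "\<dots> \<le> 2 * (a n + a k)" unfolding a_def by (rule ip_diff_self_le)
    finally show ?thesis using m' by (simp add: field_simps)
  qed
  have "convergent (\<lambda>n. y n c)" if c: "c \<in> C" for c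
  proof -
    have "Cauchy (\<lambda>n. y n c)"
    proof (rule metric_CauchyI)
      fix \<epsilon> :: real assume "\<epsilon> > 0"
      then have "\<forall>\<^sub>F n in sequentially. a n < \<epsilon>\<^sup>2 * m' / 4"
        using m' by (intro order_tendstoD(2)[OF a0]) auto
      then obtain N where N: "\<And>n. n \<ge> N \<Longrightarrow> a n < \<epsilon>\<^sup>2 * m' / 4"
        unfolding eventually_sequentially by blast
      have "dist (y i c) (y j c) < \<epsilon>" if "i \<ge> N" "j \<ge> N" for i j
      proof -
        have "(y i c - y j c)\<^sup>2 \<le> 2 * (a i + a j) / m'" by (rule dist[OF c])
        also have "\<dots> < \<epsilon>\<^sup>2" using N[OF that(1)] N[OF that(2)] m' by (simp add: field_simps)
        finally show ?thesis using \<open>\<epsilon> > 0\<close> by (intro power2_less_imp_less[of _ \<epsilon>]) (auto simp: dist_real_def)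
      qed
      then show "\<exists>N. \<forall>i\<ge>N. \<forall>j\<ge>N. dist (y i c) (y j c) < \<epsilon>" by blast
    qed
    then show ?thesis by (simp add: Cauchy_convergent)
  qed
  then obtain w where w: "\<And>c. c \<in> C \<Longrightarrow> (\<lambda>n. y n c) \<longlonglongrightarrow> w c"
    unfolding convergent_def by metis
  have "matvec G C w r = 0" if r: "r \<in> R" for r
  proof -
    have "(\<lambda>n. U n r) \<longlonglongrightarrow> matvec G C w r"
      unfolding U_def matvec_def by (intro tendsto_intros w)
    moreover have "(\<lambda>n. U n r) \<longlonglongrightarrow> 0"
    proof -
      have "(\<lambda>n. (U n r)\<^sup>2) \<longlonglongrightarrow> 0"
        using a0 by (rule tendsto_sandwich[OF _ _ tendsto_const, rotated 2])
          (auto simp: a_def square_le_ip[OF finR r])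
      then have "(\<lambda>n. sqrt ((U n r)\<^sup>2)) \<longlonglongrightarrow> sqrt 0" by (rule tendsto_real_sqrt)
      then show ?thesis by (simp add: tendsto_rabs_zero_iff)
    qed
    ultimately show ?thesis by (rule LIMSEQ_unique)
  qed
  then show ?thesis using w by blast
qed

section \<open>Convergence of square-integrable martingales\<close>

definition sq_int :: "'w measure \<Rightarrow> ('w \<Rightarrow> real) \<Rightarrow> bool" where
  "sq_int M X \<longleftrightarrow> X \<in> borel_measurable M \<and> integrable M (\<lambda>\<omega>. (X \<omega>)\<^sup>2)"

lemma sq_int_measurable [measurable_dest]: "sq_int M X \<Longrightarrow> X \<in> borel_measurable M"
  by (simp add: sq_int_def)

lemma sq_int_square: "sq_int M X \<Longrightarrow> integrable M (\<lambda>\<omega>. (X \<omega>)\<^sup>2)"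
  by (simp add: sq_int_def)

lemma sq_int_bound:
  assumes "sq_int M X" "Y \<in> borel_measurable M" "\<And>\<omega>. \<bar>Y \<omega>\<bar> \<le> \<bar>X \<omega>\<bar>"
  shows "sq_int M Y"
  unfolding sq_int_def
proof (intro conjI Bochner_Integration.integrable_bound[OF sq_int_square[OF assms(1)]])
  show "AE \<omega> in M. norm ((Y \<omega>)\<^sup>2) \<le> norm ((X \<omega>)\<^sup>2)"
    using assms(3) by (simp add: abs_le_square_iff)
qed (use assms(2) in measurable)

lemma integrable_mult_sq_int:
  assumes "sq_int M X" "sq_int M Y"
  shows "integrable M (\<lambda>\<omega>. X \<omega> * Y \<omega>)"
proof (rule Bochner_Integration.integrable_bound)
  show "integrable M (\<lambda>\<omega>. (X \<omega>)\<^sup>2 + (Y \<omega>)\<^sup>2)"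
    using assms by (simp add: sq_int_def)
  show "AE \<omega> in M. norm (X \<omega> * Y \<omega>) \<le> norm ((X \<omega>)\<^sup>2 + (Y \<omega>)\<^sup>2)"
  proof (intro AE_I2)
    fix \<omega>
    have "2 * (\<bar>X \<omega>\<bar> * \<bar>Y \<omega>\<bar>) \<le> (X \<omega>)\<^sup>2 + (Y \<omega>)\<^sup>2"
      using sum_squares_bound[of "\<bar>X \<omega>\<bar>" "\<bar>Y \<omega>\<bar>"] by (simp add: mult.assoc)
    moreover have "0 \<le> \<bar>X \<omega>\<bar> * \<bar>Y \<omega>\<bar>" by simp
    ultimately have "\<bar>X \<omega>\<bar> * \<bar>Y \<omega>\<bar> \<le> (X \<omega>)\<^sup>2 + (Y \<omega>)\<^sup>2" by linarith
    then show "norm (X \<omega> * Y \<omega>) \<le> norm ((X \<omega>)\<^sup>2 + (Y \<omega>)\<^sup>2)"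
      by (simp add: abs_mult)
  qed
qed (use assms in measurable)

lemma sq_int_add:
  assumes "sq_int M X" "sq_int M Y"
  shows "sq_int M (\<lambda>\<omega>. X \<omega> + Y \<omega>)"
proof -
  have "(\<lambda>\<omega>. (X \<omega> + Y \<omega>)\<^sup>2) = (\<lambda>\<omega>. (X \<omega>)\<^sup>2 + (Y \<omega>)\<^sup>2 + 2 * (X \<omega> * Y \<omega>))"
    by (simp add: fun_eq_iff power2_eq_square algebra_simps)
  then show ?thesis using assms integrable_mult_sq_int[OF assms] by (simp add: sq_int_def borel_measurable_add)
qed

lemma sq_int_scale: "sq_int M X \<Longrightarrow> sq_int M (\<lambda>\<omega>. c * X \<omega>)"
  by (simp add: sq_int_def power_mult_distrib borel_measurable_times)

lemma sq_int_diff: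
  assumes "sq_int M X" "sq_int M Y"
  shows "sq_int M (\<lambda>\<omega>. X \<omega> - Y \<omega>)"
  using sq_int_add[OF assms(1) sq_int_scale[OF assms(2), of "-1"]] by simp

lemma sq_int_sum: "(\<And>i. i \<in> I \<Longrightarrow> sq_int M (X i)) \<Longrightarrow> sq_int M (\<lambda>\<omega>. \<Sum>i\<in>I. X i \<omega>)"
proof (induction I rule: infinite_finite_induct)
  case (insert i I)
  then show ?case by (simp add: sq_int_add)
qed (simp_all add: sq_int_def)

lemma (in prob_space) sq_int_const: "sq_int M (\<lambda>\<omega>. c)"
  by (simp add: sq_int_def)

lemma expectation_square_add:
  assumes "sq_int M X" "sq_int M Y"
  shows "(\<integral>\<omega>. (X \<omega> + Y \<omega>)\<^sup>2 \<partial>M) = (\<integral>\<omega>. (X \<omega>)\<^sup>2 \<partial>M) + 2 * (\<integral>\<omega>. X \<omega> * Y \<omega> \<partial>M) + (\<integral>\<omega>. (Y \<omega>)\<^sup>2 \<partial>M)"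
proof -
  have "(\<lambda>\<omega>. (X \<omega> + Y \<omega>)\<^sup>2) = (\<lambda>\<omega>. (X \<omega>)\<^sup>2 + 2 * (X \<omega> * Y \<omega>) + (Y \<omega>)\<^sup>2)"
    by (simp add: fun_eq_iff power2_eq_square algebra_simps)
  then show ?thesis using assms integrable_mult_sq_int[OF assms] by (simp add: sq_int_def)
qed

text \<open>\<open>orth\<close> is the vanishing of the conditional mean given \<open>F k\<close> in
  weak form. Square-integrable test functions are enough, because the argument lives in L2.\<close>

locale martingale_differences = prob_space M for M :: "'w measure" +
  fixes F :: "nat \<Rightarrow> 'w measure" and X :: "nat \<Rightarrow> 'w \<Rightarrow> real"
  assumes sub: "\<And>k. subalgebra M (F k)"
    and mono: "\<And>k. subalgebra (F (Suc k)) (F k)"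
    and adapted: "\<And>k. X k \<in> borel_measurable (F (Suc k))"
    and X_sq: "\<And>k. sq_int M (X k)"
    and orth: "\<And>k h. h \<in> borel_measurable (F k) \<Longrightarrow> sq_int M h \<Longrightarrow> (\<integral>\<omega>. X k \<omega> * h \<omega> \<partial>M) = 0"
begin

definition psum :: "nat \<Rightarrow> 'w \<Rightarrow> real" where
  "psum n \<omega> = (\<Sum>i<n. X i \<omega>)"

definition small :: "real \<Rightarrow> nat \<Rightarrow> 'w \<Rightarrow> bool" where
  "small e n \<omega> \<longleftrightarrow> (\<forall>j\<le>n. \<bar>psum j \<omega>\<bar> < e)"

text \<open>The partial sums stopped when they first leave the interval (-e, e).\<close>

primrec stopped :: "real \<Rightarrow> nat \<Rightarrow> 'w \<Rightarrow> real" where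
  "stopped e 0 \<omega> = 0"
| "stopped e (Suc n) \<omega> = stopped e n \<omega> + (if small e n \<omega> then X n \<omega> else 0)"

lemma sub_le: "i \<le> j \<Longrightarrow> subalgebra (F j) (F i)"
proof (induction j)
  case (Suc j)
  then show ?case using mono[of j] by (cases "i = Suc j") (auto simp: subalgebra_def le_Suc_eq)
qed (simp add: subalgebra_def)

lemma measurable_up: "i \<le> j \<Longrightarrow> f \<in> borel_measurable (F i) \<Longrightarrow> f \<in> borel_measurable (F j)"
  using measurable_from_subalg sub_le by blast

lemma psum_measurable: "psum n \<in> borel_measurable (F n)"
proof (induction n)
  case (Suc n)
  have "psum n \<in> borel_measurable (F (Suc n))" using Suc measurable_up[of n "Suc n"] by simp
  then show ?case using adapted[of n] unfolding psum_def by simp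
qed (simp add: psum_def)

lemma small_measurable: "Measurable.pred (F n) (small e n)"
proof -
  have [measurable]: "psum (min j n) \<in> borel_measurable (F n)" for j
    by (rule measurable_up[OF _ psum_measurable]) simp
  \<comment> \<open>Cutting the index off with \<open>min\<close> turns the bounded quantifier into
    a countable conjunction of conditions measurable in \<open>F n\<close>.\<close>
  have "small e n = (\<lambda>\<omega>. \<forall>j. \<bar>psum (min j n) \<omega>\<bar> < e)"
    unfolding small_def by (auto simp: fun_eq_iff min_def)
  then show ?thesis by simp
qed

lemma stopped_measurable: "stopped e n \<in> borel_measurable (F n)"
proof (induction n)
  case (Suc n)
  have [measurable]: "stopped e n \<in> borel_measurable (F (Suc n))" using Suc measurable_up[of n "Suc n"] by simp
  have [measurable]: "Measurable.pred (F (Suc n)) (small e n)"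
    using small_measurable[where n=n and e=e] sub_le[of n "Suc n"] by (auto intro: measurable_from_subalg)
  note adapted[measurable]
  show ?case unfolding stopped.simps by measurable
qed (simp)

text \<open>After the first exit the stopped sum is frozen outside (-e, e). An excursion of the path
  at any time up to n is thus visible in the single value at time n, to which Markov's inequality
  applies.\<close>

lemma stopped_invariant:
  "(small e n \<omega> \<longrightarrow> stopped e n \<omega> = psum n \<omega>) \<and> (\<not> small e n \<omega> \<longrightarrow> e \<le> \<bar>stopped e n \<omega>\<bar>)"
proof (induction n)
  case 0
  then show ?case by (auto simp: small_def psum_def)
next
  case (Suc n)
  have sm: "small e (Suc n) \<omega> \<longleftrightarrow> small e n \<omega> \<and> \<bar>psum (Suc n) \<omega>\<bar> < e"
    by (auto simp: small_def le_Suc_eq)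
  show ?case using Suc by (auto simp: sm psum_def)
qed

lemma stopped_second_moment: "sq_int M (stopped e n) \<and> (\<integral>\<omega>. (stopped e n \<omega>)\<^sup>2 \<partial>M) \<le> (\<Sum>i<n. \<integral>\<omega>. (X i \<omega>)\<^sup>2 \<partial>M)"
proof (induction n)
  case 0
  then show ?case by (simp add: sq_int_const)
next
  case (Suc n)
  define Y where "Y \<omega> = (if small e n \<omega> then X n \<omega> else 0)" for \<omega>
  \<comment> \<open>The event that the sum is still running is known at time n. Moving its indicator
    from the increment to the past factor makes \<open>h\<close> an admissible test function in
    \<open>orth\<close>, so the stopped increments are orthogonal too.\<close>
  define h where "h \<omega> = (if small e n \<omega> then stopped e n \<omega> else 0)" for \<omega>
  note [measurable] = stopped_measurable[where n=n and e=e] small_measurable[where n=n and e=e]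
  have pM[measurable]: "Measurable.pred M (small e n)"
    using small_measurable[where n=n and e=e] sub[of n] by (auto intro: measurable_from_subalg)
  have XM[measurable]: "X n \<in> borel_measurable M" using X_sq by (rule sq_int_measurable)
  have hF: "h \<in> borel_measurable (F n)" unfolding h_def by measurable
  have hsq: "sq_int M h"
    using Suc measurable_from_subalg[OF sub hF] by (auto intro: sq_int_bound[of M "stopped e n"] simp: h_def)
  have "Y \<in> borel_measurable M" unfolding Y_def by measurable
  then have Ysq: "sq_int M Y"
    by (intro sq_int_bound[OF X_sq[of n]]) (auto simp: Y_def)
  have "(\<integral>\<omega>. stopped e n \<omega> * Y \<omega> \<partial>M) = (\<integral>\<omega>. X n \<omega> * h \<omega> \<partial>M)"
    by (intro Bochner_Integration.integral_cong) (auto simp: Y_def h_def)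
  then have cross: "(\<integral>\<omega>. stopped e n \<omega> * Y \<omega> \<partial>M) = 0" using orth[OF hF hsq] by simp
  have "(\<integral>\<omega>. (Y \<omega>)\<^sup>2 \<partial>M) \<le> (\<integral>\<omega>. (X n \<omega>)\<^sup>2 \<partial>M)"
    using Ysq X_sq[of n] by (intro integral_mono) (auto simp: sq_int_def Y_def)
  moreover have "stopped e (Suc n) = (\<lambda>\<omega>. stopped e n \<omega> + Y \<omega>)" by (simp add: Y_def fun_eq_iff)
  ultimately show ?case
    using Suc Ysq cross expectation_square_add[of M "stopped e n" Y] by (simp add: sq_int_add)
qed

lemma kolmogorov_maximal_inequality:
  assumes "e > 0"
  shows "prob {\<omega>\<in>space M. \<exists>j\<le>n. e \<le> \<bar>psum j \<omega>\<bar>} \<le> (\<Sum>i<n. \<integral>\<omega>. (X i \<omega>)\<^sup>2 \<partial>M) / e\<^sup>2"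
proof -
  have Rsq: "sq_int M (stopped e n)" using stopped_second_moment by blast
  then have [measurable]: "stopped e n \<in> borel_measurable M" by (rule sq_int_measurable)
  have "prob {\<omega>\<in>space M. \<exists>j\<le>n. e \<le> \<bar>psum j \<omega>\<bar>} \<le> prob {\<omega>\<in>space M. e\<^sup>2 \<le> (stopped e n \<omega>)\<^sup>2}"
  proof (rule finite_measure_mono)
    show "{\<omega>\<in>space M. \<exists>j\<le>n. e \<le> \<bar>psum j \<omega>\<bar>} \<subseteq> {\<omega>\<in>space M. e\<^sup>2 \<le> (stopped e n \<omega>)\<^sup>2}"
    proof safe
      fix \<omega> j assume "j \<le> n" "e \<le> \<bar>psum j \<omega>\<bar>"
      then have "\<not> small e n \<omega>" by (auto simp: small_def not_less)
      then have "e \<le> \<bar>stopped e n \<omega>\<bar>" using stopped_invariant by blast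
      then show "e\<^sup>2 \<le> (stopped e n \<omega>)\<^sup>2" using assms by (simp add: abs_le_square_iff[symmetric])
    qed
  qed measurable
  also have "\<dots> \<le> (\<integral>\<omega>. (stopped e n \<omega>)\<^sup>2 \<partial>M) / e\<^sup>2"
    using integral_Markov_inequality_measure[of M "\<lambda>\<omega>. (stopped e n \<omega>)\<^sup>2" "{}" "e\<^sup>2"] Rsq assms
    by (simp add: sq_int_def)
  also have "\<dots> \<le> (\<Sum>i<n. \<integral>\<omega>. (X i \<omega>)\<^sup>2 \<partial>M) / e\<^sup>2"
    using stopped_second_moment by (intro divide_right_mono) auto
  finally show ?thesis .
qed

lemma maximal_inequality_infinite:
  assumes "e > 0" "summable (\<lambda>i. \<integral>\<omega>. (X i \<omega>)\<^sup>2 \<partial>M)"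
  shows "prob {\<omega>\<in>space M. \<exists>j. e \<le> \<bar>psum j \<omega>\<bar>} \<le> (\<Sum>i. \<integral>\<omega>. (X i \<omega>)\<^sup>2 \<partial>M) / e\<^sup>2"
proof -
  have [measurable]: "psum j \<in> borel_measurable M" for j
    using measurable_from_subalg[OF sub psum_measurable] .
  let ?A = "\<lambda>n. {\<omega>\<in>space M. \<exists>j\<le>n. e \<le> \<bar>psum j \<omega>\<bar>}"
  have "(\<lambda>n. prob (?A n)) \<longlonglongrightarrow> prob (\<Union>n. ?A n)"
  proof (rule finite_Lim_measure_incseq)
    have "?A n \<in> events" for n by measurable
    then show "range ?A \<subseteq> events" by blast
    show "incseq ?A" by (auto simp: incseq_def intro: order_trans)
  qed
  moreover have "(\<Union>n. ?A n) = {\<omega>\<in>space M. \<exists>j. e \<le> \<bar>psum j \<omega>\<bar>}" by auto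
  ultimately have lim: "(\<lambda>n. prob (?A n)) \<longlonglongrightarrow> prob {\<omega>\<in>space M. \<exists>j. e \<le> \<bar>psum j \<omega>\<bar>}" by (simp only:)
  have bound: "prob (?A n) \<le> (\<Sum>i. \<integral>\<omega>. (X i \<omega>)\<^sup>2 \<partial>M) / e\<^sup>2" for n
  proof -
    have "(\<Sum>i<n. \<integral>\<omega>. (X i \<omega>)\<^sup>2 \<partial>M) \<le> (\<Sum>i. \<integral>\<omega>. (X i \<omega>)\<^sup>2 \<partial>M)"
      using assms(2) by (intro sum_le_suminf) auto
    then show ?thesis
      by (intro order_trans[OF kolmogorov_maximal_inequality[OF assms(1)]] divide_right_mono) auto
  qed
  show ?thesis by (rule LIMSEQ_le_const2[OF lim]) (use bound in blast)
qed

end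

text \<open>The maximal inequality for the sequence shifted by m bounds the oscillation after m by
  the tail of the variances. As m grows, the event of oscillating by at least e after every m gets
  probability 0; taking e = 1/(q+1) for all q gives the Cauchy property almost surely.\<close>

theorem (in martingale_differences) AE_convergent_sum:
  assumes summ: "summable (\<lambda>i. \<integral>\<omega>. (X i \<omega>)\<^sup>2 \<partial>M)"
  shows "AE \<omega> in M. convergent (\<lambda>n. \<Sum>i<n. X i \<omega>)"
proof -
  let ?V = "\<lambda>i. \<integral>\<omega>. (X i \<omega>)\<^sup>2 \<partial>M"
  have [measurable]: "X i \<in> borel_measurable M" for i using X_sq by (rule sq_int_measurable)
  have bad: "prob {\<omega>\<in>space M. \<forall>m. \<exists>j. e \<le> \<bar>\<Sum>i<j. X (i + m) \<omega>\<bar>} = 0" if e: "e > 0" for e :: real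
  proof -
    have "prob {\<omega>\<in>space M. \<forall>m. \<exists>j. e \<le> \<bar>\<Sum>i<j. X (i + m) \<omega>\<bar>} \<le> (\<Sum>i. ?V (i + m)) / e\<^sup>2" for m
    proof -
      interpret sh: martingale_differences M "\<lambda>k. F (k + m)" "\<lambda>k. X (k + m)"
        using sub mono adapted X_sq orth by unfold_locales auto
      have "{\<omega>\<in>space M. \<exists>j. e \<le> \<bar>\<Sum>i<j. X (i + m) \<omega>\<bar>} \<in> events" by measurable
      then have "prob {\<omega>\<in>space M. \<forall>m. \<exists>j. e \<le> \<bar>\<Sum>i<j. X (i + m) \<omega>\<bar>} \<le> prob {\<omega>\<in>space M. \<exists>j. e \<le> \<bar>sh.psum j \<omega>\<bar>}"
        unfolding sh.psum_def by (intro finite_measure_mono) auto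
      also have "\<dots> \<le> (\<Sum>i. ?V (i + m)) / e\<^sup>2"
        using e summable_ignore_initial_segment[OF summ, of m] by (rule sh.maximal_inequality_infinite)
      finally show ?thesis .
    qed
    moreover have "(\<lambda>m. (\<Sum>i. ?V (i + m)) / e\<^sup>2) \<longlonglongrightarrow> 0 / e\<^sup>2"
      using e by (intro tendsto_divide suminf_exist_split2 summ tendsto_const) auto
    ultimately have "prob {\<omega>\<in>space M. \<forall>m. \<exists>j. e \<le> \<bar>\<Sum>i<j. X (i + m) \<omega>\<bar>} \<le> 0"
      by (intro LIMSEQ_le_const[where X="\<lambda>m. (\<Sum>i. ?V (i + m)) / e\<^sup>2"]) auto
    then show ?thesis by (simp add: measure_le_0_iff)
  qed
  have "AE \<omega> in M. \<not> (\<forall>m. \<exists>j. 1 / real (Suc q) \<le> \<bar>\<Sum>i<j. X (i + m) \<omega>\<bar>)" for q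
  proof (rule AE_I[where N="{\<omega>\<in>space M. \<forall>m. \<exists>j. 1 / real (Suc q) \<le> \<bar>\<Sum>i<j. X (i + m) \<omega>\<bar>}"])
    show "emeasure M {\<omega>\<in>space M. \<forall>m. \<exists>j. 1 / real (Suc q) \<le> \<bar>\<Sum>i<j. X (i + m) \<omega>\<bar>} = 0"
      using bad[of "1 / real (Suc q)"] by (simp add: emeasure_eq_measure)
    show "{\<omega>\<in>space M. \<forall>m. \<exists>j. 1 / real (Suc q) \<le> \<bar>\<Sum>i<j. X (i + m) \<omega>\<bar>} \<in> events"
      by measurable
  qed auto
  then have "AE \<omega> in M. \<forall>q. \<not> (\<forall>m. \<exists>j. 1 / real (Suc q) \<le> \<bar>\<Sum>i<j. X (i + m) \<omega>\<bar>)"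
    by (simp add: AE_all_countable)
  then show ?thesis
  proof eventually_elim
    case (elim \<omega>)
    let ?psum = "\<lambda>n. \<Sum>i<n. X i \<omega>"
    have split: "(\<Sum>i<j. X (i + m) \<omega>) = ?psum (j + m) - ?psum m" for j m
      by (induction j) auto
    have "Cauchy ?psum"
    proof (rule metric_CauchyI)
      fix e :: real assume "e > 0"
      then obtain q where q: "1 / real (Suc q) < e / 2"
        using reals_Archimedean[of "e / 2"] by (auto simp: inverse_eq_divide)
      obtain m where m: "\<And>j. \<bar>?psum (j + m) - ?psum m\<bar> < 1 / real (Suc q)"
        using elim[rule_format, of q] unfolding split by (auto simp: not_le)
      have "dist (?psum a) (?psum b) < e" if "a \<ge> m" "b \<ge> m" for a b
        using m[of "a - m"] m[of "b - m"] q that by (simp add: dist_real_def)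
      then show "\<exists>m. \<forall>a\<ge>m. \<forall>b\<ge>m. dist (?psum a) (?psum b) < e" by blast
    qed
    then show ?case by (simp add: Cauchy_convergent)
  qed
qed

section \<open>Stochastic gradient descent on a degenerate quadratic\<close>

text \<open>\<open>zs\<close> is a reference zero, not the limit; measuring from it removes the
  constant term of the residual. \<open>Y_mean\<close> is the weak form of a conditional mean equal
  to the gradient of |G(z - zs)|^2. \<open>m\<close> and \<open>m'\<close> are the gaps of G and
  G^T, and only \<open>m\<close> enters the step-size condition.\<close>

locale linear_stochastic_descent = prob_space M for M :: "'w measure" +
  fixes F :: "nat \<Rightarrow> 'w measure" and R :: "'r set" and C :: "'c set"
    and G :: "'r \<Rightarrow> 'c \<Rightarrow> real" and z Y :: "nat \<Rightarrow> 'w \<Rightarrow> 'c \<Rightarrow> real"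
    and zs :: "'c \<Rightarrow> real" and g K m m' :: real
  assumes finR: "finite R" and fC: "finite C"
    and sub: "\<And>k. subalgebra M (F k)" and mono: "\<And>k. subalgebra (F (Suc k)) (F k)"
    and z_adapted: "\<And>k c. c \<in> C \<Longrightarrow> (\<lambda>\<omega>. z k \<omega> c) \<in> borel_measurable (F k)"
    and z_sq: "\<And>k c. c \<in> C \<Longrightarrow> sq_int M (\<lambda>\<omega>. z k \<omega> c)"
    and Y_sq: "\<And>k c. c \<in> C \<Longrightarrow> sq_int M (\<lambda>\<omega>. Y k \<omega> c)"
    and z_step: "\<And>k c \<omega>. c \<in> C \<Longrightarrow> z (Suc k) \<omega> c = z k \<omega> c - g / real (Suc k) * Y k \<omega> c"
    and Y_mean: "\<And>k c h. c \<in> C \<Longrightarrow> h \<in> borel_measurable (F k) \<Longrightarrow> sq_int M h \<Longrightarrow>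
        (\<integral>\<omega>. Y k \<omega> c * h \<omega> \<partial>M)
          = (\<integral>\<omega>. 2 * matvec (tr G) R (matvec G C (\<lambda>c. z k \<omega> c - zs c)) c * h \<omega> \<partial>M)"
    and K: "K \<ge> 0"
    and Y_second: "\<And>k c. c \<in> C \<Longrightarrow>
        (\<integral>\<omega>. (Y k \<omega> c)\<^sup>2 \<partial>M) \<le> K * (1 + (\<integral>\<omega>. ip C (\<lambda>c. z k \<omega> c - zs c) (\<lambda>c. z k \<omega> c - zs c) \<partial>M))"
    and m: "m > 0" and gap: "\<And>v. m * ip R (matvec G C v) (matvec G C v)
        \<le> ip C (matvec (tr G) R (matvec G C v)) (matvec (tr G) R (matvec G C v))"
    and m': "m' > 0" and gap': "\<And>v. m' * ip C (matvec (tr G) R v) (matvec (tr G) R v)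
        \<le> ip R (matvec G C (matvec (tr G) R v)) (matvec G C (matvec (tr G) R v))"
    and g: "2 \<le> 4 * m * g"
begin

definition v :: "nat \<Rightarrow> 'w \<Rightarrow> 'c \<Rightarrow> real" where "v k \<omega> c = z k \<omega> c - zs c"
definition u :: "nat \<Rightarrow> 'w \<Rightarrow> 'r \<Rightarrow> real" where "u k \<omega> = matvec G C (v k \<omega>)"
definition q :: "nat \<Rightarrow> 'w \<Rightarrow> 'c \<Rightarrow> real" where "q k \<omega> = matvec (tr G) R (u k \<omega>)"

lemma v_fun: "v k \<omega> = (\<lambda>c. z k \<omega> c - zs c)"
  by (simp add: v_def fun_eq_iff)

lemma g_pos: "g > 0"
  using g m by (smt (verit) mult_nonneg_nonpos)

lemma v_sq: "c \<in> C \<Longrightarrow> sq_int M (\<lambda>\<omega>. v k \<omega> c)"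
  unfolding v_def by (intro sq_int_diff z_sq sq_int_const)

lemma u_sq: "sq_int M (\<lambda>\<omega>. u k \<omega> r)"
  unfolding u_def matvec_def by (intro sq_int_sum sq_int_scale v_sq)

lemma q_sq: "sq_int M (\<lambda>\<omega>. q k \<omega> c)"
  unfolding q_def matvec_def by (intro sq_int_sum sq_int_scale u_sq)

lemma v_adapted: "c \<in> C \<Longrightarrow> (\<lambda>\<omega>. v k \<omega> c) \<in> borel_measurable (F k)"
  unfolding v_def using z_adapted by (intro borel_measurable_diff) auto

lemma u_adapted: "(\<lambda>\<omega>. u k \<omega> r) \<in> borel_measurable (F k)"
  unfolding u_def matvec_def by (intro borel_measurable_sum borel_measurable_times v_adapted) auto

lemma q_adapted: "(\<lambda>\<omega>. q k \<omega> c) \<in> borel_measurable (F k)"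
  unfolding q_def matvec_def by (intro borel_measurable_sum borel_measurable_times u_adapted) auto

lemma integrable_ip:
  "(\<And>i. i \<in> I \<Longrightarrow> sq_int M (\<lambda>\<omega>. x \<omega> i)) \<Longrightarrow> (\<And>i. i \<in> I \<Longrightarrow> sq_int M (\<lambda>\<omega>. y \<omega> i))
    \<Longrightarrow> integrable M (\<lambda>\<omega>. ip I (x \<omega>) (y \<omega>))"
  unfolding ip_def by (intro Bochner_Integration.integrable_sum integrable_mult_sq_int)

lemma expectation_ip:
  "(\<And>i. i \<in> I \<Longrightarrow> sq_int M (\<lambda>\<omega>. x \<omega> i)) \<Longrightarrow> (\<And>i. i \<in> I \<Longrightarrow> sq_int M (\<lambda>\<omega>. y \<omega> i))
    \<Longrightarrow> expectation (\<lambda>\<omega>. ip I (x \<omega>) (y \<omega>)) = (\<Sum>i\<in>I. expectation (\<lambda>\<omega>. x \<omega> i * y \<omega> i))"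
  unfolding ip_def by (intro Bochner_Integration.integral_sum integrable_mult_sq_int)

lemma Y_mean_q:
  assumes "c \<in> C" "h \<in> borel_measurable (F k)" "sq_int M h"
  shows "expectation (\<lambda>\<omega>. Y k \<omega> c * h \<omega>) = 2 * expectation (\<lambda>\<omega>. q k \<omega> c * h \<omega>)"
proof -
  have "expectation (\<lambda>\<omega>. Y k \<omega> c * h \<omega>) = expectation (\<lambda>\<omega>. 2 * (q k \<omega> c * h \<omega>))"
    unfolding Y_mean[OF assms] q_def u_def v_fun by (simp add: mult.assoc)
  then show ?thesis by simp
qed

lemma expectation_Y_ip:
  assumes "\<And>c. c \<in> C \<Longrightarrow> (\<lambda>\<omega>. h \<omega> c) \<in> borel_measurable (F k)" "\<And>c. c \<in> C \<Longrightarrow> sq_int M (\<lambda>\<omega>. h \<omega> c)"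
  shows "expectation (\<lambda>\<omega>. ip C (Y k \<omega>) (h \<omega>)) = 2 * expectation (\<lambda>\<omega>. ip C (q k \<omega>) (h \<omega>))"
  using assms by (simp add: expectation_ip Y_sq q_sq Y_mean_q sum_distrib_left)

definition a :: "nat \<Rightarrow> real" where "a k = expectation (\<lambda>\<omega>. ip C (v k \<omega>) (v k \<omega>))"
definition f :: "nat \<Rightarrow> real" where "f k = expectation (\<lambda>\<omega>. ip R (u k \<omega>) (u k \<omega>))"
definition b :: "nat \<Rightarrow> real" where "b k = expectation (\<lambda>\<omega>. ip C (Y k \<omega>) (Y k \<omega>))"

lemma b_le: "b k \<le> real (card C) * K * (1 + a k)"
proof -
  have "b k = (\<Sum>c\<in>C. expectation (\<lambda>\<omega>. (Y k \<omega> c)\<^sup>2))"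
    unfolding b_def by (subst expectation_ip) (simp_all add: Y_sq power2_eq_square)
  also have "\<dots> \<le> (\<Sum>c\<in>C. K * (1 + a k))"
    unfolding a_def v_fun by (intro sum_mono Y_second)
  finally show ?thesis by (simp add: mult.assoc)
qed

lemma a_nonneg: "0 \<le> a k" and f_nonneg: "0 \<le> f k"
  by (simp_all add: a_def f_def ip_nonneg)

lemma v_step: "c \<in> C \<Longrightarrow> v (Suc k) \<omega> c = v k \<omega> c + (- (g / real (Suc k))) * Y k \<omega> c"
  by (simp add: v_def z_step)

lemma a_step: "a (Suc k) \<le> a k + g\<^sup>2 * real (card C) * K / (real (Suc k))\<^sup>2 * (1 + a k)"
proof -
  let ?h = "g / real (Suc k)"
  have "ip C (v (Suc k) \<omega>) (v (Suc k) \<omega>)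
      = ip C (v k \<omega>) (v k \<omega>) + 2 * (- ?h) * ip C (Y k \<omega>) (v k \<omega>) + (- ?h)\<^sup>2 * ip C (Y k \<omega>) (Y k \<omega>)" for \<omega>
  proof -
    have "ip C (v (Suc k) \<omega>) (v (Suc k) \<omega>) = ip C (\<lambda>c. v k \<omega> c + (- ?h) * Y k \<omega> c) (\<lambda>c. v k \<omega> c + (- ?h) * Y k \<omega> c)"
      by (intro ip_cong v_step)
    then show ?thesis by (simp only: ip_add_scaled ip_commute[of C "v k \<omega>" "Y k \<omega>"])
  qed
  then have "a (Suc k) = expectation (\<lambda>\<omega>. ip C (v k \<omega>) (v k \<omega>) + 2 * (- ?h) * ip C (Y k \<omega>) (v k \<omega>)
      + (- ?h)\<^sup>2 * ip C (Y k \<omega>) (Y k \<omega>))"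
    by (simp only: a_def)
  also have "\<dots> = a k + 2 * (- ?h) * (2 * expectation (\<lambda>\<omega>. ip C (q k \<omega>) (v k \<omega>))) + (- ?h)\<^sup>2 * b k"
    using expectation_Y_ip[of "v k" k] v_adapted v_sq
    by (simp add: a_def b_def integrable_ip v_sq Y_sq)
  also have "(\<lambda>\<omega>. ip C (q k \<omega>) (v k \<omega>)) = (\<lambda>\<omega>. ip R (u k \<omega>) (u k \<omega>))"
    using ip_adjoint[of R G C "v k _" "u k _"] by (simp add: q_def u_def ip_commute fun_eq_iff)
  also have "a k + 2 * (- ?h) * (2 * expectation (\<lambda>\<omega>. ip R (u k \<omega>) (u k \<omega>))) + (- ?h)\<^sup>2 * b k
      \<le> a k + 0 + (- ?h)\<^sup>2 * (real (card C) * K * (1 + a k))"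
    using g_pos f_nonneg[of k] b_le[of k] unfolding f_def
    by (intro add_mono mult_left_mono order_refl) (auto simp: mult_le_0_iff)
  finally show ?thesis by (simp add: power_divide)
qed

text \<open>Choosing one uniform bound on the mean squared distance lets later constants refer to it
  without an existential.\<close>

definition B :: real where "B = (SOME B. \<forall>k. a k \<le> B)"

lemma a_le_B: "a k \<le> B"
proof -
  have "\<exists>B. \<forall>k. a k \<le> B"
    by (rule bounded_if_summable_growth[of a "g\<^sup>2 * real (card C) * K"])
      (use a_nonneg K a_step in auto)
  then show ?thesis unfolding B_def using someI_ex[of "\<lambda>B. \<forall>k. a k \<le> B"] by blast
qed

text \<open>Testing \<open>Y\<close> against \<open>q\<close>, half of its conditional mean, yields
  2 E|q|^2 \<ge> 2 m f, and the factor 2 h of the expansion makes this 4 m g/(k+1). The second-order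
  term is bounded by the distance, that is by \<open>B\<close>, as \<open>f\<close> does not control
  the noise.\<close>

lemma f_step:
  defines "L \<equiv> (\<Sum>r\<in>R. \<Sum>c\<in>C. (G r c)\<^sup>2)"
  shows "f (Suc k) \<le> (1 - 4 * m * g / real (Suc k)) * f k
    + g\<^sup>2 * L * real (card C) * K * (1 + B) / (real (Suc k))\<^sup>2"
proof -
  let ?h = "g / real (Suc k)"
  have L: "L \<ge> 0" by (simp add: L_def sum_nonneg)
  have h: "?h > 0" using g_pos by simp
  have sqGY: "sq_int M (\<lambda>\<omega>. matvec G C (Y k \<omega>) r)" for r
    unfolding matvec_def by (intro sq_int_sum sq_int_scale Y_sq)
  have "ip R (u (Suc k) \<omega>) (u (Suc k) \<omega>)
      = ip R (u k \<omega>) (u k \<omega>) + 2 * (- ?h) * ip C (Y k \<omega>) (q k \<omega>) + (- ?h)\<^sup>2 * ip R (matvec G C (Y k \<omega>)) (matvec G C (Y k \<omega>))" for \<omega>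
  proof -
    have "u (Suc k) \<omega> = matvec G C (\<lambda>c. v k \<omega> c + (- ?h) * Y k \<omega> c)"
      unfolding u_def by (intro matvec_cong v_step)
    then have "u (Suc k) \<omega> = (\<lambda>r. u k \<omega> r + (- ?h) * matvec G C (Y k \<omega>) r)"
      by (simp only: matvec_add_scaled u_def fun_eq_iff) simp
    then show ?thesis
      using ip_adjoint[of R G C "Y k \<omega>" "u k \<omega>"]
      by (simp only: ip_add_scaled ip_commute[of R "u k \<omega>" "matvec G C (Y k \<omega>)"] q_def)
  qed
  then have "f (Suc k) = expectation (\<lambda>\<omega>. ip R (u k \<omega>) (u k \<omega>) + 2 * (- ?h) * ip C (Y k \<omega>) (q k \<omega>)
      + (- ?h)\<^sup>2 * ip R (matvec G C (Y k \<omega>)) (matvec G C (Y k \<omega>)))"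
    by (simp only: f_def)
  also have "\<dots> = f k + 2 * (- ?h) * (2 * expectation (\<lambda>\<omega>. ip C (q k \<omega>) (q k \<omega>)))
      + (- ?h)\<^sup>2 * expectation (\<lambda>\<omega>. ip R (matvec G C (Y k \<omega>)) (matvec G C (Y k \<omega>)))"
    using expectation_Y_ip[of "q k" k] q_adapted q_sq sqGY
    by (simp add: f_def integrable_ip u_sq q_sq Y_sq)
  also have "\<dots> \<le> f k + 2 * (- ?h) * (2 * (m * f k)) + (- ?h)\<^sup>2 * (L * (real (card C) * K * (1 + B)))"
  proof (intro add_mono order_refl)
    have mf: "m * f k \<le> expectation (\<lambda>\<omega>. ip C (q k \<omega>) (q k \<omega>))"
      unfolding f_def Bochner_Integration.integral_mult_right_zero[symmetric]
      using gap by (intro integral_mono integrable_ip integrable_mult_right) (auto simp: u_sq q_sq q_def u_def intro: u_sq[unfolded u_def] q_sq[unfolded q_def u_def])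
    show "2 * (- ?h) * (2 * expectation (\<lambda>\<omega>. ip C (q k \<omega>) (q k \<omega>))) \<le> 2 * (- ?h) * (2 * (m * f k))"
    proof (rule mult_left_mono_neg)
      show "2 * (m * f k) \<le> 2 * expectation (\<lambda>\<omega>. ip C (q k \<omega>) (q k \<omega>))" using mf by simp
      show "2 * (- ?h) \<le> 0" using h by simp
    qed
    have "expectation (\<lambda>\<omega>. ip R (matvec G C (Y k \<omega>)) (matvec G C (Y k \<omega>))) \<le> expectation (\<lambda>\<omega>. L * ip C (Y k \<omega>) (Y k \<omega>))"
      unfolding L_def by (intro integral_mono integrable_ip integrable_mult_right ip_le_matvec_sqr sqGY Y_sq)
    also have "\<dots> = L * b k" by (simp add: b_def)
    also have "\<dots> \<le> L * (real (card C) * K * (1 + a k))" using L b_le by (rule mult_left_mono[rotated])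
    also have "\<dots> \<le> L * (real (card C) * K * (1 + B))"
      using L K a_le_B by (intro mult_left_mono) auto
    finally show "(- ?h)\<^sup>2 * expectation (\<lambda>\<omega>. ip R (matvec G C (Y k \<omega>)) (matvec G C (Y k \<omega>)))
        \<le> (- ?h)\<^sup>2 * (L * (real (card C) * K * (1 + B)))"
      by (rule mult_left_mono) simp
  qed
  also have "\<dots> = (1 - 4 * m * g / real (Suc k)) * f k + g\<^sup>2 * L * real (card C) * K * (1 + B) / (real (Suc k))\<^sup>2"
    by (simp add: power_divide algebra_simps add_divide_distrib)
  finally show ?thesis .
qed

theorem expected_residual_bound:
  "\<exists>D. \<forall>k. expectation (\<lambda>\<omega>. ip R (u k \<omega>) (u k \<omega>)) \<le> D / real (Suc k)"
proof -
  let ?C = "g\<^sup>2 * (\<Sum>r\<in>R. \<Sum>c\<in>C. (G r c)\<^sup>2) * real (card C) * K * (1 + B)"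
  have C: "0 \<le> ?C" using K a_nonneg[of 0] a_le_B[of 0] by (intro mult_nonneg_nonneg sum_nonneg) auto
  have "f k \<le> (f 0 + 2 * ?C) / real (Suc k)" for k
    by (rule chung_sequence_bound[OF f_nonneg C g f_step])
  then show ?thesis unfolding f_def by blast
qed

text \<open>The centred noise of a step, with the step size included, so that its variances are
  summable.\<close>

definition X :: "'c \<Rightarrow> nat \<Rightarrow> 'w \<Rightarrow> real" where
  "X c k \<omega> = g / real (Suc k) * (Y k \<omega> c - 2 * q k \<omega> c)"

lemma Y_minus_q_sq: "c \<in> C \<Longrightarrow> sq_int M (\<lambda>\<omega>. Y k \<omega> c - 2 * q k \<omega> c)"
  by (intro sq_int_diff sq_int_scale Y_sq q_sq)

lemma X_martingale_differences: "c \<in> C \<Longrightarrow> martingale_differences M F (X c)"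
proof unfold_locales
  fix k assume c: "c \<in> C"
  note [measurable] = z_adapted[OF c, of k, THEN measurable_from_subalg[OF mono]] z_adapted[OF c, of "Suc k"]
    q_adapted[where k=k and c=c, THEN measurable_from_subalg[OF mono]]
  \<comment> \<open>Adaptedness is given for the iterates only, so the noise is recovered from two
    consecutive ones.\<close>
  have "X c k = (\<lambda>\<omega>. z k \<omega> c - z (Suc k) \<omega> c - g / real (Suc k) * (2 * q k \<omega> c))"
    using z_step[OF c] by (simp add: fun_eq_iff X_def algebra_simps diff_divide_distrib)
  then show "X c k \<in> borel_measurable (F (Suc k))" by simp
  show "sq_int M (X c k)" unfolding X_def using Y_minus_q_sq[OF c] by (rule sq_int_scale)
  show "expectation (\<lambda>\<omega>. X c k \<omega> * h \<omega>) = 0" if h: "h \<in> borel_measurable (F k)" "sq_int M h" for h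
  proof -
    have "expectation (\<lambda>\<omega>. X c k \<omega> * h \<omega>)
        = expectation (\<lambda>\<omega>. g / real (Suc k) * (Y k \<omega> c * h \<omega> - 2 * (q k \<omega> c * h \<omega>)))"
      by (intro Bochner_Integration.integral_cong) (auto simp: X_def algebra_simps)
    also have "\<dots> = g / real (Suc k) * (expectation (\<lambda>\<omega>. Y k \<omega> c * h \<omega>) - 2 * expectation (\<lambda>\<omega>. q k \<omega> c * h \<omega>))"
      using h by (simp add: integrable_mult_sq_int Y_sq[OF c] q_sq)
    finally show ?thesis using Y_mean_q[OF c h] by simp
  qed
qed (rule sub mono)+

text \<open>Pythagoras: the conditional mean 2 q is orthogonal to the centred part, so centring does
  not increase the second moment.\<close>

lemma X_second: 
  assumes c: "c \<in> C"
  shows "expectation (\<lambda>\<omega>. (X c k \<omega>)\<^sup>2) \<le> g\<^sup>2 * K * (1 + B) * (1 / (real (Suc k))\<^sup>2)"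
proof -
  have "expectation (\<lambda>\<omega>. (Y k \<omega> c)\<^sup>2)
      = expectation (\<lambda>\<omega>. (2 * q k \<omega> c)\<^sup>2) + 2 * expectation (\<lambda>\<omega>. 2 * q k \<omega> c * (Y k \<omega> c - 2 * q k \<omega> c))
        + expectation (\<lambda>\<omega>. (Y k \<omega> c - 2 * q k \<omega> c)\<^sup>2)"
    using expectation_square_add[of M "\<lambda>\<omega>. 2 * q k \<omega> c" "\<lambda>\<omega>. Y k \<omega> c - 2 * q k \<omega> c",
        OF sq_int_scale[OF q_sq] Y_minus_q_sq[OF c]] by simp
  moreover have "expectation (\<lambda>\<omega>. 2 * q k \<omega> c * (Y k \<omega> c - 2 * q k \<omega> c)) = 0"
  proof -
    have "expectation (\<lambda>\<omega>. 2 * q k \<omega> c * (Y k \<omega> c - 2 * q k \<omega> c))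
        = expectation (\<lambda>\<omega>. 2 * (Y k \<omega> c * q k \<omega> c) - 4 * (q k \<omega> c * q k \<omega> c))"
      by (intro Bochner_Integration.integral_cong) (auto simp: algebra_simps)
    also have "\<dots> = 2 * expectation (\<lambda>\<omega>. Y k \<omega> c * q k \<omega> c) - 4 * expectation (\<lambda>\<omega>. q k \<omega> c * q k \<omega> c)"
      by (simp add: integrable_mult_sq_int Y_sq[OF c] q_sq)
    finally show ?thesis using Y_mean_q[OF c q_adapted q_sq] by simp
  qed
  moreover have "0 \<le> expectation (\<lambda>\<omega>. (2 * q k \<omega> c)\<^sup>2)" by simp
  ultimately have "expectation (\<lambda>\<omega>. (Y k \<omega> c - 2 * q k \<omega> c)\<^sup>2) \<le> expectation (\<lambda>\<omega>. (Y k \<omega> c)\<^sup>2)"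
    by linarith
  also have "\<dots> \<le> K * (1 + a k)" using Y_second[OF c] by (simp add: a_def v_fun)
  also have "\<dots> \<le> K * (1 + B)" using K a_le_B by (intro mult_left_mono) auto
  finally have "(g / real (Suc k))\<^sup>2 * expectation (\<lambda>\<omega>. (Y k \<omega> c - 2 * q k \<omega> c)\<^sup>2) \<le> (g / real (Suc k))\<^sup>2 * (K * (1 + B))"
    by (rule mult_left_mono) simp
  then show ?thesis unfolding X_def power_mult_distrib by (simp add: power_divide mult_ac)
qed

theorem AE_convergent:
  "AE \<omega> in M. \<exists>w. (\<forall>c\<in>C. (\<lambda>k. z k \<omega> c) \<longlonglongrightarrow> w c) \<and> (\<forall>r\<in>R. matvec G C (\<lambda>c. w c - zs c) r = 0)"
proof -
  have "AE \<omega> in M. convergent (\<lambda>n. \<Sum>i<n. X c i \<omega>)" if c: "c \<in> C" for c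
  proof -
    interpret martingale_differences M F "X c" using c by (rule X_martingale_differences)
    have "summable (\<lambda>i. 1 / (real (Suc i))\<^sup>2)"
      using inverse_power_summable[of 2, where 'a=real] by (subst summable_Suc_iff) (simp add: inverse_eq_divide)
    then have "summable (\<lambda>i. g\<^sup>2 * K * (1 + B) * (1 / (real (Suc i))\<^sup>2))"
      by (rule summable_mult)
    then have "summable (\<lambda>k. expectation (\<lambda>\<omega>. (X c k \<omega>)\<^sup>2))"
    proof (rule summable_comparison_test'[where N=0])
      show "norm (expectation (\<lambda>\<omega>. (X c k \<omega>)\<^sup>2)) \<le> g\<^sup>2 * K * (1 + B) * (1 / (real (Suc k))\<^sup>2)" for k
        using X_second[OF c, of k] by (simp only: real_norm_def) simp
    qed
    then show ?thesis by (rule AE_convergent_sum)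
  qed
  then have "AE \<omega> in M. \<forall>c\<in>C. convergent (\<lambda>n. \<Sum>i<n. X c i \<omega>)"
    using fC by (simp add: AE_finite_all)
  then show ?thesis
  proof eventually_elim
    case (elim \<omega>)
    then obtain l where l: "\<And>c. c \<in> C \<Longrightarrow> (\<lambda>n. \<Sum>i<n. X c i \<omega>) \<longlonglongrightarrow> l c"
      unfolding convergent_def by metis
    \<comment> \<open>Subtracting the limit makes \<open>e\<close> minus the tail of the noise
      series, hence vanishing. Adding it to \<open>v\<close> cancels the noise in each increment and
      leaves exactly -2 (g/(n+1)) q.\<close>
    define e where "e n c = (\<Sum>i<n. X c i \<omega>) - l c" for n c
    define y where "y n c = v n \<omega> c + e n c" for n c
    have "\<exists>w. (\<forall>c\<in>C. (\<lambda>n. y n c) \<longlonglongrightarrow> w c) \<and> (\<forall>r\<in>R. matvec G C w r = 0)"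
    proof (rule perturbed_gradient_descent_converges[OF finR fC g_pos _ _ m gap m' gap'])
      fix n c assume c: "c \<in> C"
      have "(\<lambda>c. y n c - e n c) = v n \<omega>" by (simp add: y_def fun_eq_iff)
      then show "y (Suc n) c = y n c - 2 * (g / real (Suc n)) * matvec (tr G) R (matvec G C (\<lambda>c. y n c - e n c)) c"
        using v_step[OF c, of n \<omega>]
        by (simp add: y_def e_def X_def q_def u_def algebra_simps diff_divide_distrib)
      show "(\<lambda>n. e n c) \<longlonglongrightarrow> 0"
        unfolding e_def using l[OF c] by (simp add: LIM_zero)
    qed
    then obtain w where w: "\<And>c. c \<in> C \<Longrightarrow> (\<lambda>n. y n c) \<longlonglongrightarrow> w c" and w0: "\<And>r. r \<in> R \<Longrightarrow> matvec G C w r = 0"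
      by blast
    have "(\<lambda>n. z n \<omega> c) \<longlonglongrightarrow> w c + zs c" if c: "c \<in> C" for c
    proof -
      have "(\<lambda>n. y n c - ((\<Sum>i<n. X c i \<omega>) - l c) + zs c) \<longlonglongrightarrow> w c - (l c - l c) + zs c"
        by (intro tendsto_intros w l c)
      then show ?thesis by (simp add: y_def e_def v_def)
    qed
    then show ?case using w0 by (intro exI[of _ "\<lambda>c. w c + zs c"]) auto
  qed
qed

end

section \<open>Moments of standard Gaussian vectors\<close>

text \<open>Asking for all absolute moments gives a class closed under products, so polynomials in
  the noise can be integrated without tracking degrees.\<close>

definition fin_moments :: "'w measure \<Rightarrow> ('w \<Rightarrow> real) \<Rightarrow> bool" where
  "fin_moments M f \<longleftrightarrow> f \<in> borel_measurable M \<and> (\<forall>n. integrable M (\<lambda>\<omega>. \<bar>f \<omega>\<bar> ^ n))"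

lemma fin_moments_measurable: "fin_moments M f \<Longrightarrow> f \<in> borel_measurable M"
  by (simp add: fin_moments_def)

lemma fin_moments_integrable: "fin_moments M f \<Longrightarrow> integrable M f"
  unfolding fin_moments_def using integrable_abs_iff[of f M] by (auto dest: spec[of _ 1])

lemma fin_moments_sq_int: "fin_moments M f \<Longrightarrow> sq_int M f"
  unfolding fin_moments_def sq_int_def by (auto dest: spec[of _ 2])

lemma (in prob_space) fin_moments_const: "fin_moments M (\<lambda>_. c)"
  by (simp add: fin_moments_def)

lemma fin_moments_mult:
  assumes "fin_moments M f" "fin_moments M h"
  shows "fin_moments M (\<lambda>\<omega>. f \<omega> * h \<omega>)"
proof -
  have [measurable]: "f \<in> borel_measurable M" "h \<in> borel_measurable M"
    using assms by (auto simp: fin_moments_def)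
  have "integrable M (\<lambda>\<omega>. \<bar>f \<omega> * h \<omega>\<bar> ^ n)" for n
  proof (rule Bochner_Integration.integrable_bound)
    show "integrable M (\<lambda>\<omega>. \<bar>f \<omega>\<bar> ^ (2 * n) + \<bar>h \<omega>\<bar> ^ (2 * n))"
      using assms by (simp add: fin_moments_def)
    show "AE \<omega> in M. norm (\<bar>f \<omega> * h \<omega>\<bar> ^ n) \<le> norm (\<bar>f \<omega>\<bar> ^ (2 * n) + \<bar>h \<omega>\<bar> ^ (2 * n))"
    proof (intro AE_I2)
      fix \<omega>
      let ?x = "\<bar>f \<omega>\<bar> ^ n" and ?y = "\<bar>h \<omega>\<bar> ^ n"
      have "2 * (?x * ?y) \<le> ?x\<^sup>2 + ?y\<^sup>2"
        using sum_squares_bound[of ?x ?y] by (simp add: mult.assoc)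
      moreover have "0 \<le> ?x * ?y" by simp
      ultimately have "?x * ?y \<le> ?x\<^sup>2 + ?y\<^sup>2" by linarith
      then show "norm (\<bar>f \<omega> * h \<omega>\<bar> ^ n) \<le> norm (\<bar>f \<omega>\<bar> ^ (2 * n) + \<bar>h \<omega>\<bar> ^ (2 * n))"
        by (simp add: abs_mult power_mult_distrib power_mult power_even_eq mult.commute flip: power_mult)
    qed
  qed measurable
  then show ?thesis by (simp add: fin_moments_def)
qed

lemma fin_moments_add:
  assumes "fin_moments M f" "fin_moments M h"
  shows "fin_moments M (\<lambda>\<omega>. f \<omega> + h \<omega>)"
proof -
  have [measurable]: "f \<in> borel_measurable M" "h \<in> borel_measurable M"
    using assms by (auto simp: fin_moments_def)
  have "integrable M (\<lambda>\<omega>. \<bar>f \<omega> + h \<omega>\<bar> ^ n)" for n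
  proof (rule Bochner_Integration.integrable_bound)
    show "integrable M (\<lambda>\<omega>. 2 ^ n * (\<bar>f \<omega>\<bar> ^ n + \<bar>h \<omega>\<bar> ^ n))"
      using assms by (simp add: fin_moments_def)
    show "AE \<omega> in M. norm (\<bar>f \<omega> + h \<omega>\<bar> ^ n) \<le> norm (2 ^ n * (\<bar>f \<omega>\<bar> ^ n + \<bar>h \<omega>\<bar> ^ n))"
    proof (intro AE_I2)
      fix \<omega>
      have "\<bar>f \<omega> + h \<omega>\<bar> ^ n \<le> (2 * max \<bar>f \<omega>\<bar> \<bar>h \<omega>\<bar>) ^ n"
        by (intro power_mono) auto
      also have "\<dots> = 2 ^ n * max \<bar>f \<omega>\<bar> \<bar>h \<omega>\<bar> ^ n" by (simp add: power_mult_distrib)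
      also have "\<dots> \<le> 2 ^ n * (\<bar>f \<omega>\<bar> ^ n + \<bar>h \<omega>\<bar> ^ n)" by (intro mult_left_mono) (auto simp: max_def)
      finally show "norm (\<bar>f \<omega> + h \<omega>\<bar> ^ n) \<le> norm (2 ^ n * (\<bar>f \<omega>\<bar> ^ n + \<bar>h \<omega>\<bar> ^ n))" by simp
    qed
  qed measurable
  then show ?thesis by (simp add: fin_moments_def)
qed

lemma (in prob_space) fin_moments_sum:
  "(\<And>i. i \<in> I \<Longrightarrow> fin_moments M (f i)) \<Longrightarrow> fin_moments M (\<lambda>\<omega>. \<Sum>i\<in>I. f i \<omega>)"
proof (induction I rule: infinite_finite_induct)
  case (insert i I)
  then show ?case by (simp add: fin_moments_add)
qed (simp_all add: fin_moments_const)

lemma (in prob_space) fin_moments_diff: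
  assumes "fin_moments M f" "fin_moments M h"
  shows "fin_moments M (\<lambda>\<omega>. f \<omega> - h \<omega>)"
  using fin_moments_add[OF assms(1) fin_moments_mult[OF fin_moments_const[of "-1"] assms(2)]] by simp

lemma (in prob_space) fin_moments_prod_list:
  "(\<And>j. j \<in> set js \<Longrightarrow> fin_moments M (f j)) \<Longrightarrow> fin_moments M (\<lambda>\<omega>. prod_list (map (\<lambda>j. f j \<omega>) js))"
  by (induction js) (auto intro!: fin_moments_mult fin_moments_const)

section \<open>The standard Gaussian product measure and its moments\<close>

abbreviation std_normal_measure :: "real measure" where
  "std_normal_measure \<equiv> density lborel (\<lambda>u. ennreal (std_normal_density u))"

text \<open>The product runs over the whole index type, like the noise family of the procedure; the
  noise of one step is then again such a measure, by reindexing.\<close>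

definition gauss :: "('i \<Rightarrow> real) measure" where
  "gauss = PiM UNIV (\<lambda>_. std_normal_measure)"

lemma prob_space_std_normal: "prob_space std_normal_measure"
  using prob_space_normal_density[of 1 0] by simp

lemma prob_space_gauss: "prob_space gauss"
  unfolding gauss_def by (intro prob_space_PiM prob_space_std_normal)

lemma sets_gauss: "sets gauss = sets (PiM UNIV (\<lambda>_. borel))"
  unfolding gauss_def by (intro sets_PiM_cong) auto

lemma gauss_component_measurable [measurable]: "(\<lambda>y. y i) \<in> borel_measurable gauss"
  using measurable_component_singleton[of i UNIV "\<lambda>_. borel"] by (simp add: measurable_cong_sets[OF sets_gauss refl])

lemma distr_gauss_component: "distr gauss std_normal_measure (\<lambda>y. y i) = std_normal_measure"
  unfolding gauss_def by (rule distr_PiM_component) (auto intro: prob_space_std_normal)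

definition mom :: "nat \<Rightarrow> real" where
  "mom n = (\<integral>u. std_normal_density u * u ^ n \<partial>lborel)"

lemma integrable_gauss_power: "integrable gauss (\<lambda>y. y i ^ n)"
  and integral_gauss_power: "(\<integral>y. y i ^ n \<partial>gauss) = mom n"
  and integrable_gauss_abs_power: "integrable gauss (\<lambda>y. \<bar>y i\<bar> ^ n)"
proof -
  have 1: "(\<lambda>y. y i) \<in> measurable gauss std_normal_measure"
    using gauss_component_measurable[of i] by simp
  have m: "(\<lambda>u. u ^ n) \<in> borel_measurable std_normal_measure" "(\<lambda>u. \<bar>u\<bar> ^ n) \<in> borel_measurable std_normal_measure" for n :: nat
    by simp_all
  have "integrable std_normal_measure (\<lambda>u. u ^ n)"
    using integrable_std_normal_moment[of n] by (subst integrable_density) auto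
  then show "integrable gauss (\<lambda>y. y i ^ n)"
    using integrable_distr_eq[OF 1 m(1), of n] by (simp add: distr_gauss_component)
  have "integrable std_normal_measure (\<lambda>u. \<bar>u\<bar> ^ n)"
    using integrable_std_normal_moment_abs[of n] by (subst integrable_density) auto
  then show "integrable gauss (\<lambda>y. \<bar>y i\<bar> ^ n)"
    using integrable_distr_eq[OF 1 m(2), of n] by (simp add: distr_gauss_component)
  show "(\<integral>y. y i ^ n \<partial>gauss) = mom n"
    using integral_distr[OF 1 m(1), of n] unfolding distr_gauss_component mom_def
    by (simp add: integral_density)
qed

lemma fin_moments_gauss_component: "fin_moments gauss (\<lambda>y. y i)"
  by (simp add: fin_moments_def integrable_gauss_abs_power)

lemma mom_odd: "odd n \<Longrightarrow> mom n = 0"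
  unfolding mom_def by (elim oddE) (use integral_std_normal_moment_odd in simp)

lemma mom_2: "mom 2 = 1" and mom_4: "mom 4 = 3"
proof -
  have "mom (2 * k) = fact (2 * k) / (2 ^ k * fact k)" for k
    unfolding mom_def by (rule integral_std_normal_moment_even)
  from this[of 1] this[of 2] show "mom 2 = 1" "mom 4 = 3"
    by (simp_all add: fact_numeral)
qed

text \<open>Monomials are kept as lists of indices with repetition. Gaussian moments then depend on
  multiplicities only, and a vanishing moment is witnessed by one index of odd count.\<close>

lemma prod_list_map_eq_prod_count:
  "prod_list (map f xs) = (\<Prod>x\<in>set xs. f x ^ count_list xs x)" for f :: "'a \<Rightarrow> 'b::comm_monoid_mult"
proof (induction xs)
  case (Cons x xs)
  have *: "(\<Prod>y\<in>set xs - {x}. f y ^ count_list (x # xs) y) = (\<Prod>y\<in>set xs - {x}. f y ^ count_list xs y)"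
    by (intro prod.cong) auto
  have "(\<Prod>y\<in>set (x # xs). f y ^ count_list (x # xs) y)
      = f x ^ Suc (count_list xs x) * (\<Prod>y\<in>set xs - {x}. f y ^ count_list xs y)"
    by (simp add: prod.insert_remove * del: count_list.simps) simp
  also have "\<dots> = f x * (\<Prod>y\<in>set xs. f y ^ count_list xs y)"
  proof (cases "x \<in> set xs")
    case True
    then show ?thesis by (simp add: prod.remove[of "set xs" x] mult.assoc)
  qed (simp add: count_list_0_iff)
  finally show ?case using Cons by simp
qed simp

lemma indep_vars_gauss: "prob_space.indep_vars (gauss :: ('i \<Rightarrow> real) measure) (\<lambda>_. borel) (\<lambda>i y. y i) UNIV"
proof -
  interpret prob_space "gauss :: ('i \<Rightarrow> real) measure" by (rule prob_space_gauss)
  have eq: "distr (gauss :: ('i \<Rightarrow> real) measure) (PiM UNIV (\<lambda>_. borel)) (\<lambda>y. y) = gauss"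
    by (rule distr_id2) (simp add: sets_gauss)
  have comp: "distr gauss borel (\<lambda>y. y i) = std_normal_measure" for i :: 'i
    using distr_gauss_component[of i] by (metis (no_types) distr_cong sets_density sets_lborel)
  have "restrict (\<lambda>i. y i) UNIV = y" for y :: "'i \<Rightarrow> real" by (simp add: restrict_def)
  then have "distr (gauss :: ('i \<Rightarrow> real) measure) (PiM UNIV (\<lambda>_. borel)) (\<lambda>y. \<lambda>i\<in>UNIV. y i) = PiM UNIV (\<lambda>i. distr gauss borel (\<lambda>y. y i))"
    unfolding comp by (simp only: eq) (simp only: gauss_def)
  then show ?thesis
    by (subst indep_vars_iff_distr_eq_PiM) auto
qed

lemma integral_gauss_monomial:
  "(\<integral>y. prod_list (map y js) \<partial>gauss) = (\<Prod>j\<in>set js. mom (count_list js j))"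
proof -
  interpret prob_space gauss by (rule prob_space_gauss)
  have "indep_vars (\<lambda>_. borel) (\<lambda>j y. y j ^ count_list js j) (set js)"
    by (rule indep_vars_compose2[OF indep_vars_subset[OF indep_vars_gauss]]) auto
  then show ?thesis
    unfolding prod_list_map_eq_prod_count
    by (subst indep_vars_lebesgue_integral) (auto simp: integrable_gauss_power integral_gauss_power)
qed

lemma integrable_gauss_monomial: "integrable gauss (\<lambda>y. prod_list (map y js))"
  by (rule fin_moments_integrable[OF prob_space.fin_moments_prod_list[OF prob_space_gauss]])
    (rule fin_moments_gauss_component)

lemma integral_gauss_monomial_odd:
  assumes "odd (count_list js j)"
  shows "(\<integral>y. prod_list (map y js) \<partial>gauss) = 0"
proof -
  have "j \<in> set js" using assms by (metis count_notin even_zero)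
  then show ?thesis unfolding integral_gauss_monomial using assms mom_odd by (intro prod_zero) auto
qed

section \<open>Equilibria as zeros of the residual\<close>

definition offset :: "game \<Rightarrow> (nat \<times> nat) + (nat \<times> nat) \<Rightarrow> real" where
  "offset \<Gamma> r = (case r of Inl (i, k) \<Rightarrow> rv \<Gamma> i (i, k) | Inr (i, l) \<Rightarrow> - bv \<Gamma> i l)"

text \<open>Entry (p, c) of the gradient in x, over all players, of the Lagrangian of player i.\<close>

definition Lrow :: "game \<Rightarrow> nat \<Rightarrow> nat \<times> nat \<Rightarrow> (nat \<times> nat) + (nat \<times> nat) \<Rightarrow> real" where
  "Lrow \<Gamma> i p c = (case c of Inl q \<Rightarrow> Qm \<Gamma> i p q | Inr (j, l) \<Rightarrow> if j = i then Am \<Gamma> i l p else 0)"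

definition gradL :: "game \<Rightarrow> nat \<Rightarrow> ((nat \<times> nat) + (nat \<times> nat) \<Rightarrow> real) \<Rightarrow> nat \<times> nat \<Rightarrow> real" where
  "gradL \<Gamma> i z p = matvec (Lrow \<Gamma> i) (gidx \<Gamma>) z p + rv \<Gamma> i p"

definition residual :: "game \<Rightarrow> ((nat \<times> nat) + (nat \<times> nat) \<Rightarrow> real) \<Rightarrow> (nat \<times> nat) + (nat \<times> nat) \<Rightarrow> real" where
  "residual \<Gamma> z r = matvec (Gmat \<Gamma>) (gidx \<Gamma>) z r + offset \<Gamma> r"

lemma finite_xidx: "finite (xidx \<Gamma>)" and finite_lidx: "finite (lidx \<Gamma>)" and finite_gidx: "finite (gidx \<Gamma>)"
  by (simp_all add: xidx_def lidx_def gidx_def)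

lemma sum_gidx: "(\<Sum>j\<in>gidx \<Gamma>. h j) = (\<Sum>p\<in>xidx \<Gamma>. h (Inl p)) + (\<Sum>q\<in>lidx \<Gamma>. h (Inr q))"
  unfolding gidx_def
  by (subst sum.union_disjoint) (auto simp: finite_xidx finite_lidx sum.reindex)

lemma sum_xidx: "(\<Sum>p\<in>xidx \<Gamma>. h p) = (\<Sum>i<np \<Gamma>. \<Sum>k<dim \<Gamma>. h (i, k))"
  by (simp add: xidx_def sum.cartesian_product atLeast0LessThan split_beta)

lemma sum_lidx: "(\<Sum>p\<in>lidx \<Gamma>. h p) = (\<Sum>i<np \<Gamma>. \<Sum>l<mc \<Gamma> i. h (i, l))"
  by (simp add: lidx_def sum.Sigma atLeast0LessThan split_beta)

lemma matvec_Lrow: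
  assumes "i < np \<Gamma>"
  shows "matvec (Lrow \<Gamma> i) (gidx \<Gamma>) z p
    = (\<Sum>q\<in>xidx \<Gamma>. Qm \<Gamma> i p q * z (Inl q)) + (\<Sum>l<mc \<Gamma> i. Am \<Gamma> i l p * z (Inr (i, l)))"
proof -
  have "(\<Sum>q\<in>lidx \<Gamma>. Lrow \<Gamma> i p (Inr q) * z (Inr q))
      = (\<Sum>j<np \<Gamma>. if j = i then \<Sum>l<mc \<Gamma> i. Am \<Gamma> i l p * z (Inr (i, l)) else 0)"
    unfolding sum_lidx by (intro sum.cong) (auto simp: Lrow_def)
  also have "\<dots> = (\<Sum>l<mc \<Gamma> i. Am \<Gamma> i l p * z (Inr (i, l)))"
    using assms by simp
  finally show ?thesis by (simp add: matvec_def sum_gidx Lrow_def)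
qed

lemma Gmat_Inl: "Gmat \<Gamma> (Inl (i, k)) c = Lrow \<Gamma> i (i, k) c"
  by (cases c) (auto simp: Lrow_def split: sum.splits)

lemma residual_Inl: "residual \<Gamma> z (Inl (i, k)) = gradL \<Gamma> i z (i, k)"
  by (simp add: residual_def gradL_def matvec_def Gmat_Inl offset_def)

lemma residual_Inr: "residual \<Gamma> (case_sum x lam) (Inr (i, l)) = resid \<Gamma> i l x"
  by (simp add: residual_def matvec_def sum_gidx offset_def resid_def)

lemma ball_gidx:
  "(\<forall>r\<in>gidx \<Gamma>. P r) \<longleftrightarrow> (\<forall>i<np \<Gamma>. (\<forall>k<dim \<Gamma>. P (Inl (i, k))) \<and> (\<forall>l<mc \<Gamma> i. P (Inr (i, l))))"
  by (auto simp: gidx_def xidx_def lidx_def)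

lemma Ffun_eq: "Ffun \<Gamma> x lam = ip (gidx \<Gamma>) (residual \<Gamma> (case_sum x lam)) (residual \<Gamma> (case_sum x lam))"
proof -
  have "residual \<Gamma> (case_sum x lam) (Inl (i, k))
      = (\<Sum>p\<in>xidx \<Gamma>. Qm \<Gamma> i (i, k) p * x p) + rv \<Gamma> i (i, k) + (\<Sum>l<mc \<Gamma> i. Am \<Gamma> i l (i, k) * lam (i, l))"
    if "i < np \<Gamma>" for i k
    using that by (simp add: residual_Inl gradL_def matvec_Lrow)
  then show ?thesis
    by (simp add: Ffun_def ip_def sum_gidx sum_xidx sum_lidx residual_Inr sum.distrib power2_eq_square)
qed

lemma resid_add: "resid \<Gamma> i l (\<lambda>p. x p + s * w p) = resid \<Gamma> i l x + s * (\<Sum>p\<in>xidx \<Gamma>. Am \<Gamma> i l p * w p)"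
  unfolding resid_def sum_distrib_left by (simp add: algebra_simps sum.distrib)

definition qform :: "game \<Rightarrow> nat \<Rightarrow> (nat \<times> nat \<Rightarrow> real) \<Rightarrow> real" where
  "qform \<Gamma> i w = (\<Sum>p\<in>xidx \<Gamma>. \<Sum>q\<in>xidx \<Gamma>. w p * Qm \<Gamma> i p q * w q)"

definition gradJ :: "game \<Rightarrow> nat \<Rightarrow> (nat \<times> nat \<Rightarrow> real) \<Rightarrow> nat \<times> nat \<Rightarrow> real" where
  "gradJ \<Gamma> i x p = (\<Sum>q\<in>xidx \<Gamma>. Qm \<Gamma> i p q * x q) + rv \<Gamma> i p"

lemma Jc_add:
  assumes game: "standing_game \<Gamma>" and i: "i < np \<Gamma>"
  shows "Jc \<Gamma> i (\<lambda>p. x p + s * w p) = Jc \<Gamma> i x + s * (\<Sum>p\<in>xidx \<Gamma>. gradJ \<Gamma> i x p * w p) + s\<^sup>2 / 2 * qform \<Gamma> i w"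
proof -
  let ?I = "xidx \<Gamma>" and ?Q = "Qm \<Gamma> i"
  have sym: "?Q p q = ?Q q p" if "p \<in> ?I" "q \<in> ?I" for p q
    using game i that by (auto simp: standing_game_def)
  have "(\<Sum>p\<in>?I. \<Sum>q\<in>?I. w p * ?Q p q * x q) = (\<Sum>p\<in>?I. \<Sum>q\<in>?I. x p * ?Q p q * w q)"
    by (subst sum.swap) (intro sum.cong refl, simp add: sym mult_ac)
  moreover have "(\<Sum>p\<in>?I. \<Sum>q\<in>?I. (x p + s * w p) * ?Q p q * (x q + s * w q))
      = (\<Sum>p\<in>?I. \<Sum>q\<in>?I. x p * ?Q p q * x q) + s * (\<Sum>p\<in>?I. \<Sum>q\<in>?I. w p * ?Q p q * x q)
        + s * (\<Sum>p\<in>?I. \<Sum>q\<in>?I. x p * ?Q p q * w q) + s\<^sup>2 * qform \<Gamma> i w"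
    unfolding qform_def sum_distrib_left sum.distrib[symmetric]
    by (intro sum.cong refl) (simp add: algebra_simps power2_eq_square)
  ultimately have quad: "(\<Sum>p\<in>?I. \<Sum>q\<in>?I. (x p + s * w p) * ?Q p q * (x q + s * w q))
      = (\<Sum>p\<in>?I. \<Sum>q\<in>?I. x p * ?Q p q * x q) + 2 * s * (\<Sum>p\<in>?I. \<Sum>q\<in>?I. w p * ?Q p q * x q) + s\<^sup>2 * qform \<Gamma> i w"
    by simp
  have lin: "(\<Sum>p\<in>?I. rv \<Gamma> i p * (x p + s * w p)) = (\<Sum>p\<in>?I. rv \<Gamma> i p * x p) + s * (\<Sum>p\<in>?I. rv \<Gamma> i p * w p)"
    unfolding sum_distrib_left by (simp add: algebra_simps sum.distrib)
  have grad: "(\<Sum>p\<in>?I. gradJ \<Gamma> i x p * w p) = (\<Sum>p\<in>?I. \<Sum>q\<in>?I. w p * ?Q p q * x q) + (\<Sum>p\<in>?I. rv \<Gamma> i p * w p)"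
    unfolding gradJ_def by (simp add: algebra_simps sum.distrib sum_distrib_left sum_distrib_right)
  show ?thesis unfolding Jc_def quad lin grad by (simp add: algebra_simps)
qed

lemma gradL_eq_gradJ:
  assumes "i < np \<Gamma>"
  shows "gradL \<Gamma> i (case_sum x lam) p = gradJ \<Gamma> i x p + (\<Sum>l<mc \<Gamma> i. Am \<Gamma> i l p * lam (i, l))"
  using assms by (simp add: gradL_def matvec_Lrow gradJ_def)

text \<open>The last term is even in \<open>s\<close>, so a symmetric difference quotient returns
  the directional derivative exactly, whatever the value of sigma.\<close>

lemma Lag_add:
  assumes game: "standing_game \<Gamma>" and i: "i < np \<Gamma>"
  shows "Lag \<Gamma> i (\<lambda>p. x p + s * w p) lam
    = Lag \<Gamma> i x lam + s * (\<Sum>p\<in>xidx \<Gamma>. gradL \<Gamma> i (case_sum x lam) p * w p) + s\<^sup>2 / 2 * qform \<Gamma> i w"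
proof -
  have "(\<Sum>p\<in>xidx \<Gamma>. gradL \<Gamma> i (case_sum x lam) p * w p)
      = (\<Sum>p\<in>xidx \<Gamma>. gradJ \<Gamma> i x p * w p) + (\<Sum>p\<in>xidx \<Gamma>. \<Sum>l<mc \<Gamma> i. lam (i, l) * (Am \<Gamma> i l p * w p))"
    using i by (simp add: gradL_eq_gradJ algebra_simps sum.distrib sum_distrib_left sum_distrib_right)
  also have "(\<Sum>p\<in>xidx \<Gamma>. \<Sum>l<mc \<Gamma> i. lam (i, l) * (Am \<Gamma> i l p * w p))
      = (\<Sum>l<mc \<Gamma> i. lam (i, l) * (\<Sum>p\<in>xidx \<Gamma>. Am \<Gamma> i l p * w p))"
    by (subst sum.swap) (simp add: sum_distrib_left)
  finally have grad: "(\<Sum>p\<in>xidx \<Gamma>. gradL \<Gamma> i (case_sum x lam) p * w p)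
      = (\<Sum>p\<in>xidx \<Gamma>. gradJ \<Gamma> i x p * w p) + (\<Sum>l<mc \<Gamma> i. lam (i, l) * (\<Sum>p\<in>xidx \<Gamma>. Am \<Gamma> i l p * w p))" .
  have constr: "(\<Sum>l<mc \<Gamma> i. lam (i, l) * resid \<Gamma> i l (\<lambda>p. x p + s * w p))
      = (\<Sum>l<mc \<Gamma> i. lam (i, l) * resid \<Gamma> i l x) + s * (\<Sum>l<mc \<Gamma> i. lam (i, l) * (\<Sum>p\<in>xidx \<Gamma>. Am \<Gamma> i l p * w p))"
    unfolding resid_add by (simp add: algebra_simps sum.distrib sum_distrib_left)
  show ?thesis unfolding Lag_def Jc_add[OF assms] grad constr by (simp add: algebra_simps)
qed

definition own_dir :: "nat \<Rightarrow> (nat \<Rightarrow> real) \<Rightarrow> nat \<times> nat \<Rightarrow> real" where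
  "own_dir i w = (\<lambda>(j, k). if j = i then w k else 0)"

lemma repl_eq_add_own_dir: "repl x i (\<lambda>k. x (i, k) + s * w k) = (\<lambda>p. x p + s * own_dir i w p)"
  by (auto simp: repl_def own_dir_def fun_eq_iff)

lemma sum_own_dir:
  assumes "i < np \<Gamma>"
  shows "(\<Sum>p\<in>xidx \<Gamma>. h p * own_dir i w p) = (\<Sum>k<dim \<Gamma>. h (i, k) * w k)"
proof -
  have "(\<Sum>p\<in>xidx \<Gamma>. h p * own_dir i w p) = (\<Sum>j<np \<Gamma>. if j = i then \<Sum>k<dim \<Gamma>. h (i, k) * w k else 0)"
    unfolding sum_xidx by (intro sum.cong) (auto simp: own_dir_def)
  then show ?thesis using assms by simp
qed

text \<open>Convexity at the midpoint of \<open>w\<close> and \<open>-w\<close> around the origin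
  cancels the constant and linear terms and leaves the quadratic form.\<close>

lemma qform_own_dir_nonneg:
  assumes game: "standing_game \<Gamma>" and i: "i < np \<Gamma>"
  shows "0 \<le> qform \<Gamma> i (own_dir i w)"
proof -
  let ?x = "\<lambda>_::nat \<times> nat. 0::real"
  have conv: "Jc \<Gamma> i (repl ?x i (\<lambda>k. u * y k + (1 - u) * z k)) \<le> u * Jc \<Gamma> i (repl ?x i y) + (1 - u) * Jc \<Gamma> i (repl ?x i z)"
    if "0 \<le> u" "u \<le> 1" for y z u
    using game i that unfolding standing_game_def by blast
  have shift: "Jc \<Gamma> i (repl ?x i (\<lambda>k. s * w k)) = Jc \<Gamma> i ?x + s * (\<Sum>p\<in>xidx \<Gamma>. gradJ \<Gamma> i ?x p * own_dir i w p) + s\<^sup>2 / 2 * qform \<Gamma> i (own_dir i w)" for s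
    using Jc_add[OF assms, of ?x s "own_dir i w"] repl_eq_add_own_dir[of ?x i s w] by simp
  have "Jc \<Gamma> i (repl ?x i (\<lambda>k. 0 * w k)) \<le> 1/2 * Jc \<Gamma> i (repl ?x i (\<lambda>k. 1 * w k)) + (1 - 1/2) * Jc \<Gamma> i (repl ?x i (\<lambda>k. (-1) * w k))"
    using conv[of "1/2" "\<lambda>k. 1 * w k" "\<lambda>k. (-1) * w k"] by simp
  then show ?thesis unfolding shift by (simp add: field_simps)
qed

text \<open>A deviation in the kernel of the player's own constraint block stays feasible, so the
  own gradient annihilates that kernel and is a combination of the rows \<open>mu\<close>. The
  multiplier is \<open>- mu\<close>, since the two terms must cancel in the residual.\<close>

lemma GNE_imp_residual_zero:
  assumes game: "standing_game \<Gamma>" and gne: "is_GNE \<Gamma> x"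
  shows "\<exists>lam. \<forall>r\<in>gidx \<Gamma>. residual \<Gamma> (case_sum x lam) r = 0"
proof -
  have "\<exists>mu. \<forall>k\<in>{..<dim \<Gamma>}. gradJ \<Gamma> i x (i, k) = matvec (tr (\<lambda>l k. Am \<Gamma> i l (i, k))) {..<mc \<Gamma> i} mu k" if i: "i < np \<Gamma>" for i
  proof (rule kernel_annihilator_in_row_span)
    fix w assume "\<And>l. l \<in> {..<mc \<Gamma> i} \<Longrightarrow> matvec (\<lambda>l k. Am \<Gamma> i l (i, k)) {..<dim \<Gamma>} w l = 0"
    then have w: "(\<Sum>k<dim \<Gamma>. Am \<Gamma> i l (i, k) * w k) = 0" if "l < mc \<Gamma> i" for l
      using that by (simp add: matvec_def)
    let ?D = "\<Sum>k<dim \<Gamma>. gradJ \<Gamma> i x (i, k) * w k"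
    have "0 \<le> s * ?D + s\<^sup>2 / 2 * qform \<Gamma> i (own_dir i w)" for s
    proof -
      have "feasible \<Gamma> i (repl x i (\<lambda>k. x (i, k) + s * w k))"
        using gne i unfolding feasible_def repl_eq_add_own_dir resid_add sum_own_dir[OF i]
        by (auto simp: is_GNE_def feasible_def w)
      then have "Jc \<Gamma> i x \<le> Jc \<Gamma> i (repl x i (\<lambda>k. x (i, k) + s * w k))"
        using gne i unfolding is_GNE_def by blast
      then show ?thesis
        unfolding repl_eq_add_own_dir Jc_add[OF game i] sum_own_dir[OF i] by simp
    qed
    \<comment> \<open>Scaling the step by the derivative itself makes the linear coefficient a
      square, which meets the sign hypothesis of
      \<open>quadratic_nonneg_imp_linear_zero\<close>.\<close>
    from this[of "e * 2 * ?D" for e]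
    have "0 \<le> 2 * e * ?D\<^sup>2 + e\<^sup>2 * (2 * ?D\<^sup>2 * qform \<Gamma> i (own_dir i w))" for e
      by (simp add: power2_eq_square mult_ac)
    then have "?D\<^sup>2 = 0" by (rule quadratic_nonneg_imp_linear_zero) simp
    then show "ip {..<dim \<Gamma>} (\<lambda>k. gradJ \<Gamma> i x (i, k)) w = 0" by (simp add: ip_def)
  qed simp_all
  then obtain mu where mu: "\<And>i k. i < np \<Gamma> \<Longrightarrow> k < dim \<Gamma> \<Longrightarrow>
      gradJ \<Gamma> i x (i, k) = (\<Sum>l<mc \<Gamma> i. Am \<Gamma> i l (i, k) * mu i l)"
    unfolding matvec_def by (metis lessThan_iff)
  show ?thesis
  proof (rule exI[of _ "\<lambda>(i, l). - mu i l"])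
    show "\<forall>r\<in>gidx \<Gamma>. residual \<Gamma> (case_sum x (\<lambda>(i, l). - mu i l)) r = 0"
      using gne unfolding ball_gidx
      by (simp add: residual_Inl residual_Inr gradL_eq_gradJ mu sum_negf is_GNE_def feasible_def)
  qed
qed

text \<open>The difference to a feasible deviation lies in the kernel of the own constraint block.
  Stationarity pairs it with the multipliers, so the linear term vanishes, and convexity in the own
  action handles the quadratic term.\<close>

lemma residual_zero_imp_GNE:
  assumes game: "standing_game \<Gamma>" and z: "\<forall>r\<in>gidx \<Gamma>. residual \<Gamma> (case_sum x lam) r = 0"
  shows "is_GNE \<Gamma> x"
  unfolding is_GNE_def
proof (intro allI impI conjI)
  fix i assume i: "i < np \<Gamma>"
  show feas: "feasible \<Gamma> i x"
    using z i unfolding ball_gidx by (simp add: feasible_def residual_Inr)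
  fix y assume y: "feasible \<Gamma> i (repl x i y)"
  define w where "w k = y k - x (i, k)" for k
  have rep: "repl x i y = (\<lambda>p. x p + 1 * own_dir i w p)"
    using repl_eq_add_own_dir[of x i 1 w] by (simp add: w_def)
  have Aw: "(\<Sum>k<dim \<Gamma>. Am \<Gamma> i l (i, k) * w k) = 0" if "l < mc \<Gamma> i" for l
  proof -
    have "resid \<Gamma> i l (repl x i y) = 0" "resid \<Gamma> i l x = 0"
      using y feas that by (auto simp: feasible_def)
    then show ?thesis unfolding rep resid_add sum_own_dir[OF i] by simp
  qed
  have g: "gradJ \<Gamma> i x (i, k) = - (\<Sum>l<mc \<Gamma> i. Am \<Gamma> i l (i, k) * lam (i, l))" if "k < dim \<Gamma>" for k
    using z i that unfolding ball_gidx by (simp add: residual_Inl gradL_eq_gradJ eq_neg_iff_add_eq_0)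
  have "(\<Sum>k<dim \<Gamma>. gradJ \<Gamma> i x (i, k) * w k) = - (\<Sum>k<dim \<Gamma>. \<Sum>l<mc \<Gamma> i. lam (i, l) * (Am \<Gamma> i l (i, k) * w k))"
    by (simp add: g sum_negf sum_distrib_left mult_ac)
  also have "\<dots> = - (\<Sum>l<mc \<Gamma> i. lam (i, l) * (\<Sum>k<dim \<Gamma>. Am \<Gamma> i l (i, k) * w k))"
    by (subst sum.swap) (simp add: sum_distrib_left)
  also have "\<dots> = 0" by (simp add: Aw)
  finally have "(\<Sum>k<dim \<Gamma>. gradJ \<Gamma> i x (i, k) * w k) = 0" .
  then show "Jc \<Gamma> i x \<le> Jc \<Gamma> i (repl x i y)"
    unfolding rep Jc_add[OF game i] sum_own_dir[OF i] using qform_own_dir_nonneg[OF game i, of w] by simp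
qed

section \<open>The smallest positive singular value\<close>

lemma sing_val_iff:
  "sing_val \<Gamma> s \<longleftrightarrow> 0 \<le> s \<and> (\<exists>v. (\<exists>j\<in>gidx \<Gamma>. v j \<noteq> 0) \<and>
    (\<forall>j\<in>gidx \<Gamma>. matvec (tr (Gmat \<Gamma>)) (gidx \<Gamma>) (matvec (Gmat \<Gamma>) (gidx \<Gamma>) v) j = s\<^sup>2 * v j))"
proof -
  have "(\<Sum>k\<in>gidx \<Gamma>. (\<Sum>rr\<in>gidx \<Gamma>. Gmat \<Gamma> rr j * Gmat \<Gamma> rr k) * v k)
      = matvec (tr (Gmat \<Gamma>)) (gidx \<Gamma>) (matvec (Gmat \<Gamma>) (gidx \<Gamma>) v) j" for v j
    unfolding matvec_def sum_distrib_left sum_distrib_right by (subst sum.swap) (simp add: mult.assoc)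
  then show ?thesis unfolding sing_val_def by simp
qed

text \<open>The infimum is attained: the eigenvector of \<open>spectral_gap\<close> makes sqrt m a
  singular value, and the gap inequality applied to the eigenvector of any other positive one shows
  that it is at least sqrt m.\<close>

lemma sigma_min_pos_gap:
  assumes nz: "\<exists>s. 0 < s \<and> sing_val \<Gamma> s"
  shows "0 < sigma_min_pos \<Gamma>"
    and "(sigma_min_pos \<Gamma>)\<^sup>2 * ip (gidx \<Gamma>) (matvec (Gmat \<Gamma>) (gidx \<Gamma>) v) (matvec (Gmat \<Gamma>) (gidx \<Gamma>) v)
      \<le> ip (gidx \<Gamma>) (matvec (tr (Gmat \<Gamma>)) (gidx \<Gamma>) (matvec (Gmat \<Gamma>) (gidx \<Gamma>) v))
           (matvec (tr (Gmat \<Gamma>)) (gidx \<Gamma>) (matvec (Gmat \<Gamma>) (gidx \<Gamma>) v))"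
    and "\<exists>r\<in>gidx \<Gamma>. \<exists>c\<in>gidx \<Gamma>. Gmat \<Gamma> r c \<noteq> 0"
proof -
  let ?I = "gidx \<Gamma>" and ?G = "Gmat \<Gamma>"
  let ?g = "matvec ?G ?I" and ?t = "matvec (tr ?G) ?I"
  show entry: "\<exists>r\<in>?I. \<exists>c\<in>?I. ?G r c \<noteq> 0"
  proof (rule ccontr)
    assume "\<not> ?thesis"
    then have "?t u c = 0" if "c \<in> ?I" for u c using that by (simp add: matvec_def)
    then show False using nz unfolding sing_val_iff by force
  qed
  obtain m v0 where m: "m > 0" and v0: "\<exists>c\<in>?I. v0 c \<noteq> 0"
    and eig: "\<And>c. c \<in> ?I \<Longrightarrow> ?t (?g v0) c = m * v0 c"
    and gap: "\<And>v. m * ip ?I (?g v) (?g v) \<le> ip ?I (?t (?g v)) (?t (?g v))"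
    using spectral_gap[OF finite_gidx finite_gidx entry] by metis
  have "0 < sqrt m \<and> sing_val \<Gamma> (sqrt m)"
    unfolding sing_val_iff using m v0 eig by auto
  moreover have "sqrt m \<le> s" if s: "0 < s" "sing_val \<Gamma> s" for s
  proof -
    obtain v where v: "\<exists>c\<in>?I. v c \<noteq> 0" and e: "\<And>c. c \<in> ?I \<Longrightarrow> ?t (?g v) c = s\<^sup>2 * v c"
      using s(2) unfolding sing_val_iff by blast
    have n: "ip ?I v v > 0"
      using v ip_self_eq_0_iff[OF finite_gidx, of \<Gamma> v] ip_nonneg[of ?I v] by force
    have "ip ?I (?g v) (?g v) = ip ?I v (?t (?g v))" by (rule ip_adjoint)
    also have "\<dots> = ip ?I (\<lambda>c. 1 * v c) (\<lambda>c. s\<^sup>2 * v c)" by (rule ip_cong) (simp_all add: e)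
    also have "\<dots> = s\<^sup>2 * ip ?I v v" unfolding ip_scale by simp
    finally have 1: "ip ?I (?g v) (?g v) = s\<^sup>2 * ip ?I v v" .
    have "ip ?I (?t (?g v)) (?t (?g v)) = ip ?I (\<lambda>c. s\<^sup>2 * v c) (\<lambda>c. s\<^sup>2 * v c)"
      by (rule ip_cong) (simp_all add: e)
    also have "\<dots> = s\<^sup>2 * (s\<^sup>2 * ip ?I v v)" unfolding ip_scale by simp
    finally have "m * (s\<^sup>2 * ip ?I v v) \<le> s\<^sup>2 * (s\<^sup>2 * ip ?I v v)"
      using gap[of v] 1 by simp
    moreover have "0 < s\<^sup>2 * ip ?I v v" using n s(1) by simp
    ultimately have "m \<le> s\<^sup>2" by (rule mult_right_le_imp_le)
    then show ?thesis using s(1) by (simp add: real_le_lsqrt)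
  qed
  ultimately have "sigma_min_pos \<Gamma> = sqrt m"
    unfolding sigma_min_pos_def by (intro cInf_eq_minimum) auto
  then show "0 < sigma_min_pos \<Gamma>"
    and "(sigma_min_pos \<Gamma>)\<^sup>2 * ip ?I (?g v) (?g v) \<le> ip ?I (?t (?g v)) (?t (?g v))"
    using m gap by simp_all
qed

section \<open>The zero-order search direction\<close>

type_synonym coord = "(nat \<times> nat) + (nat \<times> nat)"
type_synonym noise = "nat \<times> (nat \<times> nat) \<Rightarrow> real"

text \<open>
  The noise of one step is y: y (0, _) is xi_x, y (1, _) is xi_lambda and y (2, _) is eta.
  Affine functions of the state are written as linear forms on homogeneous coordinates, where
  None indexes the constant coordinate 1.
\<close>

definition noise_ix :: "coord \<Rightarrow> nat \<times> (nat \<times> nat)" where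
  "noise_ix c = (case c of Inl p \<Rightarrow> (0, p) | Inr q \<Rightarrow> (1, q))"

definition Gmat1 :: "game \<Rightarrow> coord \<Rightarrow> coord option \<Rightarrow> real" where
  "Gmat1 \<Gamma> r b = (case b of None \<Rightarrow> offset \<Gamma> r | Some c \<Rightarrow> Gmat \<Gamma> r c)"

definition Lrow1 :: "game \<Rightarrow> nat \<Rightarrow> nat \<times> nat \<Rightarrow> coord option \<Rightarrow> real" where
  "Lrow1 \<Gamma> i p b = (case b of None \<Rightarrow> rv \<Gamma> i p | Some c \<Rightarrow> Lrow \<Gamma> i p c)"

definition homog :: "(coord \<Rightarrow> real) \<Rightarrow> coord option \<Rightarrow> real" where
  "homog z b = (case b of None \<Rightarrow> 1 | Some c \<Rightarrow> z c)"

definition gidx1 :: "game \<Rightarrow> coord option set" where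
  "gidx1 \<Gamma> = insert None (Some ` gidx \<Gamma>)"

lemma sum_gidx1: "(\<Sum>b\<in>gidx1 \<Gamma>. h b) = h None + (\<Sum>c\<in>gidx \<Gamma>. h (Some c))"
  unfolding gidx1_def by (subst sum.insert) (auto simp: finite_gidx sum.reindex)

lemma gradL_affine: "gradL \<Gamma> i z p = (\<Sum>b\<in>gidx1 \<Gamma>. homog z b * Lrow1 \<Gamma> i p b)"
  by (simp add: sum_gidx1 homog_def Lrow1_def gradL_def matvec_def mult.commute)

lemma residual_affine: "residual \<Gamma> z r = (\<Sum>b\<in>gidx1 \<Gamma>. homog z b * Gmat1 \<Gamma> r b)"
  by (simp add: sum_gidx1 homog_def Gmat1_def residual_def matvec_def mult.commute)

text \<open>
  For player i, let V be the derivative of the Lagrangian along eta at z, and slope the one of its linear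
  part at (xi_x, xi_lambda). Then S_1 = ((V + \<delta> slope)^2 - V^2) / \<delta> = slope (2 V + \<delta> slope), and
  S_2 - d S_1 = S_1 weight; the coefficients of V and of the sum of the Delta_3 with respect to the
  homogeneous coordinate b are grad_coef and constr_coef.
\<close>

definition weight :: "game \<Rightarrow> nat \<Rightarrow> noise \<Rightarrow> real" where
  "weight \<Gamma> i y = (\<Sum>k<dim \<Gamma>. (y (2, (i, k)))\<^sup>2 - 1)"

definition slope :: "game \<Rightarrow> nat \<Rightarrow> noise \<Rightarrow> real" where
  "slope \<Gamma> i y = (\<Sum>p\<in>xidx \<Gamma>. \<Sum>c\<in>gidx \<Gamma>. Lrow \<Gamma> i p c * y (noise_ix c) * y (2, p))"

definition grad_coef :: "game \<Rightarrow> nat \<Rightarrow> coord option \<Rightarrow> noise \<Rightarrow> real" where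
  "grad_coef \<Gamma> i b y = (\<Sum>q\<in>xidx \<Gamma>. Lrow1 \<Gamma> i q b * y (2, q))"

definition constr_coef :: "game \<Rightarrow> coord option \<Rightarrow> noise \<Rightarrow> real" where
  "constr_coef \<Gamma> b y = (\<Sum>i<np \<Gamma>. \<Sum>l<mc \<Gamma> i. 2 * Gmat1 \<Gamma> (Inr (i, l)) b * (\<Sum>q\<in>xidx \<Gamma>. Am \<Gamma> i l q * y (2, q)))"

text \<open>The estimate for x sums over all players, the one for a multiplier uses its owner only.\<close>

definition own :: "nat \<Rightarrow> coord \<Rightarrow> real" where
  "own i j = (case j of Inl _ \<Rightarrow> 1 | Inr q \<Rightarrow> if fst q = i then 1 else 0)"

text \<open>The three groups are the signal, the term of order delta and the constraint estimate.
  The delta term does not involve the state and so belongs to the constant coordinate; the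
  constraint estimate enters only the update of x.\<close>

definition coef :: "game \<Rightarrow> real \<Rightarrow> coord \<Rightarrow> coord option \<Rightarrow> noise \<Rightarrow> real" where
  "coef \<Gamma> \<delta> j b y = (\<Sum>i<np \<Gamma>. own i j * (weight \<Gamma> i y * slope \<Gamma> i y * grad_coef \<Gamma> i b y * y (noise_ix j)))
    + (if b = None then (\<Sum>i<np \<Gamma>. own i j * (\<delta> / 2 * (weight \<Gamma> i y * slope \<Gamma> i y * slope \<Gamma> i y * y (noise_ix j)))) else 0)
    + (case j of Inl p \<Rightarrow> constr_coef \<Gamma> b y * y (2, p) | Inr _ \<Rightarrow> 0)"

lemma coef_sum:
  "(\<Sum>b\<in>gidx1 \<Gamma>. homog z b * coef \<Gamma> \<delta> j b y)
    = (\<Sum>i<np \<Gamma>. own i j * (weight \<Gamma> i y * slope \<Gamma> i y * (\<Sum>p\<in>xidx \<Gamma>. gradL \<Gamma> i z p * y (2, p)) * y (noise_ix j)))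
      + (\<Sum>i<np \<Gamma>. own i j * (\<delta> / 2 * (weight \<Gamma> i y * slope \<Gamma> i y * slope \<Gamma> i y * y (noise_ix j))))
      + (case j of Inl p \<Rightarrow> (\<Sum>i<np \<Gamma>. \<Sum>l<mc \<Gamma> i. 2 * residual \<Gamma> z (Inr (i, l)) * (\<Sum>q\<in>xidx \<Gamma>. Am \<Gamma> i l q * y (2, q))) * y (2, p) | Inr _ \<Rightarrow> 0)"
proof -
  let ?I = "gidx1 \<Gamma>"
  have V: "(\<Sum>p\<in>xidx \<Gamma>. gradL \<Gamma> i z p * y (2, p)) = (\<Sum>b\<in>?I. homog z b * grad_coef \<Gamma> i b y)" for i
    unfolding gradL_affine grad_coef_def sum_distrib_left sum_distrib_right
    by (subst sum.swap) (simp add: mult.assoc)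
  have 1: "(\<Sum>b\<in>?I. homog z b * (\<Sum>i<np \<Gamma>. own i j * (weight \<Gamma> i y * slope \<Gamma> i y * grad_coef \<Gamma> i b y * y (noise_ix j))))
      = (\<Sum>i<np \<Gamma>. own i j * (weight \<Gamma> i y * slope \<Gamma> i y * (\<Sum>p\<in>xidx \<Gamma>. gradL \<Gamma> i z p * y (2, p)) * y (noise_ix j)))"
    unfolding V sum_distrib_left sum_distrib_right by (subst sum.swap) (simp add: mult_ac)
  have 2: "(\<Sum>b\<in>?I. homog z b * (if b = None then D else 0)) = D" for D
    by (simp add: sum_gidx1 homog_def)
  have C: "(\<Sum>b\<in>?I. homog z b * constr_coef \<Gamma> b y)
      = (\<Sum>i<np \<Gamma>. \<Sum>l<mc \<Gamma> i. 2 * residual \<Gamma> z (Inr (i, l)) * (\<Sum>q\<in>xidx \<Gamma>. Am \<Gamma> i l q * y (2, q)))"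
  proof -
    have "(\<Sum>b\<in>?I. homog z b * constr_coef \<Gamma> b y)
        = (\<Sum>i<np \<Gamma>. \<Sum>b\<in>?I. \<Sum>l<mc \<Gamma> i. homog z b * (2 * Gmat1 \<Gamma> (Inr (i, l)) b * (\<Sum>q\<in>xidx \<Gamma>. Am \<Gamma> i l q * y (2, q))))"
      unfolding constr_coef_def sum_distrib_left[where r="homog z _"] by (rule sum.swap)
    also have "\<dots> = (\<Sum>i<np \<Gamma>. \<Sum>l<mc \<Gamma> i. \<Sum>b\<in>?I. homog z b * (2 * Gmat1 \<Gamma> (Inr (i, l)) b * (\<Sum>q\<in>xidx \<Gamma>. Am \<Gamma> i l q * y (2, q))))"
      by (intro sum.cong refl sum.swap)
    also have "\<dots> = (\<Sum>i<np \<Gamma>. \<Sum>l<mc \<Gamma> i. 2 * residual \<Gamma> z (Inr (i, l)) * (\<Sum>q\<in>xidx \<Gamma>. Am \<Gamma> i l q * y (2, q)))"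
    proof (intro sum.cong refl)
      fix i l
      define T where "T = (\<Sum>q\<in>xidx \<Gamma>. Am \<Gamma> i l q * y (2, q))"
      show "(\<Sum>b\<in>?I. homog z b * (2 * Gmat1 \<Gamma> (Inr (i, l)) b * (\<Sum>q\<in>xidx \<Gamma>. Am \<Gamma> i l q * y (2, q))))
          = 2 * residual \<Gamma> z (Inr (i, l)) * (\<Sum>q\<in>xidx \<Gamma>. Am \<Gamma> i l q * y (2, q))"
        unfolding T_def[symmetric] residual_affine sum_distrib_left sum_distrib_right by (simp add: mult_ac)
    qed
    finally show ?thesis .
  qed
  have 3: "(\<Sum>b\<in>?I. homog z b * (case j of Inl p \<Rightarrow> constr_coef \<Gamma> b y * y (2, p) | Inr _ \<Rightarrow> 0))
      = (case j of Inl p \<Rightarrow> (\<Sum>i<np \<Gamma>. \<Sum>l<mc \<Gamma> i. 2 * residual \<Gamma> z (Inr (i, l)) * (\<Sum>q\<in>xidx \<Gamma>. Am \<Gamma> i l q * y (2, q))) * y (2, p) | Inr _ \<Rightarrow> 0)"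
  proof (cases j)
    case (Inl p)
    have "(\<Sum>b\<in>?I. homog z b * (constr_coef \<Gamma> b y * y (2, p))) = (\<Sum>b\<in>?I. homog z b * constr_coef \<Gamma> b y) * y (2, p)"
      by (simp add: sum_distrib_right mult.assoc)
    then show ?thesis using Inl by (simp only: C sum.case)
  qed simp
  show ?thesis
    unfolding coef_def distrib_left sum.distrib 1 2 3 ..
qed

text \<open>A step is a pairing of the homogeneous state with coefficients in the fresh noise alone,
  so independence will factor every moment. The identity is exact for all nonzero sigma and delta
  because the finite differences are taken of quadratics.\<close>

lemma zo_step_eq:
  fixes y :: noise and gam :: real and st :: "(nat \<times> nat \<Rightarrow> real) \<times> (nat \<times> nat \<Rightarrow> real)"
  assumes game: "standing_game \<Gamma>" and \<sigma>: "\<sigma> \<noteq> 0" and \<delta>: "\<delta> \<noteq> 0" and j: "j \<in> gidx \<Gamma>"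
  defines "st' \<equiv> zo_step \<Gamma> \<sigma> \<delta> gam (\<lambda>p. y (0, p)) (\<lambda>q. y (1, q)) (\<lambda>p. y (2, p)) st"
  shows "case_sum (fst st') (snd st') j
    = case_sum (fst st) (snd st) j
      - gam * (\<Sum>b\<in>gidx1 \<Gamma>. homog (case_sum (fst st) (snd st)) b * coef \<Gamma> \<delta> j b y)"
proof -
  let ?x = "fst st" and ?lam = "snd st"
  let ?z = "case_sum ?x ?lam"
  define V where "V i = (\<Sum>p\<in>xidx \<Gamma>. gradL \<Gamma> i ?z p * y (2, p))" for i
  define U where "U i = slope \<Gamma> i y" for i
  define W where "W i = weight \<Gamma> i y" for i
  define A where "A i l = (\<Sum>q\<in>xidx \<Gamma>. Am \<Gamma> i l q * y (2, q))" for i l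
  define E where "E i = (\<Sum>l<mc \<Gamma> i. 2 * residual \<Gamma> ?z (Inr (i, l)) * A i l)" for i
  have lagdiff: "(Lag \<Gamma> i (\<lambda>p. x p + \<sigma> * y (2, p)) lam - Lag \<Gamma> i (\<lambda>p. x p - \<sigma> * y (2, p)) lam) / (2 * \<sigma>)
      = (\<Sum>p\<in>xidx \<Gamma>. gradL \<Gamma> i (case_sum x lam) p * y (2, p))" if "i < np \<Gamma>" for i x lam
    using Lag_add[OF game that, of x \<sigma> "\<lambda>p. y (2, p)" lam] Lag_add[OF game that, of x "- \<sigma>" "\<lambda>p. y (2, p)" lam] \<sigma>
    by simp
  have D1: "(Lag \<Gamma> i (\<lambda>p. ?x p + \<sigma> * y (2, p)) ?lam - Lag \<Gamma> i (\<lambda>p. ?x p - \<sigma> * y (2, p)) ?lam) / (2 * \<sigma>) = V i"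
    if "i < np \<Gamma>" for i
    unfolding V_def by (rule lagdiff[OF that])
  have D2: "(Lag \<Gamma> i (\<lambda>p. ?x p + \<delta> * y (0, p) + \<sigma> * y (2, p)) (\<lambda>q. ?lam q + \<delta> * y (1, q))
      - Lag \<Gamma> i (\<lambda>p. ?x p + \<delta> * y (0, p) - \<sigma> * y (2, p)) (\<lambda>q. ?lam q + \<delta> * y (1, q))) / (2 * \<sigma>) = V i + \<delta> * U i"
    if i: "i < np \<Gamma>" for i
  proof -
    have "case_sum (\<lambda>p. ?x p + \<delta> * y (0, p)) (\<lambda>q. ?lam q + \<delta> * y (1, q)) = (\<lambda>c. ?z c + \<delta> * y (noise_ix c))"
      by (auto simp: noise_ix_def fun_eq_iff split: sum.splits)
    then have "gradL \<Gamma> i (case_sum (\<lambda>p. ?x p + \<delta> * y (0, p)) (\<lambda>q. ?lam q + \<delta> * y (1, q))) p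
        = gradL \<Gamma> i ?z p + \<delta> * matvec (Lrow \<Gamma> i) (gidx \<Gamma>) (\<lambda>c. y (noise_ix c)) p" for p
      by (simp add: gradL_def matvec_add_scaled)
    then have "(\<Sum>p\<in>xidx \<Gamma>. gradL \<Gamma> i (case_sum (\<lambda>p. ?x p + \<delta> * y (0, p)) (\<lambda>q. ?lam q + \<delta> * y (1, q))) p * y (2, p))
        = V i + \<delta> * (\<Sum>p\<in>xidx \<Gamma>. matvec (Lrow \<Gamma> i) (gidx \<Gamma>) (\<lambda>c. y (noise_ix c)) p * y (2, p))"
      by (simp add: V_def distrib_right sum.distrib sum_distrib_left mult.assoc)
    also have "(\<Sum>p\<in>xidx \<Gamma>. matvec (Lrow \<Gamma> i) (gidx \<Gamma>) (\<lambda>c. y (noise_ix c)) p * y (2, p)) = U i"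
      by (simp add: U_def slope_def matvec_def sum_distrib_right)
    finally show ?thesis
      by (rule trans[OF lagdiff[OF i, of "\<lambda>p. ?x p + \<delta> * y (0, p)" "\<lambda>q. ?lam q + \<delta> * y (1, q)"]])
  qed
  have D3: "(cfun \<Gamma> i (\<lambda>p. ?x p + \<sigma> * y (2, p)) - cfun \<Gamma> i (\<lambda>p. ?x p - \<sigma> * y (2, p))) / (2 * \<sigma>) = E i" for i
  proof -
    have "cfun \<Gamma> i (\<lambda>p. ?x p + \<sigma> * y (2, p)) - cfun \<Gamma> i (\<lambda>p. ?x p - \<sigma> * y (2, p)) = (\<Sum>l<mc \<Gamma> i. 4 * \<sigma> * (resid \<Gamma> i l ?x * A i l))"
    proof -
      have "(resid \<Gamma> i l (\<lambda>p. ?x p + \<sigma> * y (2, p)))\<^sup>2 - (resid \<Gamma> i l (\<lambda>p. ?x p - \<sigma> * y (2, p)))\<^sup>2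
          = 4 * \<sigma> * (resid \<Gamma> i l ?x * A i l)" for l
      proof -
        have p: "resid \<Gamma> i l (\<lambda>p. ?x p + \<sigma> * y (2, p)) = resid \<Gamma> i l ?x + \<sigma> * A i l"
          unfolding A_def by (rule resid_add)
        have m: "resid \<Gamma> i l (\<lambda>p. ?x p - \<sigma> * y (2, p)) = resid \<Gamma> i l ?x - \<sigma> * A i l"
          using resid_add[of \<Gamma> i l ?x "- \<sigma>" "\<lambda>p. y (2, p)"] by (simp add: A_def)
        show ?thesis unfolding p m by (simp add: power2_eq_square algebra_simps)
      qed
      then show ?thesis unfolding cfun_def sum_subtractf[symmetric] by simp
    qed
    also have "\<dots> = 2 * \<sigma> * E i"
      by (simp add: E_def residual_Inr sum_distrib_left mult_ac)
    finally show ?thesis using \<sigma> by simp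
  qed
  have S: "((V i + \<delta> * U i)\<^sup>2 - (V i)\<^sup>2) / \<delta> * (\<Sum>k<dim \<Gamma>. (y (2, (i, k)))\<^sup>2)
      - real (dim \<Gamma>) * (((V i + \<delta> * U i)\<^sup>2 - (V i)\<^sup>2) / \<delta>) = 2 * (W i * U i * V i + \<delta> / 2 * (W i * U i * U i))" for i
  proof -
    have "((V i + \<delta> * U i)\<^sup>2 - (V i)\<^sup>2) / \<delta> = 2 * U i * V i + \<delta> * U i * U i"
      using \<delta> by (simp add: field_simps power2_eq_square)
    moreover have "(\<Sum>k<dim \<Gamma>. (y (2, (i, k)))\<^sup>2) = W i + real (dim \<Gamma>)"
      by (simp add: W_def weight_def sum_subtractf)
    ultimately show ?thesis by (simp only:) (simp add: algebra_simps)
  qed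
  show ?thesis
  proof (cases j)
    case (Inl p)
    have "case_sum (fst st') (snd st') j
        = ?x p - gam * (1 / 2 * (\<Sum>i<np \<Gamma>. 2 * (W i * U i * V i + \<delta> / 2 * (W i * U i * U i))) * y (0, p) + (\<Sum>i<np \<Gamma>. E i) * y (2, p))"
      unfolding Inl sum.case st'_def zo_step_def Let_def fst_conv
      by (intro arg_cong2[where f="(-)"] arg_cong2[where f="(*)"] arg_cong2[where f="(+)"] sum.cong refl)
        (simp_all only: D1 D2 D3 S lessThan_iff)
    also have "1 / 2 * (\<Sum>i<np \<Gamma>. 2 * (W i * U i * V i + \<delta> / 2 * (W i * U i * U i))) * y (0, p)
        = (\<Sum>i<np \<Gamma>. W i * U i * V i * y (0, p)) + (\<Sum>i<np \<Gamma>. \<delta> / 2 * (W i * U i * U i * y (0, p)))"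
      by (simp add: sum_distrib_left sum_distrib_right algebra_simps flip: sum.distrib)
    finally show ?thesis
      unfolding coef_sum Inl by (simp add: own_def noise_ix_def U_def W_def V_def E_def A_def)
  next
    case (Inr q)
    obtain i l where q: "q = (i, l)" by (cases q)
    have i: "i < np \<Gamma>" using j by (auto simp: Inr q gidx_def lidx_def)
    have r: "case_sum (fst st') (snd st') j
        = ?lam q - gam * (1 / 2 * (2 * (W i * U i * V i + \<delta> / 2 * (W i * U i * U i))) * y (1, q))"
      unfolding Inr q sum.case st'_def zo_step_def Let_def snd_conv prod.case
      by (simp only: D1[OF i] D2[OF i] S)
    \<comment> \<open>For a multiplier coordinate \<open>own\<close> singles out its player,
      matching the update of lambda, which has no sum over players.\<close>
    have o: "(\<Sum>i'<np \<Gamma>. own i' j * h i') = h i" for h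
    proof -
      have "(\<Sum>i'<np \<Gamma>. own i' j * h i') = (\<Sum>i'<np \<Gamma>. if i' = i then h i else 0)"
        by (intro sum.cong) (auto simp: own_def Inr q)
      then show ?thesis using i by simp
    qed
    show ?thesis
      unfolding r coef_sum o by (simp add: Inr noise_ix_def U_def W_def V_def algebra_simps)
  qed
qed

section \<open>Unbiasedness of the search direction\<close>

lemma noise_ix_eq_iff [simp]: "noise_ix c = noise_ix c' \<longleftrightarrow> c = c'"
  by (auto simp: noise_ix_def split: sum.splits)

lemma noise_ix_neq [simp]: "noise_ix c \<noteq> (2, p)" "(2, p) \<noteq> noise_ix c"
  by (auto simp: noise_ix_def split: sum.splits)

interpretation gauss: prob_space gauss
  by (rule prob_space_gauss)

lemma fin_moments_if: "fin_moments M f \<Longrightarrow> fin_moments M h \<Longrightarrow> fin_moments M (\<lambda>\<omega>. if P then f \<omega> else h \<omega>)"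
  by (cases P) simp_all

lemmas gauss_intros = fin_moments_mult fin_moments_add gauss.fin_moments_sum gauss.fin_moments_diff
  gauss.fin_moments_const fin_moments_gauss_component

lemma fin_moments_weight: "fin_moments gauss (weight \<Gamma> i)"
  unfolding weight_def power2_eq_square by (intro gauss_intros)

lemma fin_moments_slope: "fin_moments gauss (slope \<Gamma> i)"
  unfolding slope_def by (intro gauss_intros)

lemma fin_moments_grad_coef: "fin_moments gauss (grad_coef \<Gamma> i b)"
  unfolding grad_coef_def by (intro gauss_intros)

lemma fin_moments_constr_coef: "fin_moments gauss (constr_coef \<Gamma> b)"
  unfolding constr_coef_def by (intro gauss_intros)

lemma fin_moments_coef: "fin_moments gauss (coef \<Gamma> \<delta> j b)"
proof -
  have "fin_moments gauss (\<lambda>y. case j of Inl p \<Rightarrow> constr_coef \<Gamma> b y * y (2, p) | Inr _ \<Rightarrow> 0)"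
    by (cases j) (auto intro!: gauss_intros fin_moments_constr_coef)
  moreover have "fin_moments gauss (\<lambda>y. if b = None then (\<Sum>i<np \<Gamma>. own i j * (\<delta> / 2 * (weight \<Gamma> i y * slope \<Gamma> i y * slope \<Gamma> i y * y (noise_ix j)))) else 0)"
    by (intro fin_moments_if gauss_intros fin_moments_weight fin_moments_slope)
  ultimately show ?thesis
    unfolding coef_def[abs_def] by (intro gauss_intros fin_moments_weight fin_moments_slope fin_moments_grad_coef)
qed

lemma mom_Suc: "mom (Suc 0) = 0" "mom (Suc (Suc 0)) = 1" "mom (Suc (Suc (Suc (Suc 0)))) = 3"
  using mom_odd[of 1] mom_2 mom_4 by (simp_all add: numeral_eq_Suc)

lemma integral_weighted_monomial:
  "(\<integral>y. prod_list (map y js) * ((y r)\<^sup>2 - 1) \<partial>gauss)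
    = (\<integral>y. prod_list (map y (r # r # js)) \<partial>gauss) - (\<integral>y. prod_list (map y js) \<partial>gauss)"
proof -
  have "(\<lambda>y :: _ \<Rightarrow> real. prod_list (map y js) * ((y r)\<^sup>2 - 1)) = (\<lambda>y. prod_list (map y (r # r # js)) - prod_list (map y js))"
    by (auto simp: fun_eq_iff power2_eq_square right_diff_distrib mult_ac)
  then show ?thesis by (simp only: Bochner_Integration.integral_diff[OF integrable_gauss_monomial integrable_gauss_monomial])
qed

text \<open>The factor eta_r^2 - 1 is a second Hermite polynomial: for p = q other than r it
  averages out as 1 - 1, and for p = q = r it gives 3 - 1 = 2. Hence the weight of player i keeps
  only the gradient entries of that player's own block, although eta perturbs all players at
  once.\<close>

lemma moment_signal:
  "(\<integral>y. prod_list (map y [noise_ix c, noise_ix j, (2, p), (2, q)]) * ((y (2, r))\<^sup>2 - 1) \<partial>gauss)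
    = (if q = r then if p = r then if c = j then 2 else 0 else 0 else 0)"
proof (cases "c = j \<and> p = q")
  case True
  then show ?thesis
    unfolding integral_weighted_monomial integral_gauss_monomial
    by (cases "q = r") (auto simp: mom_Suc insert_commute)
next
  case False
  \<comment> \<open>If c and j differ, the index of c occurs once; otherwise p and q differ and p is
    odd. The extra pair of r does not alter parity, so one witness serves both lists.\<close>
  then have "\<exists>x. odd (count_list [(2, r), (2, r), noise_ix c, noise_ix j, (2, p), (2, q)] x) \<and> odd (count_list [noise_ix c, noise_ix j, (2, p), (2, q)] x)"
    by (intro exI[of _ "if c = j then (2, p) else noise_ix c"]) auto
  then have "(\<integral>y. prod_list (map y [noise_ix c, noise_ix j, (2, p), (2, q)]) * ((y (2, r))\<^sup>2 - 1) \<partial>gauss) = 0"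
    unfolding integral_weighted_monomial by (metis diff_self integral_gauss_monomial_odd)
  then show ?thesis using False by auto
qed

text \<open>Three factors come from the xi, so one of their indices has odd multiplicity: j if c =
  c', else c' if c = j, else c.\<close>

lemma moment_bias:
  "(\<integral>y. prod_list (map y [noise_ix c, noise_ix c', noise_ix j, (2, p), (2, q)]) * ((y (2, r))\<^sup>2 - 1) \<partial>gauss) = 0"
proof -
  have "\<exists>x. odd (count_list [(2, r), (2, r), noise_ix c, noise_ix c', noise_ix j, (2, p), (2, q)] x) \<and> odd (count_list [noise_ix c, noise_ix c', noise_ix j, (2, p), (2, q)] x)"
    by (intro exI[of _ "if c = c' then noise_ix j else if c = j then noise_ix c' else noise_ix c"]) auto
  then show ?thesis
    unfolding integral_weighted_monomial by (metis diff_self integral_gauss_monomial_odd)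
qed

lemma moment_cov: "(\<integral>y. y (2::nat, p) * y (2, q) \<partial>gauss) = (if p = q then 1 else 0)"
proof -
  have "(\<integral>y. y (2::nat, p) * y (2, q) \<partial>gauss) = (\<integral>y. prod_list (map y [(2::nat, p), (2, q)]) \<partial>gauss)"
    by simp
  also have "\<dots> = (if p = q then 1 else 0)"
    unfolding integral_gauss_monomial by (auto simp: mom_Suc)
  finally show ?thesis .
qed

lemma gauss_integral_sum:
  "(\<And>i. i \<in> I \<Longrightarrow> fin_moments gauss (f i)) \<Longrightarrow> (\<integral>y. (\<Sum>i\<in>I. f i y) \<partial>gauss) = (\<Sum>i\<in>I. \<integral>y. f i y \<partial>gauss)"
  by (intro Bochner_Integration.integral_sum fin_moments_integrable)

lemma mean_signal:
  assumes i: "i < np \<Gamma>" and j: "j \<in> gidx \<Gamma>"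
  shows "(\<integral>y. weight \<Gamma> i y * slope \<Gamma> i y * grad_coef \<Gamma> i b y * y (noise_ix j) \<partial>gauss)
    = 2 * (\<Sum>k<dim \<Gamma>. Lrow \<Gamma> i (i, k) j * Lrow1 \<Gamma> i (i, k) b)"
proof -
  let ?m = "\<lambda>c p q k y. prod_list (map y [noise_ix c, noise_ix j, (2, p), (2, q)]) * ((y (2, (i, k)))\<^sup>2 - 1)"
  have fm: "fin_moments gauss (?m c p q k)" for c p q k
    unfolding power2_eq_square by (intro gauss_intros gauss.fin_moments_prod_list)
  have "(\<lambda>y. weight \<Gamma> i y * slope \<Gamma> i y * grad_coef \<Gamma> i b y * y (noise_ix j))
      = (\<lambda>y. \<Sum>k<dim \<Gamma>. \<Sum>q\<in>xidx \<Gamma>. \<Sum>p\<in>xidx \<Gamma>. \<Sum>c\<in>gidx \<Gamma>.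
          ((y (2, (i, k)))\<^sup>2 - 1) * (Lrow \<Gamma> i p c * y (noise_ix c) * y (2, p)) * (Lrow1 \<Gamma> i q b * y (2, q)) * y (noise_ix j))"
    unfolding weight_def slope_def grad_coef_def
    by (simp only: sum_distrib_left[symmetric] sum_distrib_right[symmetric])
  also have "\<dots> = (\<lambda>y. \<Sum>k<dim \<Gamma>. \<Sum>q\<in>xidx \<Gamma>. \<Sum>p\<in>xidx \<Gamma>. \<Sum>c\<in>gidx \<Gamma>. Lrow \<Gamma> i p c * Lrow1 \<Gamma> i q b * ?m c p q k y)"
    by (intro ext sum.cong refl) (simp add: mult_ac)
  finally have "(\<integral>y. weight \<Gamma> i y * slope \<Gamma> i y * grad_coef \<Gamma> i b y * y (noise_ix j) \<partial>gauss)
      = (\<Sum>k<dim \<Gamma>. \<Sum>q\<in>xidx \<Gamma>. \<Sum>p\<in>xidx \<Gamma>. \<Sum>c\<in>gidx \<Gamma>. Lrow \<Gamma> i p c * Lrow1 \<Gamma> i q b * (\<integral>y. ?m c p q k y \<partial>gauss))"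
    by (simp only: gauss_integral_sum gauss_intros fm integral_mult_right_zero)
  also have "\<dots> = (\<Sum>k<dim \<Gamma>. 2 * (Lrow \<Gamma> i (i, k) j * Lrow1 \<Gamma> i (i, k) b))"
  proof (intro sum.cong refl)
    fix k assume "k \<in> {..<dim \<Gamma>}"
    then have r: "(i, k) \<in> xidx \<Gamma>" using i by (simp add: xidx_def)
    have "(\<Sum>c\<in>gidx \<Gamma>. Lrow \<Gamma> i p c * Lrow1 \<Gamma> i q b * (\<integral>y. ?m c p q k y \<partial>gauss))
        = (if p = (i, k) then if q = (i, k) then 2 * (Lrow \<Gamma> i p j * Lrow1 \<Gamma> i q b) else 0 else 0)" for p q
      unfolding moment_signal using j finite_gidx[of \<Gamma>]
      by (simp add: mult_delta_right)
    then show "(\<Sum>q\<in>xidx \<Gamma>. \<Sum>p\<in>xidx \<Gamma>. \<Sum>c\<in>gidx \<Gamma>. Lrow \<Gamma> i p c * Lrow1 \<Gamma> i q b * (\<integral>y. ?m c p q k y \<partial>gauss))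
        = 2 * (Lrow \<Gamma> i (i, k) j * Lrow1 \<Gamma> i (i, k) b)"
      using r finite_xidx[of \<Gamma>] by simp
  qed
  finally show ?thesis by (simp add: sum_distrib_left)
qed

lemma mean_bias: "(\<integral>y. weight \<Gamma> i y * slope \<Gamma> i y * slope \<Gamma> i y * y (noise_ix j) \<partial>gauss) = 0"
proof -
  let ?m = "\<lambda>c c' p q k y. prod_list (map y [noise_ix c, noise_ix c', noise_ix j, (2, p), (2, q)]) * ((y (2, (i, k)))\<^sup>2 - 1)"
  have fm: "fin_moments gauss (?m c c' p q k)" for c c' p q k
    unfolding power2_eq_square by (intro gauss_intros gauss.fin_moments_prod_list)
  have "(\<lambda>y. weight \<Gamma> i y * slope \<Gamma> i y * slope \<Gamma> i y * y (noise_ix j))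
      = (\<lambda>y. \<Sum>k<dim \<Gamma>. \<Sum>q\<in>xidx \<Gamma>. \<Sum>c'\<in>gidx \<Gamma>. \<Sum>p\<in>xidx \<Gamma>. \<Sum>c\<in>gidx \<Gamma>.
          ((y (2, (i, k)))\<^sup>2 - 1) * (Lrow \<Gamma> i p c * y (noise_ix c) * y (2, p)) * (Lrow \<Gamma> i q c' * y (noise_ix c') * y (2, q)) * y (noise_ix j))"
    unfolding weight_def slope_def
    by (simp only: sum_distrib_left[symmetric] sum_distrib_right[symmetric])
  also have "\<dots> = (\<lambda>y. \<Sum>k<dim \<Gamma>. \<Sum>q\<in>xidx \<Gamma>. \<Sum>c'\<in>gidx \<Gamma>. \<Sum>p\<in>xidx \<Gamma>. \<Sum>c\<in>gidx \<Gamma>.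
      Lrow \<Gamma> i p c * Lrow \<Gamma> i q c' * ?m c c' p q k y)"
    by (intro ext sum.cong refl) (simp add: mult_ac)
  finally have "(\<integral>y. weight \<Gamma> i y * slope \<Gamma> i y * slope \<Gamma> i y * y (noise_ix j) \<partial>gauss)
      = (\<Sum>k<dim \<Gamma>. \<Sum>q\<in>xidx \<Gamma>. \<Sum>c'\<in>gidx \<Gamma>. \<Sum>p\<in>xidx \<Gamma>. \<Sum>c\<in>gidx \<Gamma>.
          Lrow \<Gamma> i p c * Lrow \<Gamma> i q c' * (\<integral>y. ?m c c' p q k y \<partial>gauss))"
    by (simp only: gauss_integral_sum gauss_intros fm integral_mult_right_zero)
  then show ?thesis unfolding moment_bias by simp
qed

lemma mean_constr_coef:
  assumes p: "p \<in> xidx \<Gamma>"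
  shows "(\<integral>y. constr_coef \<Gamma> b y * y (2, p) \<partial>gauss) = 2 * (\<Sum>i<np \<Gamma>. \<Sum>l<mc \<Gamma> i. Am \<Gamma> i l p * Gmat1 \<Gamma> (Inr (i, l)) b)"
proof -
  have "(\<lambda>y. constr_coef \<Gamma> b y * y (2, p))
      = (\<lambda>y. \<Sum>i<np \<Gamma>. \<Sum>l<mc \<Gamma> i. \<Sum>q\<in>xidx \<Gamma>. 2 * Gmat1 \<Gamma> (Inr (i, l)) b * Am \<Gamma> i l q * (y (2, q) * y (2, p)))"
    unfolding constr_coef_def by (simp add: sum_distrib_left sum_distrib_right mult.assoc)
  then have "(\<integral>y. constr_coef \<Gamma> b y * y (2, p) \<partial>gauss)
      = (\<Sum>i<np \<Gamma>. \<Sum>l<mc \<Gamma> i. \<Sum>q\<in>xidx \<Gamma>. 2 * Gmat1 \<Gamma> (Inr (i, l)) b * Am \<Gamma> i l q * (\<integral>y. y (2::nat, q) * y (2, p) \<partial>gauss))"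
    by (simp only: gauss_integral_sum gauss_intros integral_mult_right_zero)
  also have "\<dots> = (\<Sum>i<np \<Gamma>. \<Sum>l<mc \<Gamma> i. 2 * Gmat1 \<Gamma> (Inr (i, l)) b * Am \<Gamma> i l p)"
    unfolding moment_cov using p finite_xidx[of \<Gamma>]
    by (simp add: mult_delta_right)
  finally show ?thesis by (simp add: sum_distrib_left mult_ac)
qed

lemma mean_coef:
  assumes j: "j \<in> gidx \<Gamma>"
  shows "(\<integral>y. coef \<Gamma> \<delta> j b y \<partial>gauss) = 2 * (\<Sum>r\<in>gidx \<Gamma>. Gmat \<Gamma> r j * Gmat1 \<Gamma> r b)"
proof -
  let ?A = "\<lambda>y. \<Sum>i<np \<Gamma>. own i j * (weight \<Gamma> i y * slope \<Gamma> i y * grad_coef \<Gamma> i b y * y (noise_ix j))"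
  let ?B = "\<lambda>y. if b = None then (\<Sum>i<np \<Gamma>. own i j * (\<delta> / 2 * (weight \<Gamma> i y * slope \<Gamma> i y * slope \<Gamma> i y * y (noise_ix j)))) else 0"
  let ?C = "\<lambda>y. case j of Inl p \<Rightarrow> constr_coef \<Gamma> b y * y (2, p) | Inr _ \<Rightarrow> 0"
  note fm = gauss_intros fin_moments_weight fin_moments_slope fin_moments_grad_coef fin_moments_constr_coef
  have fA: "fin_moments gauss ?A" by (intro fm)
  have fB: "fin_moments gauss ?B" by (intro fin_moments_if fm)
  have fC: "fin_moments gauss ?C" by (cases j) (auto intro!: fm)
  have A: "(\<integral>y. ?A y \<partial>gauss) = 2 * (\<Sum>p\<in>xidx \<Gamma>. Gmat \<Gamma> (Inl p) j * Gmat1 \<Gamma> (Inl p) b)"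
  proof -
    have "(\<integral>y. ?A y \<partial>gauss) = (\<Sum>i<np \<Gamma>. own i j * (\<integral>y. weight \<Gamma> i y * slope \<Gamma> i y * grad_coef \<Gamma> i b y * y (noise_ix j) \<partial>gauss))"
      by (simp only: gauss_integral_sum fm integral_mult_right_zero)
    also have "\<dots> = (\<Sum>i<np \<Gamma>. \<Sum>k<dim \<Gamma>. 2 * (Gmat \<Gamma> (Inl (i, k)) j * Gmat1 \<Gamma> (Inl (i, k)) b))"
    proof (intro sum.cong refl)
      fix i assume "i \<in> {..<np \<Gamma>}"
      then have i: "i < np \<Gamma>" by simp
      \<comment> \<open>A multiplier occurs only in its owner's Lagrangian, so restricting its
        estimate to the owner discards only terms that are zero in the mean.\<close>
      have "own i j * Lrow \<Gamma> i p j = Lrow \<Gamma> i p j" for p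
        by (auto simp: own_def Lrow_def split: sum.splits)
      moreover have "Gmat1 \<Gamma> (Inl (i, k)) b = Lrow1 \<Gamma> i (i, k) b" for k
        by (auto simp: Gmat1_def Lrow1_def offset_def Gmat_Inl split: option.splits)
      ultimately show "own i j * (\<integral>y. weight \<Gamma> i y * slope \<Gamma> i y * grad_coef \<Gamma> i b y * y (noise_ix j) \<partial>gauss)
          = (\<Sum>k<dim \<Gamma>. 2 * (Gmat \<Gamma> (Inl (i, k)) j * Gmat1 \<Gamma> (Inl (i, k)) b))"
        unfolding mean_signal[OF i j] Gmat_Inl sum_distrib_left
        by (intro sum.cong refl) (simp add: mult.assoc[symmetric])
    qed
    finally show ?thesis by (simp add: sum_xidx sum_distrib_left)
  qed
  have B: "(\<integral>y. ?B y \<partial>gauss) = 0"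
  proof (cases b)
    case None
    then have "(\<integral>y. ?B y \<partial>gauss) = (\<Sum>i<np \<Gamma>. own i j * (\<delta> / 2 * (\<integral>y. weight \<Gamma> i y * slope \<Gamma> i y * slope \<Gamma> i y * y (noise_ix j) \<partial>gauss)))"
      by (simp only: if_True simp_thms gauss_integral_sum fm integral_mult_right_zero)
    then show ?thesis by (simp add: mean_bias)
  qed simp
  have C: "(\<integral>y. ?C y \<partial>gauss) = 2 * (\<Sum>q\<in>lidx \<Gamma>. Gmat \<Gamma> (Inr q) j * Gmat1 \<Gamma> (Inr q) b)"
  proof (cases j)
    case (Inl p)
    then have p: "p \<in> xidx \<Gamma>" using j by (auto simp: gidx_def)
    show ?thesis unfolding Inl sum.case mean_constr_coef[OF p] sum_lidx by simp
  next
    case (Inr q)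
    then show ?thesis by simp
  qed
  have "(\<integral>y. coef \<Gamma> \<delta> j b y \<partial>gauss) = (\<integral>y. ?A y \<partial>gauss) + (\<integral>y. ?B y \<partial>gauss) + (\<integral>y. ?C y \<partial>gauss)"
    unfolding coef_def
    by (simp only: Bochner_Integration.integral_add[OF Bochner_Integration.integrable_add[OF fin_moments_integrable[OF fA] fin_moments_integrable[OF fB]] fin_moments_integrable[OF fC]]
        Bochner_Integration.integral_add[OF fin_moments_integrable[OF fA] fin_moments_integrable[OF fB]])
  then show ?thesis unfolding A B C by (simp add: sum_gidx)
qed

section \<open>The zero-order process\<close>

locale zero_order_process = prob_space M for M :: "'w measure" +
  fixes \<Gamma> :: game and Z :: "nat \<times> nat \<times> (nat \<times> nat) \<Rightarrow> 'w \<Rightarrow> real"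
    and x0 l0 :: "nat \<times> nat \<Rightarrow> real" and g \<sigma> \<delta> :: real
  assumes game: "standing_game \<Gamma>"
    and indep: "indep_vars (\<lambda>_. borel) Z UNIV"
    and std_normal: "\<And>j. distributed M lborel (Z j) (\<lambda>u. ennreal (std_normal_density u))"
    and \<sigma>: "\<sigma> > 0" and \<delta>: "\<delta> > 0"
begin

definition state :: "nat \<Rightarrow> 'w \<Rightarrow> coord \<Rightarrow> real" where
  "state k \<omega> = case_sum (fst (zo_iter \<Gamma> \<sigma> \<delta> g x0 l0 Z k \<omega>)) (snd (zo_iter \<Gamma> \<sigma> \<delta> g x0 l0 Z k \<omega>))"

definition noise_at :: "nat \<Rightarrow> 'w \<Rightarrow> noise" where
  "noise_at t \<omega> = (\<lambda>ap. Z (t, ap) \<omega>)"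

definition Y :: "nat \<Rightarrow> 'w \<Rightarrow> coord \<Rightarrow> real" where
  "Y k \<omega> j = (\<Sum>b\<in>gidx1 \<Gamma>. homog (state k \<omega>) b * coef \<Gamma> \<delta> j b (noise_at (Suc k) \<omega>))"

lemma state_step:
  assumes "j \<in> gidx \<Gamma>"
  shows "state (Suc k) \<omega> j = state k \<omega> j - g / real (Suc k) * Y k \<omega> j"
proof -
  let ?s = "zo_step \<Gamma> \<sigma> \<delta> (g / real (Suc k)) (\<lambda>p. noise_at (Suc k) \<omega> (0, p)) (\<lambda>q. noise_at (Suc k) \<omega> (1, q))
    (\<lambda>p. noise_at (Suc k) \<omega> (2, p)) (zo_iter \<Gamma> \<sigma> \<delta> g x0 l0 Z k \<omega>)"
  have "state (Suc k) \<omega> j = case_sum (fst ?s) (snd ?s) j"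
    unfolding state_def zo_iter.simps noise_at_def ..
  also have "\<dots> = state k \<omega> j - g / real (Suc k) * Y k \<omega> j"
    unfolding state_def Y_def using \<sigma> \<delta> by (intro zo_step_eq[OF game _ _ assms]) auto
  finally show ?thesis .
qed

definition past :: "nat \<Rightarrow> (nat \<times> nat \<times> (nat \<times> nat)) set" where
  "past k = {j. fst j \<le> k}"

definition P :: "nat \<Rightarrow> 'w \<Rightarrow> nat \<times> nat \<times> (nat \<times> nat) \<Rightarrow> real" where
  "P k \<omega> = restrict (\<lambda>j. Z j \<omega>) (past k)"

text \<open>\<open>state k\<close> uses the noise of times 1 to k, and the step leaving it draws
  time \<open>Suc k\<close>. Past and fresh noise thus come from disjoint blocks of the family
  \<open>Z\<close>.\<close>

definition F :: "nat \<Rightarrow> 'w measure" where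
  "F k = vimage_algebra (space M) (P k) (PiM (past k) (\<lambda>_. borel))"

lemma Z_measurable [measurable]: "Z j \<in> borel_measurable M"
  using std_normal[of j] by (auto dest: distributed_measurable)

lemma P_measurable: "P k \<in> measurable M (PiM (past k) (\<lambda>_. borel))"
  unfolding P_def by (intro measurable_restrict Z_measurable)

lemma space_F: "space (F k) = space M"
  by (simp add: F_def)

lemma sub: "subalgebra M (F k)"
  using P_measurable[of k] unfolding subalgebra_def F_def measurable_iff_sets by simp

lemma Z_adapted: 
  assumes "fst j \<le> k"
  shows "Z j \<in> borel_measurable (F k)"
proof -
  have "P k \<in> measurable (F k) (PiM (past k) (\<lambda>_. borel))"
    unfolding F_def using P_measurable[of k] by (intro measurable_vimage_algebra1) (auto dest: measurable_space)
  then have "(\<lambda>\<omega>. P k \<omega> j) \<in> borel_measurable (F k)"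
    by (rule measurable_compose[OF _ measurable_component_singleton]) (simp add: past_def assms)
  then show ?thesis using assms by (simp add: P_def past_def)
qed

lemma mono: "subalgebra (F (Suc k)) (F k)"
proof -
  have "P k \<in> measurable (F (Suc k)) (PiM (past k) (\<lambda>_. borel))"
    unfolding P_def by (intro measurable_restrict Z_adapted) (simp add: past_def)
  then show ?thesis
    unfolding measurable_iff_sets subalgebra_def space_F by (simp add: F_def)
qed

lemma noise_at_measurable_gen:
  assumes "\<And>ap. Z (t, ap) \<in> borel_measurable N"
  shows "noise_at t \<in> measurable N gauss"
  unfolding measurable_cong_sets[OF refl sets_gauss] noise_at_def
  by (rule measurable_PiM_single') (auto simp: assms)

lemma noise_at_measurable [measurable]: "noise_at t \<in> measurable M gauss"
  by (rule noise_at_measurable_gen) measurable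

text \<open>Independence makes the law of the whole family a product, and the noise at time
  \<open>t\<close> is its image under reindexing along the injection of \<open>ap\<close> to
  \<open>(t, ap)\<close>.\<close>

lemma distr_noise_at: "distr M gauss (noise_at t) = gauss"
proof -
  have comp: "distr M borel (Z j) = std_normal_measure" for j
    using distributed_distr_eq_density[OF std_normal[of j]] by (metis (no_types) distr_cong sets_lborel)
  have "(\<lambda>j\<in>UNIV. Z j \<omega>) = (\<lambda>j. Z j \<omega>)" for \<omega> by (simp add: restrict_def)
  then have "distr M (PiM UNIV (\<lambda>_. borel)) (\<lambda>\<omega> j. Z j \<omega>) = gauss"
    using indep_vars_iff_distr_eq_PiM[where I=UNIV and M'="\<lambda>_. borel" and X=Z] indep
    by (simp add: comp gauss_def)
  then have all: "distr M gauss (\<lambda>\<omega> j. Z j \<omega>) = gauss"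
    by (metis (no_types) distr_cong sets_gauss)
  have Zall: "(\<lambda>\<omega> j. Z j \<omega>) \<in> measurable M gauss"
    unfolding measurable_cong_sets[OF refl sets_gauss]
    by (rule measurable_PiM_single') auto
  have re: "(\<lambda>y ap. y (t, ap)) \<in> measurable gauss gauss"
    unfolding measurable_cong_sets[OF refl sets_gauss]
    by (rule measurable_PiM_single') auto
  have "distr gauss gauss (\<lambda>y ap. y (t, ap)) = (gauss :: noise measure)"
    using distr_PiM_reindex[of UNIV "\<lambda>_. std_normal_measure" "\<lambda>ap. (t, ap)" UNIV] prob_space_std_normal
    by (simp add: inj_on_def restrict_def gauss_def)
  then have "gauss = distr (distr M gauss (\<lambda>\<omega> j. Z j \<omega>)) gauss (\<lambda>y ap. y (t, ap))"
    by (simp add: all)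
  also have "\<dots> = distr M gauss (noise_at t)"
    using distr_distr[OF re Zall] by (simp add: noise_at_def[abs_def] comp_def)
  finally show ?thesis by simp
qed

lemma expectation_noise_at:
  fixes f :: "noise \<Rightarrow> real"
  shows "f \<in> borel_measurable gauss \<Longrightarrow> expectation (\<lambda>\<omega>. f (noise_at t \<omega>)) = (\<integral>y. f y \<partial>gauss)"
  using integral_distr[OF noise_at_measurable, of f t] by (simp add: distr_noise_at)

lemma integrable_noise_at:
  fixes f :: "noise \<Rightarrow> real"
  shows "f \<in> borel_measurable gauss \<Longrightarrow> integrable M (\<lambda>\<omega>. f (noise_at t \<omega>)) \<longleftrightarrow> integrable gauss f"
  using integrable_distr_eq[OF noise_at_measurable, of f t] by (simp add: distr_noise_at)

text \<open>\<open>h\<close> is only known to be measurable in \<open>F k\<close>, not given as a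
  function of \<open>P k\<close>. Independence of the two blocks is therefore carried over by
  inclusion of the generated sigma-algebras.\<close>

lemma indep_past_noise:
  fixes f :: "noise \<Rightarrow> real" and h :: "'w \<Rightarrow> real"
  assumes h: "h \<in> borel_measurable (F k)" and f: "f \<in> borel_measurable gauss"
  shows "indep_var borel h borel (\<lambda>\<omega>. f (noise_at (Suc k) \<omega>))"
proof -
  let ?B = "{j. fst j = Suc k} :: (nat \<times> nat \<times> (nat \<times> nat)) set"
  let ?N = "\<lambda>\<omega>. restrict (\<lambda>j. Z j \<omega>) ?B"
  let ?PP = "{P k -` A \<inter> space M |A. A \<in> sets (PiM (past k) (\<lambda>_. borel))}"
  let ?NN = "{?N -` A \<inter> space M |A. A \<in> sets (PiM ?B (\<lambda>_. borel))}"
  have "indep_var (PiM (past k) (\<lambda>_. borel)) (P k) (PiM ?B (\<lambda>_. borel)) ?N"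
    unfolding P_def by (rule indep_var_restrict[OF indep]) (auto simp: past_def)
  then have ind: "indep_set (sigma_sets (space M) ?PP) (sigma_sets (space M) ?NN)"
    and N: "?N \<in> measurable M (PiM ?B (\<lambda>_. borel))"
    unfolding indep_var_eq by auto
  have F_sets: "sets (F k) = ?PP"
    unfolding F_def using P_measurable[of k] by (intro sets_vimage_algebra2) (auto dest: measurable_space)
  have "{h -` A \<inter> space M |A. A \<in> sets borel} \<subseteq> ?PP"
    using measurable_sets[OF h] unfolding F_sets[symmetric] space_F by auto
  then have 1: "sigma_sets (space M) {h -` A \<inter> space M |A. A \<in> sets borel} \<subseteq> sigma_sets (space M) ?PP"
    by (rule sigma_sets_subseteq)
  define e where "e = f \<circ> (\<lambda>x ap. x (Suc k, ap))"
  have "(\<lambda>x ap. x (Suc k, ap)) \<in> measurable (PiM ?B (\<lambda>_. borel :: real measure)) gauss"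
    unfolding measurable_cong_sets[OF refl sets_gauss]
    by (rule measurable_PiM_single') (auto intro: measurable_component_singleton)
  then have e: "e \<in> borel_measurable (PiM ?B (\<lambda>_. borel))"
    unfolding e_def using f by (rule measurable_comp)
  have fe: "f (noise_at (Suc k) \<omega>) = e (?N \<omega>)" for \<omega>
    by (simp add: e_def noise_at_def)
  have "(\<lambda>\<omega>. f (noise_at (Suc k) \<omega>)) -` A \<inter> space M \<in> ?NN" if "A \<in> sets borel" for A
  proof -
    have "(\<lambda>\<omega>. f (noise_at (Suc k) \<omega>)) -` A \<inter> space M = ?N -` (e -` A \<inter> space (PiM ?B (\<lambda>_. borel))) \<inter> space M"
      using measurable_space[OF N] unfolding fe by auto
    moreover have "e -` A \<inter> space (PiM ?B (\<lambda>_. borel)) \<in> sets (PiM ?B (\<lambda>_. borel))"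
      using e that by (rule measurable_sets)
    ultimately show ?thesis by blast
  qed
  then have "{(\<lambda>\<omega>. f (noise_at (Suc k) \<omega>)) -` A \<inter> space M |A. A \<in> sets borel} \<subseteq> ?NN"
    by blast
  then have 2: "sigma_sets (space M) {(\<lambda>\<omega>. f (noise_at (Suc k) \<omega>)) -` A \<inter> space M |A. A \<in> sets borel}
      \<subseteq> sigma_sets (space M) ?NN"
    by (rule sigma_sets_subseteq)
  have "indep_set (sigma_sets (space M) {h -` A \<inter> space M |A. A \<in> sets borel})
      (sigma_sets (space M) {(\<lambda>\<omega>. f (noise_at (Suc k) \<omega>)) -` A \<inter> space M |A. A \<in> sets borel})"
    unfolding indep_set_def
    by (rule indep_sets_mono_sets[OF ind[unfolded indep_set_def]]) (use 1 2 in \<open>auto split: bool.split\<close>)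
  moreover have "h \<in> borel_measurable M" by (rule measurable_from_subalg[OF sub h])
  moreover have "(\<lambda>\<omega>. f (noise_at (Suc k) \<omega>)) \<in> borel_measurable M"
    by (rule measurable_compose[OF noise_at_measurable f])
  ultimately show ?thesis unfolding indep_var_eq by blast
qed

text \<open>With an arbitrary measure space \<open>N\<close> the induction on the step leaves the
  sigma-algebra fixed; \<open>F k\<close> is substituted afterwards.\<close>

lemma state_measurable_gen:
  assumes "\<And>j. fst j \<le> k \<Longrightarrow> Z j \<in> borel_measurable N" "c \<in> gidx \<Gamma>"
  shows "(\<lambda>\<omega>. state k \<omega> c) \<in> borel_measurable N"
  using assms
proof (induction k arbitrary: c)
  case 0
  then show ?case by (simp add: state_def)
next
  case (Suc k)
  have z: "(\<lambda>\<omega>. state k \<omega> c) \<in> borel_measurable N" if "c \<in> gidx \<Gamma>" for c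
    using Suc.prems(1) that by (intro Suc.IH) auto
  have homog: "(\<lambda>\<omega>. homog (state k \<omega>) b) \<in> borel_measurable N" if "b \<in> gidx1 \<Gamma>" for b
    using that z by (auto simp: homog_def gidx1_def)
  have "noise_at (Suc k) \<in> measurable N gauss"
    using Suc.prems(1) by (intro noise_at_measurable_gen) simp
  then have "(\<lambda>\<omega>. coef \<Gamma> \<delta> j b (noise_at (Suc k) \<omega>)) \<in> borel_measurable N" for j b
    by (rule measurable_compose[OF _ fin_moments_measurable[OF fin_moments_coef]])
  then show ?case
    unfolding state_step[OF Suc.prems(2)] Y_def
    by (intro borel_measurable_diff borel_measurable_times borel_measurable_sum z homog Suc.prems(2)) auto
qed

lemma state_adapted: "c \<in> gidx \<Gamma> \<Longrightarrow> (\<lambda>\<omega>. state k \<omega> c) \<in> borel_measurable (F k)"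
  by (rule state_measurable_gen[OF Z_adapted])

lemma homog_adapted: "b \<in> gidx1 \<Gamma> \<Longrightarrow> (\<lambda>\<omega>. homog (state k \<omega>) b) \<in> borel_measurable (F k)"
  using state_adapted by (auto simp: homog_def gidx1_def)

lemma expectation_past_noise:
  fixes f :: "noise \<Rightarrow> real" and h :: "'w \<Rightarrow> real"
  assumes h: "h \<in> borel_measurable (F k)" "integrable M h" and f: "f \<in> borel_measurable gauss" "integrable gauss f"
  shows "expectation (\<lambda>\<omega>. h \<omega> * f (noise_at (Suc k) \<omega>)) = expectation h * (\<integral>y. f y \<partial>gauss)"
    and "integrable M (\<lambda>\<omega>. h \<omega> * f (noise_at (Suc k) \<omega>))"
proof -
  note ind = indep_past_noise[OF h(1) f(1)]
  have i: "integrable M (\<lambda>\<omega>. f (noise_at (Suc k) \<omega>))" using integrable_noise_at[OF f(1)] f(2) by simp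
  show "expectation (\<lambda>\<omega>. h \<omega> * f (noise_at (Suc k) \<omega>)) = expectation h * (\<integral>y. f y \<partial>gauss)"
    using indep_var_lebesgue_integral[OF ind h(2) i] expectation_noise_at[OF f(1)] by simp
  show "integrable M (\<lambda>\<omega>. h \<omega> * f (noise_at (Suc k) \<omega>))"
    by (rule indep_var_integrable[OF ind h(2) i])
qed

lemma sq_int_past_noise:
  assumes h: "h \<in> borel_measurable (F k)" "sq_int M h" and f: "fin_moments gauss f"
  shows "sq_int M (\<lambda>\<omega>. h \<omega> * f (noise_at (Suc k) \<omega>))"
    and "expectation (\<lambda>\<omega>. (h \<omega> * f (noise_at (Suc k) \<omega>))\<^sup>2) = expectation (\<lambda>\<omega>. (h \<omega>)\<^sup>2) * (\<integral>y. (f y)\<^sup>2 \<partial>gauss)"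
proof -
  have fm: "f \<in> borel_measurable gauss" using f by (rule fin_moments_measurable)
  have sq: "(\<lambda>\<omega>. (h \<omega>)\<^sup>2) \<in> borel_measurable (F k)" "integrable M (\<lambda>\<omega>. (h \<omega>)\<^sup>2)"
      "(\<lambda>y. (f y)\<^sup>2) \<in> borel_measurable gauss" "integrable gauss (\<lambda>y. (f y)\<^sup>2)"
    using h fm fin_moments_sq_int[OF f] by (auto simp: sq_int_def)
  note * = expectation_past_noise[OF sq]
  have "(\<lambda>\<omega>. h \<omega> * f (noise_at (Suc k) \<omega>)) \<in> borel_measurable M"
    using h(2) measurable_compose[OF noise_at_measurable fm] by (intro borel_measurable_times) (auto simp: sq_int_def)
  then show "sq_int M (\<lambda>\<omega>. h \<omega> * f (noise_at (Suc k) \<omega>))"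
    using *(2) by (simp add: sq_int_def power_mult_distrib)
  show "expectation (\<lambda>\<omega>. (h \<omega> * f (noise_at (Suc k) \<omega>))\<^sup>2) = expectation (\<lambda>\<omega>. (h \<omega>)\<^sup>2) * (\<integral>y. (f y)\<^sup>2 \<partial>gauss)"
    using *(1) by (simp add: power_mult_distrib)
qed

section \<open>First and second moments of the search direction along the process\<close>

lemma Y_sq_if:
  assumes "\<And>c. c \<in> gidx \<Gamma> \<Longrightarrow> sq_int M (\<lambda>\<omega>. state k \<omega> c)"
  shows "sq_int M (\<lambda>\<omega>. Y k \<omega> j)"
proof -
  have "sq_int M (\<lambda>\<omega>. homog (state k \<omega>) b)" if "b \<in> gidx1 \<Gamma>" for b
    using that assms by (auto simp: homog_def gidx1_def sq_int_const)
  then show ?thesis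
    unfolding Y_def by (intro sq_int_sum sq_int_past_noise homog_adapted fin_moments_coef)
qed

lemma state_sq: "c \<in> gidx \<Gamma> \<Longrightarrow> sq_int M (\<lambda>\<omega>. state k \<omega> c)"
proof (induction k arbitrary: c)
  case 0
  then show ?case by (simp add: state_def sq_int_const)
next
  case (Suc k)
  then show ?case
    unfolding state_step[OF Suc.prems] by (intro sq_int_diff sq_int_scale Y_sq_if) auto
qed

lemma Y_sq: "sq_int M (\<lambda>\<omega>. Y k \<omega> j)"
  by (intro Y_sq_if state_sq)

lemma homog_sq: "b \<in> gidx1 \<Gamma> \<Longrightarrow> sq_int M (\<lambda>\<omega>. homog (state k \<omega>) b)"
  using state_sq by (auto simp: homog_def gidx1_def sq_int_const)

text \<open>The product of a state coordinate with the test function is a past factor, so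
  independence replaces each coefficient by its mean; exchanging the finite sums reassembles the
  gradient of F.\<close>

lemma Y_mean:
  assumes j: "j \<in> gidx \<Gamma>" and h: "h \<in> borel_measurable (F k)" "sq_int M h"
  shows "expectation (\<lambda>\<omega>. Y k \<omega> j * h \<omega>)
    = expectation (\<lambda>\<omega>. 2 * matvec (tr (Gmat \<Gamma>)) (gidx \<Gamma>) (residual \<Gamma> (state k \<omega>)) j * h \<omega>)"
proof -
  let ?I = "gidx1 \<Gamma>" and ?z = "\<lambda>b \<omega>. homog (state k \<omega>) b"
  have ad: "(\<lambda>\<omega>. ?z b \<omega> * h \<omega>) \<in> borel_measurable (F k)" if "b \<in> ?I" for b
    using homog_adapted[OF that] h(1) by (rule borel_measurable_times)
  have int: "integrable M (\<lambda>\<omega>. ?z b \<omega> * h \<omega>)" if "b \<in> ?I" for b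
    using homog_sq[OF that] h(2) by (rule integrable_mult_sq_int)
  note cm = fin_moments_measurable[OF fin_moments_coef] fin_moments_integrable[OF fin_moments_coef]
  have "expectation (\<lambda>\<omega>. Y k \<omega> j * h \<omega>)
      = expectation (\<lambda>\<omega>. \<Sum>b\<in>?I. (?z b \<omega> * h \<omega>) * coef \<Gamma> \<delta> j b (noise_at (Suc k) \<omega>))"
    by (simp add: Y_def sum_distrib_right sum_distrib_left mult_ac)
  also have "\<dots> = (\<Sum>b\<in>?I. expectation (\<lambda>\<omega>. ?z b \<omega> * h \<omega>) * (2 * (\<Sum>r\<in>gidx \<Gamma>. Gmat \<Gamma> r j * Gmat1 \<Gamma> r b)))"
    using expectation_past_noise[OF ad int cm] by (simp add: mean_coef[OF j])
  also have "\<dots> = expectation (\<lambda>\<omega>. \<Sum>b\<in>?I. (?z b \<omega> * h \<omega>) * (2 * (\<Sum>r\<in>gidx \<Gamma>. Gmat \<Gamma> r j * Gmat1 \<Gamma> r b)))"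
    by (subst Bochner_Integration.integral_sum) (auto intro!: int)
  also have "\<dots> = expectation (\<lambda>\<omega>. 2 * matvec (tr (Gmat \<Gamma>)) (gidx \<Gamma>) (residual \<Gamma> (state k \<omega>)) j * h \<omega>)"
  proof (intro Bochner_Integration.integral_cong refl)
    fix \<omega>
    have "(\<Sum>b\<in>?I. (?z b \<omega> * h \<omega>) * (2 * (\<Sum>r\<in>gidx \<Gamma>. Gmat \<Gamma> r j * Gmat1 \<Gamma> r b)))
        = (\<Sum>b\<in>?I. \<Sum>r\<in>gidx \<Gamma>. 2 * (Gmat \<Gamma> r j * (?z b \<omega> * Gmat1 \<Gamma> r b)) * h \<omega>)"
      by (simp add: sum_distrib_left mult_ac)
    also have "\<dots> = (\<Sum>r\<in>gidx \<Gamma>. \<Sum>b\<in>?I. 2 * (Gmat \<Gamma> r j * (?z b \<omega> * Gmat1 \<Gamma> r b)) * h \<omega>)"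
      by (rule sum.swap)
    also have "\<dots> = 2 * matvec (tr (Gmat \<Gamma>)) (gidx \<Gamma>) (residual \<Gamma> (state k \<omega>)) j * h \<omega>"
      unfolding matvec_def residual_affine sum_distrib_left sum_distrib_right ..
    finally show "(\<Sum>b\<in>?I. (?z b \<omega> * h \<omega>) * (2 * (\<Sum>r\<in>gidx \<Gamma>. Gmat \<Gamma> r j * Gmat1 \<Gamma> r b)))
        = 2 * matvec (tr (Gmat \<Gamma>)) (gidx \<Gamma>) (residual \<Gamma> (state k \<omega>)) j * h \<omega>" .
  qed
  finally show ?thesis .
qed

lemma homog_second:
  assumes b: "b \<in> gidx1 \<Gamma>"
  shows "expectation (\<lambda>\<omega>. (homog (state k \<omega>) b)\<^sup>2)
    \<le> (2 + 2 * ip (gidx \<Gamma>) zs zs) * (1 + expectation (\<lambda>\<omega>. ip (gidx \<Gamma>) (\<lambda>c. state k \<omega> c - zs c) (\<lambda>c. state k \<omega> c - zs c)))"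
proof -
  let ?d = "\<lambda>\<omega>. ip (gidx \<Gamma>) (\<lambda>c. state k \<omega> c - zs c) (\<lambda>c. state k \<omega> c - zs c)"
  have int: "integrable M ?d"
    unfolding ip_def
    by (intro Bochner_Integration.integrable_sum integrable_mult_sq_int sq_int_diff sq_int_const state_sq)
  have "(homog (state k \<omega>) b)\<^sup>2 \<le> (2 + 2 * ip (gidx \<Gamma>) zs zs) * (1 + ?d \<omega>)" for \<omega>
  proof -
    have d: "0 \<le> ?d \<omega>" and n: "0 \<le> ip (gidx \<Gamma>) zs zs" by (rule ip_nonneg)+
    have "(homog (state k \<omega>) b)\<^sup>2 \<le> 1 + 2 * ip (gidx \<Gamma>) zs zs + 2 * ?d \<omega>"
    proof (cases b)
      case None
      then show ?thesis using d n by (simp add: homog_def)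
    next
      case (Some c)
      then have c: "c \<in> gidx \<Gamma>" using b by (auto simp: gidx1_def)
      \<comment> \<open>Right side minus left side is the square of
        \<open>state k \<omega> c - 2 * zs c\<close>.\<close>
      have "(state k \<omega> c)\<^sup>2 \<le> 2 * (state k \<omega> c - zs c)\<^sup>2 + 2 * (zs c)\<^sup>2"
        using zero_le_power2[of "state k \<omega> c - 2 * zs c"] by (simp add: power2_eq_square algebra_simps)
      moreover have "(zs c)\<^sup>2 \<le> ip (gidx \<Gamma>) zs zs" "(state k \<omega> c - zs c)\<^sup>2 \<le> ?d \<omega>"
        using square_le_ip[OF finite_gidx c, of zs] square_le_ip[OF finite_gidx c, of "\<lambda>c. state k \<omega> c - zs c"] by auto
      ultimately show ?thesis unfolding Some homog_def option.case by linarith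
    qed
    also have "\<dots> \<le> (2 + 2 * ip (gidx \<Gamma>) zs zs) * (1 + ?d \<omega>)"
      using mult_nonneg_nonneg[OF n d] by (simp add: algebra_simps)
    finally show ?thesis .
  qed
  then have "expectation (\<lambda>\<omega>. (homog (state k \<omega>) b)\<^sup>2) \<le> expectation (\<lambda>\<omega>. (2 + 2 * ip (gidx \<Gamma>) zs zs) * (1 + ?d \<omega>))"
    using int by (intro integral_mono sq_int_square[OF homog_sq[OF b]]) auto
  also have "\<dots> = (2 + 2 * ip (gidx \<Gamma>) zs zs) * (1 + expectation ?d)"
    using int by (simp add: prob_space)
  finally show ?thesis .
qed

text \<open>Cauchy-Schwarz over the homogeneous coordinates contributes the cardinality, and
  independence splits each square into a state moment and a coefficient moment. Summing over all
  directions in \<open>K\<close> makes the constant independent of \<open>j\<close> and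
  \<open>k\<close>.\<close>

lemma Y_second:
  fixes zs :: "coord \<Rightarrow> real"
  assumes j: "j \<in> gidx \<Gamma>"
  defines "K \<equiv> real (card (gidx1 \<Gamma>)) * (2 + 2 * ip (gidx \<Gamma>) zs zs)
      * (\<Sum>j\<in>gidx \<Gamma>. \<Sum>b\<in>gidx1 \<Gamma>. \<integral>y. (coef \<Gamma> \<delta> j b y)\<^sup>2 \<partial>gauss)"
  shows "expectation (\<lambda>\<omega>. (Y k \<omega> j)\<^sup>2)
    \<le> K * (1 + expectation (\<lambda>\<omega>. ip (gidx \<Gamma>) (\<lambda>c. state k \<omega> c - zs c) (\<lambda>c. state k \<omega> c - zs c)))"
proof -
  let ?a = "1 + expectation (\<lambda>\<omega>. ip (gidx \<Gamma>) (\<lambda>c. state k \<omega> c - zs c) (\<lambda>c. state k \<omega> c - zs c))"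
  let ?s = "2 + 2 * ip (gidx \<Gamma>) zs zs" and ?n = "real (card (gidx1 \<Gamma>))"
  let ?q = "\<lambda>j b. \<integral>y. (coef \<Gamma> \<delta> j b y)\<^sup>2 \<partial>gauss"
  have a: "0 \<le> ?a" by (simp add: ip_nonneg add_nonneg_nonneg)
  have s: "0 \<le> ?s" by (simp add: ip_nonneg)
  note sq = sq_int_past_noise[OF homog_adapted homog_sq fin_moments_coef]
  have "expectation (\<lambda>\<omega>. (Y k \<omega> j)\<^sup>2)
      \<le> expectation (\<lambda>\<omega>. (\<Sum>b\<in>gidx1 \<Gamma>. (homog (state k \<omega>) b * coef \<Gamma> \<delta> j b (noise_at (Suc k) \<omega>))\<^sup>2) * ?n)"
  proof (rule integral_mono)
    show "integrable M (\<lambda>\<omega>. (Y k \<omega> j)\<^sup>2)" by (rule sq_int_square[OF Y_sq])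
    show "integrable M (\<lambda>\<omega>. (\<Sum>b\<in>gidx1 \<Gamma>. (homog (state k \<omega>) b * coef \<Gamma> \<delta> j b (noise_at (Suc k) \<omega>))\<^sup>2) * ?n)"
      by (intro integrable_mult_left Bochner_Integration.integrable_sum sq_int_square sq)
    show "(Y k \<omega> j)\<^sup>2 \<le> (\<Sum>b\<in>gidx1 \<Gamma>. (homog (state k \<omega>) b * coef \<Gamma> \<delta> j b (noise_at (Suc k) \<omega>))\<^sup>2) * ?n" for \<omega>
      unfolding Y_def by (rule sum_squared_le_sum_of_squares)
  qed
  also have "\<dots> = (\<Sum>b\<in>gidx1 \<Gamma>. expectation (\<lambda>\<omega>. (homog (state k \<omega>) b * coef \<Gamma> \<delta> j b (noise_at (Suc k) \<omega>))\<^sup>2)) * ?n"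
    by (simp only: integral_mult_left_zero) (subst Bochner_Integration.integral_sum; auto intro!: sq_int_square sq)
  also have "\<dots> = (\<Sum>b\<in>gidx1 \<Gamma>. expectation (\<lambda>\<omega>. (homog (state k \<omega>) b)\<^sup>2) * ?q j b) * ?n"
    by (simp add: sq(2))
  also have "\<dots> \<le> (\<Sum>b\<in>gidx1 \<Gamma>. (?s * ?a) * ?q j b) * ?n"
    by (intro mult_right_mono sum_mono homog_second) auto
  also have "\<dots> = ?n * ?s * ?a * (\<Sum>b\<in>gidx1 \<Gamma>. ?q j b)"
    unfolding sum_distrib_left[symmetric] by (simp add: mult_ac)
  also have "\<dots> \<le> ?n * ?s * ?a * (\<Sum>j\<in>gidx \<Gamma>. \<Sum>b\<in>gidx1 \<Gamma>. ?q j b)"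
    using a s by (intro mult_left_mono member_le_sum[OF j] finite_gidx sum_nonneg mult_nonneg_nonneg) auto
  also have "\<dots> = K * ?a" by (simp add: K_def mult_ac)
  finally show ?thesis .
qed

lemma stochastic_descent:
  assumes nz: "\<exists>s. 0 < s \<and> sing_val \<Gamma> s" and g: "g > 1 / (2 * (sigma_min_pos \<Gamma>)\<^sup>2)"
    and zs: "\<forall>r\<in>gidx \<Gamma>. residual \<Gamma> zs r = 0"
  shows "\<exists>K m'. linear_stochastic_descent M F (gidx \<Gamma>) (gidx \<Gamma>) (Gmat \<Gamma>) state Y zs g K ((sigma_min_pos \<Gamma>)\<^sup>2) m'"
proof -
  let ?G = "Gmat \<Gamma>" and ?I = "gidx \<Gamma>"
  \<comment> \<open>The gap lemma is used a second time, on the transpose; only the positivity of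
    \<open>m'\<close> matters.\<close>
  have "\<exists>c\<in>?I. \<exists>r\<in>?I. tr ?G c r \<noteq> 0" using sigma_min_pos_gap(3)[OF nz] by blast
  then obtain m' where m': "m' > 0" and gap': "\<And>v. m' * ip ?I (matvec (tr ?G) ?I v) (matvec (tr ?G) ?I v)
      \<le> ip ?I (matvec ?G ?I (matvec (tr ?G) ?I v)) (matvec ?G ?I (matvec (tr ?G) ?I v))"
    using spectral_gap[OF finite_gidx finite_gidx, of \<Gamma> \<Gamma> "tr ?G"] by metis
  let ?K = "real (card (gidx1 \<Gamma>)) * (2 + 2 * ip ?I zs zs)
      * (\<Sum>j\<in>?I. \<Sum>b\<in>gidx1 \<Gamma>. \<integral>y. (coef \<Gamma> \<delta> j b y)\<^sup>2 \<partial>gauss)"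
  have res: "matvec ?G ?I (\<lambda>c. z c - zs c) r = residual \<Gamma> z r" if "r \<in> ?I" for z r
    using bspec[OF zs that] unfolding matvec_diff residual_def by linarith
  have K: "0 \<le> ?K"
    by (intro mult_nonneg_nonneg sum_nonneg add_nonneg_nonneg ip_nonneg) auto
  have s: "0 < (sigma_min_pos \<Gamma>)\<^sup>2" using sigma_min_pos_gap(1)[OF nz] by simp
  have "linear_stochastic_descent M F ?I ?I ?G state Y zs g ?K ((sigma_min_pos \<Gamma>)\<^sup>2) m'"
  proof
    show "expectation (\<lambda>\<omega>. Y k \<omega> c * h \<omega>)
        = expectation (\<lambda>\<omega>. 2 * matvec (tr ?G) ?I (matvec ?G ?I (\<lambda>c. state k \<omega> c - zs c)) c * h \<omega>)"
      if "c \<in> ?I" "h \<in> borel_measurable (F k)" "sq_int M h" for k c h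
    proof -
      have "matvec (tr ?G) ?I (matvec ?G ?I (\<lambda>c. state k \<omega> c - zs c)) = matvec (tr ?G) ?I (residual \<Gamma> (state k \<omega>))" for \<omega>
        by (rule matvec_cong) (rule res)
      then show ?thesis using Y_mean[OF that] by simp
    qed
    \<comment> \<open>This is g > 1/mu_F with mu_F = 2 sigma^2, doubled.\<close>
    show "2 \<le> 4 * (sigma_min_pos \<Gamma>)\<^sup>2 * g"
      using g s by (simp add: field_simps)
  qed (assumption | rule finite_gidx sub mono state_adapted state_sq Y_sq state_step K Y_second s sigma_min_pos_gap(2)[OF nz] m' gap')+
  then show ?thesis by blast
qed

end

theorem theorem1:
  fixes \<Gamma> :: game
    and M :: "'w measure"
    and Z :: "nat \<times> nat \<times> (nat \<times> nat) \<Rightarrow> 'w \<Rightarrow> real"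
    and x0 l0 :: "nat \<times> nat \<Rightarrow> real"
    and g \<sigma> \<delta> :: real
  assumes game: "standing_game \<Gamma>"
    and GNE_exists: "\<exists>x. is_GNE \<Gamma> x"
    and G_nonzero: "\<exists>s. 0 < s \<and> sing_val \<Gamma> s"
    and prob: "prob_space M"
    and indep: "prob_space.indep_vars M (\<lambda>_. borel) Z UNIV"
    and gauss: "\<And>j. distributed M lborel (Z j) (\<lambda>u. ennreal (std_normal_density u))"
    and g_gt: "g > 1 / (2 * (sigma_min_pos \<Gamma>)\<^sup>2)"
    and sigma_pos: "\<sigma> > 0"
    and delta_pos: "\<delta> > 0"
  shows "(AE \<omega> in M. \<exists>xs. is_GNE \<Gamma> xs \<and>
            (\<forall>p\<in>xidx \<Gamma>. (\<lambda>k. fst (zo_iter \<Gamma> \<sigma> \<delta> g x0 l0 Z k \<omega>) p) \<longlonglongrightarrow> xs p)) \<and>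
         (\<forall>k. integrable M (\<lambda>\<omega>. Ffun \<Gamma> (fst (zo_iter \<Gamma> \<sigma> \<delta> g x0 l0 Z k \<omega>)) (snd (zo_iter \<Gamma> \<sigma> \<delta> g x0 l0 Z k \<omega>)))) \<and>
         (\<lambda>k. prob_space.expectation M (\<lambda>\<omega>. Ffun \<Gamma> (fst (zo_iter \<Gamma> \<sigma> \<delta> g x0 l0 Z k \<omega>)) (snd (zo_iter \<Gamma> \<sigma> \<delta> g x0 l0 Z k \<omega>))))
           \<in> O(\<lambda>k. 1 / real (Suc k))"
proof -
  let ?it = "zo_iter \<Gamma> \<sigma> \<delta> g x0 l0 Z" and ?I = "gidx \<Gamma>"
  interpret zero_order_process M \<Gamma> Z x0 l0 g \<sigma> \<delta>
    by (rule zero_order_process.intro[OF prob zero_order_process_axioms.intro[OF game indep gauss sigma_pos delta_pos]])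
  \<comment> \<open>The given equilibrium with its multipliers provides the reference zero; the
    limit will in general be a different, random one.\<close>
  obtain x lam where zs: "\<forall>r\<in>?I. residual \<Gamma> (case_sum x lam) r = 0"
    using GNE_exists GNE_imp_residual_zero[OF game] by blast
  let ?zs = "case_sum x lam"
  obtain K m' where "linear_stochastic_descent M F ?I ?I (Gmat \<Gamma>) state Y ?zs g K ((sigma_min_pos \<Gamma>)\<^sup>2) m'"
    using stochastic_descent[OF G_nonzero g_gt zs] by blast
  then interpret sd: linear_stochastic_descent M F ?I ?I "Gmat \<Gamma>" state Y ?zs g K "(sigma_min_pos \<Gamma>)\<^sup>2" m' .
  have res: "matvec (Gmat \<Gamma>) ?I (\<lambda>c. z c - ?zs c) r = residual \<Gamma> z r" if "r \<in> ?I" for z r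
    using bspec[OF zs that] unfolding matvec_diff residual_def by linarith
  have F_eq: "Ffun \<Gamma> (fst (?it k \<omega>)) (snd (?it k \<omega>)) = ip ?I (sd.u k \<omega>) (sd.u k \<omega>)" for k \<omega>
  proof -
    have "residual \<Gamma> (state k \<omega>) r = sd.u k \<omega> r" if "r \<in> ?I" for r
      unfolding sd.u_def sd.v_fun using res[OF that] by simp
    then show ?thesis unfolding Ffun_eq state_def[symmetric] by (intro ip_cong)
  qed
  have "AE \<omega> in M. \<exists>xs. is_GNE \<Gamma> xs \<and> (\<forall>p\<in>xidx \<Gamma>. (\<lambda>k. fst (?it k \<omega>) p) \<longlonglongrightarrow> xs p)"
    using sd.AE_convergent
  proof eventually_elim
    case (elim \<omega>)
    then obtain w where w: "\<And>c. c \<in> ?I \<Longrightarrow> (\<lambda>k. state k \<omega> c) \<longlonglongrightarrow> w c"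
      and Gw: "\<And>r. r \<in> ?I \<Longrightarrow> matvec (Gmat \<Gamma>) ?I (\<lambda>c. w c - ?zs c) r = 0"
      by blast
    \<comment> \<open>The limit differs from the reference zero by a kernel vector, so its residual
      vanishes as well and the KKT conditions apply to its x-component.\<close>
    have w0: "residual \<Gamma> w r = 0" if "r \<in> ?I" for r
      using Gw[OF that] unfolding res[OF that] .
    have "case_sum (\<lambda>p. w (Inl p)) (\<lambda>q. w (Inr q)) = w" by (auto simp: fun_eq_iff split: sum.splits)
    then have "is_GNE \<Gamma> (\<lambda>p. w (Inl p))"
      using w0 by (intro residual_zero_imp_GNE[OF game, of _ "\<lambda>q. w (Inr q)"]) simp
    moreover have "(\<lambda>k. fst (?it k \<omega>) p) \<longlonglongrightarrow> w (Inl p)" if "p \<in> xidx \<Gamma>" for p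
      using w[of "Inl p"] that by (simp add: gidx_def state_def)
    ultimately show ?case by blast
  qed
  moreover have "integrable M (\<lambda>\<omega>. Ffun \<Gamma> (fst (?it k \<omega>)) (snd (?it k \<omega>)))" for k
    unfolding F_eq by (intro sd.integrable_ip sd.u_sq)
  moreover have "(\<lambda>k. expectation (\<lambda>\<omega>. Ffun \<Gamma> (fst (?it k \<omega>)) (snd (?it k \<omega>)))) \<in> O(\<lambda>k. 1 / real (Suc k))"
  proof -
    \<comment> \<open>Index \<open>k\<close> stands for time t = k + 1, so the bound with
      \<open>Suc k\<close> is the rate 1/t.\<close>
    obtain D where "\<And>k. expectation (\<lambda>\<omega>. ip ?I (sd.u k \<omega>) (sd.u k \<omega>)) \<le> D / real (Suc k)"
      using sd.expected_residual_bound by blast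
    then show ?thesis
      unfolding F_eq by (intro bigoI[of _ D] always_eventually allI) (simp add: ip_nonneg)
  qed
  ultimately show ?thesis by blast
qed

end
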